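(* Let $0 \leq \alpha < 1$, $k \geq 3$, and let $n$ be such that $m = \frac{n-1}{k-1}$ is an integer with $m \geq 13$. Let $$\mathcal{T}^{(8)}(n,k)=\{\mathcal{S}_{m+1}^k, \mathcal{S}_{1,m-2}^k, \mathcal{S}_{2,m-3}^k, \mathcal{T}(1,1,m-3), \mathcal{S}_{1,m-4,1}^k, \mathcal{S}_{m-3,0,1}^k, \mathcal{S}_{3,m-4}^k, \mathcal{T}(1,2,m-4)\}.$$ Then for every supertree $\mathcal{T} \in \mathcal{T}(n,k) \setminus \mathcal{T}^{(8)}(n,k)$, $$\rho_\alpha(\mathcal{S}_{m+1}^k) > \rho_\alpha(\mathcal{S}_{1,m-2}^k) > \rho_\alpha(\mathcal{S}_{2,m-3}^k) > \rho_\alpha(\mathcal{T}(1,1,m-3)) > \rho_\alpha(\mathcal{S}_{1,m-4,1}^k) > \rho_\alpha(\mathcal{S}_{m-3,0,1}^k) > \rho_\alpha(\mathcal{S}_{3,m-4}^k) > \rho_\alpha(\mathcal{T}(1,2,m-4)) > \rho_\alpha(\mathcal{T}).$$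
   Context: A $k$-uniform hypergraph $\mathcal{G}$ has vertex set $V=\{v_1,\dots,v_n\}$ and edge set $E$ consisting of $k$-element subsets of $V$; the degree $d_v$ of a vertex is the number of edges containing it. The adjacency tensor $\mathcal{A}(\mathcal{G})=(a_{i_1\cdots i_k})$ is the order-$k$, dimension-$n$ tensor with $a_{i_1\cdots i_k}=\frac{1}{(k-1)!}$ if $\{v_{i_1},\dots,v_{i_k}\}\in E$ and $0$ otherwise; $\mathcal{D}(\mathcal{G})$ is the diagonal order-$k$ tensor with $d_{i\cdots i}=d_{v_i}$ and all other entries $0$. For $0\le\alpha<1$, $\mathcal{A}_\alpha(\mathcal{G})=\alpha\mathcal{D}(\mathcal{G})+(1-\alpha)\mathcal{A}(\mathcal{G})$. A complex number $\lambda$ is an eigenvalue of an order-$k$ dimension-$n$ tensor $\mathcal{T}=(t_{i_1\cdots i_k})$ if there is a nonzero $x\in\mathbb{C}^n$ with $\sum_{i_2,\dots,i_k} t_{i i_2\cdots i_k}x_{i_2}\cdots x_{i_k}=\lambda x_i^{k-1}$ for all $i$. The $\alpha$-spectral radius $\rho_\alpha(\mathcal{G})$ is the largest modulus of the eigenvalues of $\mathcal{A}_\alpha(\mathcal{G})$. A cycle in a hypergraph is a sequence $v_0e_1v_1e_2\cdots e_lv_l$ with $l\ge2$, $v_l=v_0$, distinct vertices $v_0,\dots,v_{l-1}$, distinct edges $e_1,\dots,e_l$, and $v_{i-1},v_i\in e_i$. A supertree is a connected hypergraph with no cycle. $\mathcal{T}(n,k)$ denotes the set of $k$-uniform supertrees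 on $n$ vertices; each has $m=\frac{n-1}{k-1}$ edges. For an ordinary graph $H$, its $k$-th power $H^k$ is the $k$-uniform hypergraph obtained by adding $k-2$ new vertices to each edge of $H$. Ordinary trees on $m+1$ vertices: $S_{m+1}$ is the star; $S_{a,b}$ ($a,b\ge0$, $a+b=m-1$) is obtained from an edge $u_1u_2$ by attaching $a$ pendent edges at $u_1$ and $b$ at $u_2$ (so $S_{m+1}=S_{0,m-1}$); $S_{s_1,s_2,s_3}$ ($s_1,s_3\ge1$, $s_2\ge0$, $s_1+s_2+s_3=m-2$) is obtained from a path $u_1u_2u_3$ by attaching $s_i$ pendent edges at $u_i$. $\mathcal{S}_{m+1}^k,\mathcal{S}_{a,b}^k,\mathcal{S}_{s_1,s_2,s_3}^k$ are the $k$-th powers of these trees. For $t_1,t_2,t_3\ge1$ with $t_1+t_2+t_3=m-1$, $\mathcal{T}(t_1,t_2,t_3)$ is the $k$-uniform supertree obtained from an edge $e_1=\{u_1,\dots,u_k\}$ by attaching, for $i=1,2,3$, $t_i$ pendent edges at $u_i$ (each pendent edge consists of $u_i$ and $k-1$ new vertices of degree $1$). *)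

theory Defs
  imports Complex_Main
begin

datatype 'a hypergraph = Hypergraph (verts: "'a set") (hedges: "'a set set")

definition uniform_hypergraph :: "nat \<Rightarrow> 'a hypergraph \<Rightarrow> bool" where
  "uniform_hypergraph k G \<longleftrightarrow>
     finite (verts G) \<and> verts G \<noteq> {} \<and> (\<forall>e\<in>hedges G. e \<subseteq> verts G \<and> card e = k)"

definition vdegree :: "'a hypergraph \<Rightarrow> 'a \<Rightarrow> nat" where
  "vdegree G v = card {e \<in> hedges G. v \<in> e}"

text \<open>
  A tensor of order \<open>k\<close> over a finite index set \<open>I\<close> is a function on lists, of which only the
  values on lists of length \<open>k\<close> with entries in \<open>I\<close> matter.  The tensors of a hypergraph are
  indexed by its vertices, so their dimension is the number of vertices.
\<close>

type_synonym 'a tensor = "'a list \<Rightarrow> complex"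

definition tensor_eigenvalue :: "nat \<Rightarrow> 'a set \<Rightarrow> 'a tensor \<Rightarrow> complex \<Rightarrow> bool" where
  "tensor_eigenvalue k I T l \<longleftrightarrow>
     (\<exists>x. (\<exists>i\<in>I. x i \<noteq> 0) \<and>
          (\<forall>i\<in>I. (\<Sum>js | set js \<subseteq> I \<and> length js = k - 1. T (i # js) * (\<Prod>j\<leftarrow>js. x j))
                  = l * x i ^ (k - 1)))"

definition adjacency_tensor :: "nat \<Rightarrow> 'a hypergraph \<Rightarrow> 'a tensor" where
  "adjacency_tensor k G is = (if set is \<in> hedges G then 1 / fact (k - 1) else 0)"

definition degree_tensor :: "nat \<Rightarrow> 'a hypergraph \<Rightarrow> 'a tensor" where
  "degree_tensor k G is =
     (if is = replicate k (hd is) then of_nat (vdegree G (hd is)) else 0)"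

definition A_alpha :: "real \<Rightarrow> nat \<Rightarrow> 'a hypergraph \<Rightarrow> 'a tensor" where
  "A_alpha \<alpha> k G is =
     of_real \<alpha> * degree_tensor k G is + of_real (1 - \<alpha>) * adjacency_tensor k G is"

definition alpha_spectral_radius :: "real \<Rightarrow> nat \<Rightarrow> 'a hypergraph \<Rightarrow> real" where
  "alpha_spectral_radius \<alpha> k G =
     (GREATEST r. \<exists>l. tensor_eigenvalue k (verts G) (A_alpha \<alpha> k G) l \<and> r = cmod l)"

definition hconnected :: "'a hypergraph \<Rightarrow> bool" where
  "hconnected G \<longleftrightarrow>
     (\<forall>u\<in>verts G. \<forall>v\<in>verts G. (u, v) \<in> {(x, y). \<exists>e\<in>hedges G. x \<in> e \<and> y \<in> e}\<^sup>*)"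

text \<open>
  The cycle \<open>v\<^sub>0 e\<^sub>1 v\<^sub>1 \<dots> e\<^sub>l v\<^sub>l\<close> with \<open>v\<^sub>l = v\<^sub>0\<close> is given by the lists
  \<open>vs = [v\<^sub>0, \<dots>, v\<^bsub>l-1\<^esub>]\<close> and \<open>es = [e\<^sub>1, \<dots>, e\<^sub>l]\<close>, so that \<open>es ! i\<close> is \<open>e\<^bsub>i+1\<^esub>\<close>.
\<close>

definition is_cycle :: "'a hypergraph \<Rightarrow> 'a list \<Rightarrow> 'a set list \<Rightarrow> bool" where
  "is_cycle G vs es \<longleftrightarrow>
     length vs = length es \<and> 2 \<le> length es \<and>
     distinct vs \<and> set vs \<subseteq> verts G \<and> distinct es \<and> set es \<subseteq> hedges G \<and>
     (\<forall>i<length es. vs ! i \<in> es ! i \<and> vs ! (Suc i mod length vs) \<in> es ! i)"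

definition supertrees :: "nat \<Rightarrow> nat \<Rightarrow> 'a hypergraph set" where
  "supertrees n k =
     {G. uniform_hypergraph k G \<and> card (verts G) = n \<and> hconnected G \<and> (\<nexists>vs es. is_cycle G vs es)}"

definition hypergraph_iso :: "'a hypergraph \<Rightarrow> 'b hypergraph \<Rightarrow> bool" (infix "\<cong>\<^sub>h" 50) where
  "G \<cong>\<^sub>h H \<longleftrightarrow>
     (\<exists>f. bij_betw f (verts G) (verts H) \<and> (\<lambda>e. f ` e) ` hedges G = hedges H)"

text \<open>
  An ordinary graph is a 2-uniform hypergraph.  In its \<open>k\<close>-th power, the \<open>k - 2\<close> vertices
  added to the edge \<open>e\<close> are \<open>Inr (e, 0), \<dots>, Inr (e, k - 3)\<close>.
\<close>

definition power_hypergraph :: "nat \<Rightarrow> 'a hypergraph \<Rightarrow> ('a + 'a set \<times> nat) hypergraph" where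
  "power_hypergraph k H =
     Hypergraph (verts H <+> (hedges H \<times> {..<k - 2}))
                ((\<lambda>e. e <+> ({e} \<times> {..<k - 2})) ` hedges H)"

text \<open>
  The path \<open>u\<^sub>1 \<dots> u\<^sub>r\<close> with \<open>s\<^sub>i\<close> pendent edges attached at \<open>u\<^sub>i\<close>, where \<open>s = [s\<^sub>1, \<dots>, s\<^sub>r]\<close>:
  \<open>u\<^sub>i\<close> is \<open>(i - 1, 0)\<close>, and the new vertices attached to it are \<open>(i - 1, 1), \<dots>, (i - 1, s\<^sub>i)\<close>.
\<close>

definition caterpillar :: "nat list \<Rightarrow> (nat \<times> nat) hypergraph" where
  "caterpillar s =
     Hypergraph {(i, j). i < length s \<and> j \<le> s ! i}
                ({{(i, 0), (Suc i, 0)} | i. Suc i < length s} \<union>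
                 {{(i, 0), (i, j)} | i j. i < length s \<and> 1 \<le> j \<and> j \<le> s ! i})"

text \<open>The argument of \<open>star_tree\<close> is the number of vertices.\<close>

definition star_tree :: "nat \<Rightarrow> (nat \<times> nat) hypergraph" where
  "star_tree p = caterpillar [p - 1]"

definition S2_tree :: "nat \<Rightarrow> nat \<Rightarrow> (nat \<times> nat) hypergraph" where
  "S2_tree a b = caterpillar [a, b]"

definition S3_tree :: "nat \<Rightarrow> nat \<Rightarrow> nat \<Rightarrow> (nat \<times> nat) hypergraph" where
  "S3_tree s1 s2 s3 = caterpillar [s1, s2, s3]"

text \<open>
  The supertree \<open>\<T>(t\<^sub>1, t\<^sub>2, t\<^sub>3)\<close>: the vertices \<open>u\<^sub>1, \<dots>, u\<^sub>k\<close> of the central edge are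
  \<open>(0, 0, 0), \<dots>, (k - 1, 0, 0)\<close>; the new vertices of the \<open>j\<close>-th pendent edge at \<open>u\<^sub>i\<close>
  (\<open>1 \<le> j \<le> t\<^sub>i\<close>) are \<open>(i - 1, j, 1), \<dots>, (i - 1, j, k - 1)\<close>.
\<close>

definition T3_supertree :: "nat \<Rightarrow> nat \<Rightarrow> nat \<Rightarrow> nat \<Rightarrow> (nat \<times> nat \<times> nat) hypergraph" where
  "T3_supertree k t1 t2 t3 =
     (let t = [t1, t2, t3];
          core = {(i, 0, 0) | i. i < k};
          new = (\<lambda>i j. {(i, j, c) | c. 1 \<le> c \<and> c \<le> k - 1})
      in Hypergraph (core \<union> \<Union>{new i j | i j. i < 3 \<and> 1 \<le> j \<and> j \<le> t ! i})
           ({core} \<union> {insert (i, 0, 0) (new i j) | i j. i < 3 \<and> 1 \<le> j \<and> j \<le> t ! i}))"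

text \<open>Hypergraphs are identified up to isomorphism, and \<open>m\<close> is the number of edges.\<close>

definition T8 :: "nat \<Rightarrow> nat \<Rightarrow> 'a hypergraph set" where
  "T8 n k = (let m = (n - 1) div (k - 1) in
     {G. G \<cong>\<^sub>h power_hypergraph k (star_tree (m + 1)) \<or>
         G \<cong>\<^sub>h power_hypergraph k (S2_tree 1 (m - 2)) \<or>
         G \<cong>\<^sub>h power_hypergraph k (S2_tree 2 (m - 3)) \<or>
         G \<cong>\<^sub>h T3_supertree k 1 1 (m - 3) \<or>
         G \<cong>\<^sub>h power_hypergraph k (S3_tree 1 (m - 4) 1) \<or>
         G \<cong>\<^sub>h power_hypergraph k (S3_tree (m - 3) 0 1) \<or>
         G \<cong>\<^sub>h power_hypergraph k (S2_tree 3 (m - 4)) \<or>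
         G \<cong>\<^sub>h T3_supertree k 1 2 (m - 4)})"

end

theory Submission
  imports Defs "HOL-Analysis.Analysis" "HOL-Combinatorics.Multiset_Permutations"
begin

text \<open>
  The tensor is symmetric, so \<open>\<rho>\<^sub>\<alpha>\<close> is the maximum of the form
  \<open>\<Sum>\<^sub>e (\<alpha> \<Sum>\<^bsub>v\<in>e\<^esub> x\<^sub>v\<^sup>k + (1 - \<alpha>) k \<Prod>\<^bsub>v\<in>e\<^esub> x\<^sub>v)\<close> on the nonnegative part of
  \<open>\<Sum>\<^sub>v x\<^sub>v\<^sup>k = 1\<close>, attained at a positive eigenvector.  Hence \<open>\<rho>\<^sub>\<alpha>\<close> can be computed and bounded by
  labelling the incidences: with \<open>\<gamma> = \<alpha> / (\<mu> - \<alpha>)\<close> and \<open>\<epsilon> = ((1 - \<alpha>) / (\<mu> - \<alpha>))\<^sup>k\<close>, a positive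
  labelling \<open>a\<close> such that \<open>\<Sum>\<^sub>e (a(v,e) + \<gamma>) \<le> 1 + \<gamma>\<close> at every vertex and
  \<open>\<Prod>\<^sub>v a(v,e) \<ge> \<epsilon>\<close> on every edge, with one strict inequality, gives \<open>\<rho>\<^sub>\<alpha> < \<mu>\<close> (by AM-GM), and
  the positive eigenvector yields a labelling with equality throughout for \<open>\<mu> = \<rho>\<^sub>\<alpha>\<close>.

  Each of the eight supertrees consists of one or two core edges with pendent edges attached, each
  of which uses up \<open>\<delta> = \<epsilon> + \<gamma>\<close> at its vertex.  So \<open>\<rho>\<^sub>\<alpha>\<close> is governed by an equation in \<open>\<delta>\<close> and
  \<open>\<epsilon>\<close> which does not mention \<open>k\<close>, such as
  \<open>(1 - t\<^sub>1 \<delta>) (1 - t\<^sub>2 \<delta>) (1 - t\<^sub>3 \<delta>) = \<epsilon>\<close> for \<open>\<T>(t\<^sub>1, t\<^sub>2, t\<^sub>3)\<close>, and consecutive equations are easily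
  compared.

  For an arbitrary supertree, let \<open>s(v,e)\<close> be the number of edges of the branch at \<open>v\<close> through
  \<open>e\<close>, and call an incidence heavy if \<open>2 s(v,e) > m\<close>.  A light incidence gets the label that a
  double star of that branch size would need, a heavy one what is left at its vertex.  It remains to
  look at centroids, i.e. vertices without a heavy incidence.  Those of degree at most \<open>m - 4\<close> have
  room to spare, those of degree \<open>m - 3\<close> need a case distinction, in which only
  \<open>\<S>\<^bsub>3,m-4\<^esub>\<^sup>k\<close> and \<open>\<T>(1,2,m-4)\<close> survive, and larger degrees occur only in the first six supertrees.
\<close>

section \<open>The spectral radius as the maximum of a form\<close>

text \<open>Each inequality is tested at a single point: \<mu> is the spectral radius of the larger
  hypergraph, whose eigenvector gives an exact equation between \<delta> and \<epsilon>, and labels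
  of the smaller one are shown to have slack there. Of \<alpha> and k only 0 < \<epsilon> \<le>
  \<delta> survives. For an arbitrary supertree, \<mu> belongs to T(1,2,m-4). The double star is the
  extremal branch: below the top edge of a branch with n edges, the other n - 1 edges take up at
  most (n - 1) \<delta> in total at its other vertices, and the product of what is left is at least
  1 - (n - 1) \<delta> however they are distributed. The bounds on weights are good enough only for
  branches with at most m / 2 edges, which is why the labels are oriented toward a centroid. At a
  centroid of degree at most m - 4 each edge that misses it costs at most \<delta> / 4, so crude
  bounds do. At degree m - 3 the supertree T(1,2,m-4) itself attains equality, so there the labels
  must be exact. The bound 13 is where m / 2 - 1 \<le> 11 / 18 (m - 4) and (m - 1) / 2 \<le> 2 / 3
  (m - 4) start to hold.\<close>

lemma am_gm_weighted:
  fixes b x :: "'v \<Rightarrow> real"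
  assumes "finite S" "card S = k" "0 < k" "0 \<le> c"
    and b: "\<And>v. v \<in> S \<Longrightarrow> 0 \<le> b v" and x: "\<And>v. v \<in> S \<Longrightarrow> 0 \<le> x v"
    and cb: "c ^ k \<le> (\<Prod>v\<in>S. b v)"
  shows "real k * c * (\<Prod>v\<in>S. x v) \<le> (\<Sum>v\<in>S. b v * x v ^ k)"
proof -
  let ?P = "\<Prod>v\<in>S. x v"
  have P0: "?P \<ge> 0" using x by (simp add: prod_nonneg)
  have "(\<Prod>v\<in>S. b v * x v ^ k) = (\<Prod>v\<in>S. b v) * ?P ^ k"
    by (simp add: prod.distrib prod_power_distrib)
  moreover have "c ^ k * ?P ^ k \<le> (\<Prod>v\<in>S. b v) * ?P ^ k"
    using cb P0 by (simp add: mult_right_mono)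
  ultimately have 1: "(c * ?P) ^ k \<le> (\<Prod>v\<in>S. b v * x v ^ k)"
    by (simp add: power_mult_distrib)
  have "c * ?P = ((c * ?P) ^ k) powr (1 / real k)"
    using assms(3,4) P0 by (cases "c * ?P = 0") (auto simp: powr_realpow[symmetric] powr_powr)
  also have "\<dots> \<le> (\<Prod>v\<in>S. b v * x v ^ k) powr (1 / real k)"
    using 1 assms(3,4) P0 by (intro powr_mono2) auto
  also have "\<dots> \<le> (\<Sum>v\<in>S. b v * x v ^ k / real k)"
    using arith_geom_mean[of S "\<lambda>v. b v * x v ^ k"] assms by (auto simp: card_gt_0_iff)
  finally show ?thesis using assms(3) by (simp add: sum_divide_distrib[symmetric] field_simps)
qed

text \<open>Strictness comes from replacing \<open>c\<close> by the k-th root of the product of the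
  \<open>b v\<close>, a larger constant that the weak version still admits; since the product of the
  \<open>x v\<close> is positive, the left side really grows.\<close>

lemma am_gm_weighted_strict:
  fixes b x :: "'v \<Rightarrow> real"
  assumes "finite S" "card S = k" "0 < k" "0 \<le> c"
    and b: "\<And>v. v \<in> S \<Longrightarrow> 0 \<le> b v" and x: "\<And>v. v \<in> S \<Longrightarrow> 0 < x v"
    and cb: "c ^ k < (\<Prod>v\<in>S. b v)"
  shows "real k * c * (\<Prod>v\<in>S. x v) < (\<Sum>v\<in>S. b v * x v ^ k)"
proof -
  define c' where "c' = root k (\<Prod>v\<in>S. b v)"
  have B: "(\<Prod>v\<in>S. b v) \<ge> 0" using b by (simp add: prod_nonneg)
  have c': "c' ^ k = (\<Prod>v\<in>S. b v)" "0 \<le> c'"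
    using B assms(3) by (simp_all add: c'_def)
  then have "c < c'" using cb by (metis power_less_imp_less_base)
  moreover have "0 < (\<Prod>v\<in>S. x v)" using x by (simp add: prod_pos)
  ultimately have "real k * c * (\<Prod>v\<in>S. x v) < real k * c' * (\<Prod>v\<in>S. x v)"
    using assms(3) by simp
  also have "\<dots> \<le> (\<Sum>v\<in>S. b v * x v ^ k)"
    using am_gm_weighted[of S k c' b x] assms c' x by (simp add: less_imp_le)
  finally show ?thesis .
qed

section \<open>The tensor eigenvalue equation written edge by edge\<close>

locale conn_hypergraph =
  fixes k :: nat and G :: "'a hypergraph"
  assumes k: "3 \<le> k" and uniform: "uniform_hypergraph k G"
    and connected: "hconnected G" and edges_nonempty: "hedges G \<noteq> {}"
begin

abbreviation incident :: "'a \<Rightarrow> 'a set set" where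
  "incident v \<equiv> {e \<in> hedges G. v \<in> e}"

lemma finite_verts: "finite (verts G)"
  and verts_nonempty: "verts G \<noteq> {}"
  and edge_subset: "e \<in> hedges G \<Longrightarrow> e \<subseteq> verts G"
  and card_edge: "e \<in> hedges G \<Longrightarrow> card e = k"
  using uniform by (auto simp: uniform_hypergraph_def)

lemma finite_edge: "e \<in> hedges G \<Longrightarrow> finite e"
  using finite_subset edge_subset finite_verts by metis

lemma finite_edges: "finite (hedges G)"
  using finite_subset[of "hedges G" "Pow (verts G)"] edge_subset finite_verts by auto

lemma sum_edges_verts:
  "(\<Sum>e\<in>hedges G. \<Sum>v\<in>e. f v e) = (\<Sum>v\<in>verts G. \<Sum>e\<in>incident v. f v e)"
proof -
  have "(\<Sum>e\<in>hedges G. \<Sum>v\<in>e. f v e) = (\<Sum>e\<in>hedges G. \<Sum>v | v \<in> verts G \<and> v \<in> e. f v e)"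
    using edge_subset by (intro sum.cong refl) (auto intro!: arg_cong[where f = "sum _"])
  also have "\<dots> = (\<Sum>v\<in>verts G. \<Sum>e\<in>incident v. f v e)"
    by (rule sum.swap_restrict) (auto simp: finite_edges finite_verts)
  finally show ?thesis .
qed

text \<open>Connectivity in the form used later: a vertex property that is not constant must change
  across some edge. It is applied to "the vector does not vanish here" and to "lies on an edge
  through u".\<close>

lemma boundary_edge:
  assumes "u \<in> verts G" "P u" "v \<in> verts G" "\<not> P v"
  obtains e a b where "e \<in> hedges G" "a \<in> e" "b \<in> e" "P a" "\<not> P b"
proof -
  have "(u, v) \<in> {(x, y). \<exists>e\<in>hedges G. x \<in> e \<and> y \<in> e}\<^sup>*"
    using connected assms by (auto simp: hconnected_def)
  then have "\<not> P v \<Longrightarrow> \<exists>e\<in>hedges G. \<exists>a\<in>e. \<exists>b\<in>e. P a \<and> \<not> P b"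
    by (induction rule: rtrancl_induct) (use assms in auto)
  then show ?thesis using that assms by blast
qed

text \<open>Edges have exactly k vertices, so a list of length k - 1 that completes \<open>i\<close>
  to an edge has no room for a repetition or for \<open>i\<close> itself.\<close>

lemma adjacency_lists:
  assumes "i \<in> verts G"
  shows "{js. set js \<subseteq> verts G \<and> length js = k - 1 \<and> set (i # js) \<in> hedges G}
           = (\<Union>e\<in>incident i. permutations_of_set (e - {i}))"
proof (intro equalityI subsetI)
  fix js assume "js \<in> {js. set js \<subseteq> verts G \<and> length js = k - 1 \<and> set (i # js) \<in> hedges G}"
  then have js: "length js = k - 1" "insert i (set js) \<in> hedges G" by auto
  from js(2) have "card (insert i (set js)) = k" by (rule card_edge)
  moreover have "card (set js) \<le> k - 1" using js(1) card_length by metis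
  ultimately have "i \<notin> set js" "card (set js) = length js"
    using k js(1) by (auto simp: card_insert_if split: if_splits)
  then have "set js = insert i (set js) - {i}" "distinct js"
    by (auto simp: card_distinct)
  then show "js \<in> (\<Union>e\<in>incident i. permutations_of_set (e - {i}))"
    using js(2) by blast
next
  fix js assume "js \<in> (\<Union>e\<in>incident i. permutations_of_set (e - {i}))"
  then obtain e where e: "e \<in> hedges G" "i \<in> e" and js: "js \<in> permutations_of_set (e - {i})" by auto
  have "set js = e - {i}" using js by (rule permutations_of_setD)
  moreover have "length js = k - 1"
    using length_finite_permutations_of_set[OF js] e card_edge finite_edge by simp
  moreover have "insert i (e - {i}) = e" using e by auto
  ultimately show "js \<in> {js. set js \<subseteq> verts G \<and> length js = k - 1 \<and> set (i # js) \<in> hedges G}"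
    using e edge_subset by auto
qed

text \<open>Each edge through \<open>i\<close> is hit by the (k - 1)! orderings of its other
  vertices, which cancels the factor 1 / (k - 1)! of the adjacency tensor. From here on tensors are
  replaced by sums over edges.\<close>

lemma A_alpha_apply:
  assumes i: "i \<in> verts G"
  shows "(\<Sum>js | set js \<subseteq> verts G \<and> length js = k - 1. A_alpha \<alpha> k G (i # js) * (\<Prod>j\<leftarrow>js. x j))
    = of_real \<alpha> * of_nat (vdegree G i) * x i ^ (k - 1)
      + of_real (1 - \<alpha>) * (\<Sum>e\<in>incident i. \<Prod>u\<in>e - {i}. x u)"
proof -
  let ?L = "{js. set js \<subseteq> verts G \<and> length js = k - 1}"
  let ?p = "\<lambda>js. \<Prod>j\<leftarrow>js. x j"
  have fin: "finite ?L" by (rule finite_lists_length_eq[OF finite_verts])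
  have "(\<Sum>js\<in>?L. degree_tensor k G (i # js) * ?p js)
    = (\<Sum>js\<in>?L. if js = replicate (k - 1) i then of_nat (vdegree G i) * x i ^ (k - 1) else 0)"
  proof (intro sum.cong refl)
    fix js
    have "i # js = replicate k i \<longleftrightarrow> js = replicate (k - 1) i"
      using k by (cases k) auto
    then show "degree_tensor k G (i # js) * ?p js
      = (if js = replicate (k - 1) i then of_nat (vdegree G i) * x i ^ (k - 1) else 0)"
      by (auto simp: degree_tensor_def prod_list_replicate)
  qed
  also have "\<dots> = of_nat (vdegree G i) * x i ^ (k - 1)"
    using i fin by (simp add: set_replicate_conv_if)
  finally have D: "(\<Sum>js\<in>?L. degree_tensor k G (i # js) * ?p js) = of_nat (vdegree G i) * x i ^ (k - 1)" .
  have "(\<Sum>js\<in>?L. adjacency_tensor k G (i # js) * ?p js)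
    = (\<Sum>js\<in>{js\<in>?L. set (i # js) \<in> hedges G}. ?p js / fact (k - 1))"
    unfolding sum.inter_filter[OF fin]
    by (intro sum.cong refl) (auto simp: adjacency_tensor_def)
  also have "{js\<in>?L. set (i # js) \<in> hedges G}
      = (\<Union>e\<in>incident i. permutations_of_set (e - {i}))"
    using adjacency_lists[OF i] by (simp add: conj_assoc)
  also have "(\<Sum>js\<in>\<dots>. ?p js / fact (k - 1))
      = (\<Sum>e\<in>incident i. \<Sum>js\<in>permutations_of_set (e - {i}). ?p js / fact (k - 1))"
  proof (rule sum.UNION_disjoint)
    show "\<forall>e\<in>incident i. \<forall>f\<in>incident i. e \<noteq> f \<longrightarrow>
        permutations_of_set (e - {i}) \<inter> permutations_of_set (f - {i}) = {}"
      by (auto dest!: permutations_of_setD(1))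
  qed (auto simp: finite_edges)
  also have "\<dots> = (\<Sum>e\<in>incident i. \<Prod>u\<in>e - {i}. x u)"
  proof (intro sum.cong refl)
    fix e assume e: "e \<in> incident i"
    have "?p js = (\<Prod>u\<in>e - {i}. x u)" if "js \<in> permutations_of_set (e - {i})" for js
      using permutations_of_setD[OF that] by (metis prod.distinct_set_conv_list)
    then have "(\<Sum>js\<in>permutations_of_set (e - {i}). ?p js / fact (k - 1))
        = of_nat (card (permutations_of_set (e - {i}))) * ((\<Prod>u\<in>e - {i}. x u) / fact (k - 1))"
      by simp
    then show "(\<Sum>js\<in>permutations_of_set (e - {i}). ?p js / fact (k - 1)) = (\<Prod>u\<in>e - {i}. x u)"
      using e card_edge finite_edge by simp
  qed
  finally have A: "(\<Sum>js\<in>?L. adjacency_tensor k G (i # js) * ?p js)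
      = (\<Sum>e\<in>incident i. \<Prod>u\<in>e - {i}. x u)" .
  have "(\<Sum>js\<in>?L. A_alpha \<alpha> k G (i # js) * ?p js)
    = of_real \<alpha> * (\<Sum>js\<in>?L. degree_tensor k G (i # js) * ?p js)
      + of_real (1 - \<alpha>) * (\<Sum>js\<in>?L. adjacency_tensor k G (i # js) * ?p js)"
    by (simp add: A_alpha_def sum.distrib sum_distrib_left distrib_right mult.assoc)
  then show ?thesis unfolding D A by (simp add: mult.assoc)
qed

end

section \<open>Maximizers of the form and the positive eigenvector\<close>

locale alpha_hypergraph = conn_hypergraph k G for k and G :: "'a hypergraph" +
  fixes \<alpha> :: real
  assumes \<alpha>: "0 \<le> \<alpha>" "\<alpha> < 1"
begin

definition hform :: "('a \<Rightarrow> real) \<Rightarrow> real" where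
  "hform x = (\<Sum>e\<in>hedges G. \<alpha> * (\<Sum>v\<in>e. x v ^ k) + (1 - \<alpha>) * real k * (\<Prod>v\<in>e. x v))"

definition perron :: "real \<Rightarrow> ('a \<Rightarrow> real) \<Rightarrow> bool" where
  "perron \<mu> x \<longleftrightarrow> (\<forall>v\<in>verts G. 0 < x v \<and>
     \<alpha> * real (vdegree G v) * x v ^ (k - 1)
       + (1 - \<alpha>) * (\<Sum>e\<in>incident v. \<Prod>u\<in>e - {v}. x u) = \<mu> * x v ^ (k - 1))"

text \<open>Euler's identity for a homogeneous form: the product over an edge is collected once at
  each of its k vertices, which absorbs the factor k.\<close>

lemma hform_alt:
  "hform x = (\<Sum>v\<in>verts G. x v * (\<alpha> * real (vdegree G v) * x v ^ (k - 1)
     + (1 - \<alpha>) * (\<Sum>e\<in>incident v. \<Prod>u\<in>e - {v}. x u)))"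
proof -
  have kk: "x v ^ k = x v * x v ^ (k - 1)" for v using k by (cases k) auto
  have "hform x = (\<Sum>e\<in>hedges G. \<Sum>v\<in>e. x v * (\<alpha> * x v ^ (k - 1) + (1 - \<alpha>) * (\<Prod>u\<in>e - {v}. x u)))"
    unfolding hform_def
  proof (intro sum.cong refl)
    fix e assume e: "e \<in> hedges G"
    have "(\<Sum>v\<in>e. x v * (\<alpha> * x v ^ (k - 1) + (1 - \<alpha>) * (\<Prod>u\<in>e - {v}. x u)))
        = (\<Sum>v\<in>e. \<alpha> * x v ^ k + (1 - \<alpha>) * (\<Prod>u\<in>e. x u))"
      by (intro sum.cong refl) (simp add: prod.remove[OF finite_edge[OF e]] kk algebra_simps)
    then show "\<alpha> * (\<Sum>v\<in>e. x v ^ k) + (1 - \<alpha>) * real k * (\<Prod>v\<in>e. x v)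
        = (\<Sum>v\<in>e. x v * (\<alpha> * x v ^ (k - 1) + (1 - \<alpha>) * (\<Prod>u\<in>e - {v}. x u)))"
      using card_edge[OF e] by (simp add: sum.distrib sum_distrib_left)
  qed
  also have "\<dots> = (\<Sum>v\<in>verts G. x v * (\<alpha> * real (vdegree G v) * x v ^ (k - 1)
     + (1 - \<alpha>) * (\<Sum>e\<in>incident v. \<Prod>u\<in>e - {v}. x u)))"
    unfolding sum_edges_verts
    by (intro sum.cong refl) (simp add: vdegree_def sum.distrib sum_distrib_left[symmetric] mult.left_commute mult.assoc)
  finally show ?thesis .
qed

lemma hform_cong: "(\<And>v. v \<in> verts G \<Longrightarrow> x v = y v) \<Longrightarrow> hform x = hform y"
proof -
  assume eq: "\<And>v. v \<in> verts G \<Longrightarrow> x v = y v"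
  have "x v = y v" if "e \<in> hedges G" "v \<in> e" for e v
    using eq that edge_subset by blast
  then show ?thesis unfolding hform_def by (intro sum.cong refl) simp
qed

lemma hform_scale: "hform (\<lambda>v. c * x v) = c ^ k * hform x"
proof -
  have "hform (\<lambda>v. c * x v) = (\<Sum>e\<in>hedges G. c ^ k *
      (\<alpha> * (\<Sum>v\<in>e. x v ^ k) + (1 - \<alpha>) * real k * (\<Prod>v\<in>e. x v)))"
    unfolding hform_def
    by (intro sum.cong refl)
      (simp add: power_mult_distrib prod.distrib card_edge sum_distrib_left[symmetric] distrib_left
        mult.left_commute mult.assoc)
  then show ?thesis by (simp add: hform_def sum_distrib_left)
qed

text \<open>Compactness gives a maximizer on the unit sphere of the k-norm; homogeneity then turns
  the bound there into one for all nonnegative vectors, without a normalising constraint.\<close>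

lemma hform_maximizer:
  obtains x \<mu> where "\<And>v. 0 \<le> x v" "(\<Sum>v\<in>verts G. x v ^ k) = 1" "hform x = \<mu>" "0 \<le> \<mu>"
    "\<forall>y. (\<forall>v\<in>verts G. 0 \<le> y v) \<longrightarrow> hform y \<le> \<mu> * (\<Sum>v\<in>verts G. y v ^ k)"
proof -
  \<comment> \<open>Values outside the vertex set are pinned to 0, so the feasible box is compact in
    the product topology on the full function space.\<close>
  define S :: "'a \<Rightarrow> real set" where "S v = (if v \<in> verts G then {0..1} else {0})" for v
  define K where "K = PiE UNIV S \<inter> {x. (\<Sum>v\<in>verts G. x v ^ k) = 1}"
  have "compactin (product_topology (\<lambda>_. euclidean) UNIV) (PiE UNIV S)"
    by (subst compactin_PiE) (auto simp: S_def)
  then have "compact (PiE UNIV S)"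
    by (simp add: euclidean_product_topology)
  moreover have cont: "continuous_on UNIV (\<lambda>x::'a \<Rightarrow> real. x v)" for v by simp
  have "closed {x. (\<Sum>v\<in>verts G. x v ^ k) = (1::real)}"
    by (intro closed_Collect_eq continuous_on_sum continuous_on_power cont continuous_on_const)
  ultimately have "compact K" unfolding K_def by (rule compact_Int_closed)
  moreover obtain v0 where v0: "v0 \<in> verts G" using verts_nonempty by auto
  have "(\<lambda>v. if v = v0 then 1 else 0) \<in> K"
    using v0 k by (auto simp: K_def S_def finite_verts power_0_left if_distrib[of "\<lambda>t. t ^ k"] cong: if_cong)
  then have "K \<noteq> {}" by blast
  moreover have "continuous_on K hform"
    unfolding hform_def
    by (rule continuous_on_subset[of UNIV])
      (intro continuous_on_sum continuous_on_add continuous_on_mult continuous_on_prod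
        continuous_on_power cont continuous_on_const, simp)
  ultimately obtain x where x: "x \<in> K" and max: "\<And>y. y \<in> K \<Longrightarrow> hform y \<le> hform x"
    using continuous_attains_sup[of K hform] by metis
  have x0: "0 \<le> x v" for v
  proof -
    have "x v \<in> S v" using x by (auto simp: K_def)
    then show ?thesis by (auto simp: S_def split: if_splits)
  qed
  have "0 \<le> hform x"
    unfolding hform_def using x0 \<alpha>
    by (intro sum_nonneg add_nonneg_nonneg mult_nonneg_nonneg prod_nonneg) (auto simp: sum_nonneg)
  moreover have "hform y \<le> hform x * (\<Sum>v\<in>verts G. y v ^ k)"
    if y: "\<And>v. v \<in> verts G \<Longrightarrow> 0 \<le> y v" for y
  proof (cases "(\<Sum>v\<in>verts G. y v ^ k) = 0")
    case True
    then have "\<forall>v\<in>verts G. y v ^ k = 0"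
      using y by (subst (asm) sum_nonneg_eq_0_iff) (auto simp: finite_verts)
    then have "\<And>v. v \<in> verts G \<Longrightarrow> y v = 0 * x v" using k by auto
    then have "hform y = hform (\<lambda>v. 0 * x v)" by (rule hform_cong)
    then show ?thesis using True k unfolding hform_scale by (simp add: power_0_left)
  next
    case False
    define s where "s = (\<Sum>v\<in>verts G. y v ^ k)"
    have s: "s > 0" using False y unfolding s_def by (simp add: sum_nonneg less_le)
    define c where "c = root k s"
    have c: "c > 0" "c ^ k = s" using s k by (auto simp: c_def)
    define z where "z v = (if v \<in> verts G then y v / c else 0)" for v
    have zs: "(\<Sum>v\<in>verts G. z v ^ k) = 1"
      using s c by (simp add: z_def power_divide sum_divide_distrib[symmetric] s_def)
    have z0: "0 \<le> z v" for v using y c by (simp add: z_def divide_nonneg_pos)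
    have "z v \<le> 1" if "v \<in> verts G" for v
    proof -
      have "z v ^ k \<le> (\<Sum>v\<in>verts G. z v ^ k)"
        using z0 that by (intro member_le_sum) (auto simp: finite_verts)
      then show ?thesis using zs k power_le_one_iff[OF z0] by auto
    qed
    then have "z v \<in> S v" for v using z0[of v] by (auto simp: S_def z_def)
    then have "z \<in> K" using zs by (simp add: K_def PiE_iff)
    then have "hform z \<le> hform x" by (rule max)
    moreover have "hform y = hform (\<lambda>v. c * z v)"
      using c by (intro hform_cong) (simp add: z_def)
    ultimately show ?thesis
      using s c unfolding hform_scale s_def[symmetric] by (simp add: mult.commute)
  qed
  ultimately show ?thesis using that[of x "hform x"] x x0 by (simp add: K_def)
qed

text \<open>An edge contains \<open>v\<close> at most once, so in the single variable at
  \<open>v\<close> the form is a multiple of t^k plus a linear term. This supplies the derivative in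
  the Lagrange condition.\<close>

lemma hform_fun_upd:
  assumes v: "v \<in> verts G"
  shows "hform (x(v := t)) = hform x + \<alpha> * real (vdegree G v) * (t ^ k - x v ^ k)
    + (1 - \<alpha>) * real k * (\<Sum>e\<in>incident v. \<Prod>u\<in>e - {v}. x u) * (t - x v)"
proof -
  let ?T = "\<lambda>x e. \<alpha> * (\<Sum>v\<in>e. x v ^ k) + (1 - \<alpha>) * real k * (\<Prod>v\<in>e. x v)"
  let ?y = "x(v := t)"
  have "?T ?y e = ?T x e + (if v \<in> e then \<alpha> * (t ^ k - x v ^ k)
      + (1 - \<alpha>) * real k * (t - x v) * (\<Prod>u\<in>e - {v}. x u) else 0)"
    if e: "e \<in> hedges G" for e
  proof (cases "v \<in> e")
    case True
    have "(\<Sum>u\<in>e - {v}. ?y u ^ k) = (\<Sum>u\<in>e - {v}. x u ^ k)"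
      "(\<Prod>u\<in>e - {v}. ?y u) = (\<Prod>u\<in>e - {v}. x u)"
      by (auto intro!: sum.cong prod.cong)
    then show ?thesis using True
      by (simp add: sum.remove[OF finite_edge[OF e] True] prod.remove[OF finite_edge[OF e] True]
          del: fun_upd_apply) (simp add: algebra_simps)
  next
    case False
    then have "(\<Sum>u\<in>e. ?y u ^ k) = (\<Sum>u\<in>e. x u ^ k)" "(\<Prod>u\<in>e. ?y u) = (\<Prod>u\<in>e. x u)"
      by (auto intro!: sum.cong prod.cong)
    then show ?thesis using False by simp
  qed
  then have "hform ?y = (\<Sum>e\<in>hedges G. ?T x e + (if v \<in> e then \<alpha> * (t ^ k - x v ^ k)
      + (1 - \<alpha>) * real k * (t - x v) * (\<Prod>u\<in>e - {v}. x u) else 0))"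
    unfolding hform_def by (intro sum.cong refl) blast
  also have "\<dots> = hform x + (\<Sum>e\<in>incident v. \<alpha> * (t ^ k - x v ^ k)
      + (1 - \<alpha>) * real k * (t - x v) * (\<Prod>u\<in>e - {v}. x u))"
    by (simp only: sum.distrib[where g = "?T x"] hform_def sum.inter_filter[OF finite_edges])
  also have "\<dots> = hform x + \<alpha> * real (vdegree G v) * (t ^ k - x v ^ k)
    + (1 - \<alpha>) * real k * (\<Sum>e\<in>incident v. \<Prod>u\<in>e - {v}. x u) * (t - x v)"
    by (simp add: sum.distrib sum_distrib_left[symmetric] vdegree_def)
  finally show ?thesis .
qed

text \<open>A maximizer cannot vanish anywhere: putting \<open>t\<close> on its zeros gains at least order
  \<open>t\<^bsup>k-1\<^esup>\<close> on an edge joining zeros to nonzeros, but costs only order \<open>t\<^bsup>k\<^esup>\<close>.\<close>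

lemma maximizer_positive:
  assumes x: "\<And>v. 0 \<le> x v" "(\<Sum>v\<in>verts G. x v ^ k) = 1" and "hform x = \<mu>" "0 \<le> \<mu>"
    and max: "\<And>y. (\<And>v. v \<in> verts G \<Longrightarrow> 0 \<le> y v) \<Longrightarrow> hform y \<le> \<mu> * (\<Sum>v\<in>verts G. y v ^ k)"
    and w: "w \<in> verts G"
  shows "0 < x w"
proof (rule ccontr)
  assume "\<not> 0 < x w"
  then have w0: "x w = 0" using x(1)[of w] by simp
  obtain u where u: "u \<in> verts G" "x u \<noteq> 0"
  proof (rule ccontr)
    assume "\<not> thesis"
    then have "\<forall>u\<in>verts G. x u = 0" using that by blast
    then show False using x(2) k by (simp add: power_0_left)
  qed
  obtain e0 a b where e0: "e0 \<in> hedges G" "a \<in> e0" "b \<in> e0" "x a \<noteq> 0" "x b = 0"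
    using boundary_edge[of u "\<lambda>v. x v \<noteq> 0" w] u w w0 by auto
  define Z where "Z = {v \<in> verts G. x v = 0}"
  define p where "p = (\<Prod>v\<in>e0 - Z. x v)"
  define c where "c = (1 - \<alpha>) * real k * p"
  have fe0: "finite e0" using e0 finite_edge by simp
  have x_pos: "0 < x v" if "v \<in> e0 - Z" for v
    using that x(1)[of v] e0 edge_subset by (force simp: Z_def less_le)
  have p: "0 < p" unfolding p_def using x_pos by (intro prod_pos) auto
  have c: "0 < c" using p \<alpha> k by (simp add: c_def)
  have j: "card (e0 \<inter> Z) \<le> k - 1"
  proof -
    have "card (e0 \<inter> Z) < card e0"
      using e0 fe0 by (intro psubset_card_mono) (auto simp: Z_def)
    then show ?thesis using card_edge e0 by simp
  qed
  have key: "c * t ^ (k - 1) \<le> \<mu> * real (card Z) * t ^ k" if t: "0 < t" "t \<le> 1" for t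
  proof -
    define y where "y v = (if v \<in> Z then t else x v)" for v
    have yx: "x v \<le> y v" and y0: "0 \<le> y v" for v
      using t x(1)[of v] by (auto simp: y_def Z_def)
    let ?T = "\<lambda>x e. \<alpha> * (\<Sum>v\<in>e. x v ^ k) + (1 - \<alpha>) * real k * (\<Prod>v\<in>e. x v)"
    have "(\<Prod>v\<in>e0. x v) = 0" using e0 fe0 by auto
    have "t ^ (k - 1) * p \<le> t ^ card (e0 \<inter> Z) * p"
      using j t p by (simp add: power_decreasing)
    also have "\<dots> = (\<Prod>v\<in>e0 \<inter> Z. y v) * (\<Prod>v\<in>e0 - Z. y v)"
      by (simp add: p_def y_def)
    also have "\<dots> = (\<Prod>v\<in>e0. y v)"
      using prod.Int_Diff[OF fe0, of y Z] by simp
    finally have "(1 - \<alpha>) * real k * (t ^ (k - 1) * p) \<le> (1 - \<alpha>) * real k * (\<Prod>v\<in>e0. y v)"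
      using \<alpha> by (intro mult_left_mono) auto
    moreover have "\<alpha> * (\<Sum>v\<in>e0. x v ^ k) \<le> \<alpha> * (\<Sum>v\<in>e0. y v ^ k)"
      using \<alpha> x(1) yx by (intro mult_left_mono sum_mono power_mono) auto
    ultimately have 1: "c * t ^ (k - 1) \<le> ?T y e0 - ?T x e0"
      using \<open>(\<Prod>v\<in>e0. x v) = 0\<close> by (simp add: c_def mult_ac)
    have 2: "0 \<le> ?T y e - ?T x e" for e
    proof -
      have "?T x e \<le> ?T y e"
        using \<alpha> x(1) yx by (intro add_mono mult_left_mono sum_mono power_mono prod_mono) auto
      then show ?thesis by simp
    qed
    have "?T y e0 - ?T x e0 \<le> (\<Sum>e\<in>hedges G. ?T y e - ?T x e)"
      using member_le_sum[of e0 "hedges G" "\<lambda>e. ?T y e - ?T x e"] e0 finite_edges 2 by blast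
    also have "\<dots> = hform y - hform x"
      by (simp only: hform_def sum_subtractf)
    also have "\<dots> \<le> \<mu> * (\<Sum>v\<in>verts G. y v ^ k) - \<mu>"
      using max[of y] y0 assms(3) by simp
    also have "(\<Sum>v\<in>verts G. y v ^ k) = (\<Sum>v\<in>verts G. x v ^ k + (if v \<in> Z then t ^ k else 0))"
      using k by (intro sum.cong refl) (auto simp: y_def Z_def)
    also have "\<dots> = 1 + real (card Z) * t ^ k"
      using finite_verts x(2) by (simp add: sum.distrib sum.If_cases Z_def Int_def)
    finally show ?thesis using 1 by (simp add: algebra_simps)
  qed
  define M where "M = \<mu> * real (card Z)"
  have M: "0 \<le> M" using assms(4) by (simp add: M_def)
  \<comment> \<open>Small enough that M t < c, which contradicts the inequality c \<le> M t that
    \<open>key\<close> yields after division by t^(k - 1).\<close>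
  define t where "t = c / (c + M)"
  have t: "0 < t" "t \<le> 1" using c M by (auto simp: t_def)
  have "t ^ k = t * t ^ (k - 1)" using k by (cases k) auto
  then have "c * t ^ (k - 1) \<le> (M * t) * t ^ (k - 1)"
    using key[OF t] by (simp add: M_def mult_ac)
  then have "c \<le> M * t" using t by simp
  then have "c * (c + M) \<le> M * c" using c M by (simp add: t_def field_simps)
  then show False using mult_pos_pos[OF c c] by (simp add: algebra_simps)
qed

text \<open>The moduli of a complex eigenvector satisfy the eigenvalue equation for |l| as an
  inequality, by the triangle inequality. Summed up through \<open>hform_alt\<close>, it says that
  the form is at least |l| times the k-norm to the power k, and the maximum caps it.\<close>

lemma eigenvalue_bound:
  assumes max: "\<And>y. (\<And>v. v \<in> verts G \<Longrightarrow> 0 \<le> y v) \<Longrightarrow> hform y \<le> \<mu> * (\<Sum>v\<in>verts G. y v ^ k)"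
    and l: "tensor_eigenvalue k (verts G) (A_alpha \<alpha> k G) l"
  shows "cmod l \<le> \<mu>"
proof -
  obtain z w where w: "w \<in> verts G" "z w \<noteq> 0" and z0: "\<And>i. i \<in> verts G \<Longrightarrow>
      (\<Sum>js | set js \<subseteq> verts G \<and> length js = k - 1. A_alpha \<alpha> k G (i # js) * (\<Prod>j\<leftarrow>js. z j))
        = l * z i ^ (k - 1)"
    using l unfolding tensor_eigenvalue_def by blast
  have z: "of_real \<alpha> * of_nat (vdegree G i) * z i ^ (k - 1)
      + of_real (1 - \<alpha>) * (\<Sum>e\<in>incident i. \<Prod>u\<in>e - {i}. z u) = l * z i ^ (k - 1)"
    if "i \<in> verts G" for i
    using z0[OF that] unfolding A_alpha_apply[OF that] .
  define y where "y v = cmod (z v)" for v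
  have "cmod l * y v ^ k \<le> y v * (\<alpha> * real (vdegree G v) * y v ^ (k - 1)
     + (1 - \<alpha>) * (\<Sum>e\<in>incident v. \<Prod>u\<in>e - {v}. y u))" if v: "v \<in> verts G" for v
  proof -
    have "cmod l * y v ^ (k - 1) = cmod (of_real \<alpha> * of_nat (vdegree G v) * z v ^ (k - 1)
      + of_real (1 - \<alpha>) * (\<Sum>e\<in>incident v. \<Prod>u\<in>e - {v}. z u))"
      unfolding z[OF v] by (simp add: norm_mult norm_power y_def)
    also have "\<dots> \<le> cmod (of_real \<alpha> * of_nat (vdegree G v) * z v ^ (k - 1))
      + cmod (of_real (1 - \<alpha>) * (\<Sum>e\<in>incident v. \<Prod>u\<in>e - {v}. z u))"
      by (rule norm_triangle_ineq)
    also have "\<dots> = \<alpha> * real (vdegree G v) * y v ^ (k - 1)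
      + (1 - \<alpha>) * cmod (\<Sum>e\<in>incident v. \<Prod>u\<in>e - {v}. z u)"
      using \<alpha> by (simp add: norm_mult norm_power y_def del: of_real_diff)
    also have "\<dots> \<le> \<alpha> * real (vdegree G v) * y v ^ (k - 1)
      + (1 - \<alpha>) * (\<Sum>e\<in>incident v. \<Prod>u\<in>e - {v}. y u)"
      using \<alpha> by (intro add_left_mono mult_left_mono sum_norm_le) (auto simp: prod_norm y_def)
    finally have "y v * (cmod l * y v ^ (k - 1)) \<le> y v * (\<alpha> * real (vdegree G v) * y v ^ (k - 1)
      + (1 - \<alpha>) * (\<Sum>e\<in>incident v. \<Prod>u\<in>e - {v}. y u))"
      by (intro mult_left_mono) (auto simp: y_def)
    moreover have "y v ^ k = y v * y v ^ (k - 1)" using k by (cases k) auto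
    ultimately show ?thesis by (simp add: mult_ac)
  qed
  then have "(\<Sum>v\<in>verts G. cmod l * y v ^ k) \<le> hform y"
    unfolding hform_alt by (rule sum_mono)
  also have "\<dots> \<le> \<mu> * (\<Sum>v\<in>verts G. y v ^ k)"
    by (rule max) (simp add: y_def)
  finally have "cmod l * (\<Sum>v\<in>verts G. y v ^ k) \<le> \<mu> * (\<Sum>v\<in>verts G. y v ^ k)"
    by (simp add: sum_distrib_left)
  moreover have "0 < (\<Sum>v\<in>verts G. y v ^ k)"
    using w finite_verts by (intro sum_pos2[of _ w]) (auto simp: y_def)
  ultimately show ?thesis by simp
qed

theorem perron_exists: "\<exists>x. perron (alpha_spectral_radius \<alpha> k G) x"
proof -
  obtain x \<mu> where x: "\<And>v. 0 \<le> x v" "(\<Sum>v\<in>verts G. x v ^ k) = 1" "hform x = \<mu>" "0 \<le> \<mu>"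
    and "\<forall>y. (\<forall>v\<in>verts G. 0 \<le> y v) \<longrightarrow> hform y \<le> \<mu> * (\<Sum>v\<in>verts G. y v ^ k)"
    using hform_maximizer by metis
  then have max: "\<And>y. (\<And>v. v \<in> verts G \<Longrightarrow> 0 \<le> y v) \<Longrightarrow> hform y \<le> \<mu> * (\<Sum>v\<in>verts G. y v ^ k)"
    by blast
  have pos: "0 < x v" if "v \<in> verts G" for v
    using maximizer_positive[OF x max that] by blast
  have eig: "\<alpha> * real (vdegree G v) * x v ^ (k - 1)
       + (1 - \<alpha>) * (\<Sum>e\<in>incident v. \<Prod>u\<in>e - {v}. x u) = \<mu> * x v ^ (k - 1)"
    if v: "v \<in> verts G" for v
  proof -
    define D where "D = \<alpha> * real (vdegree G v)"
    define P where "P = (1 - \<alpha>) * (\<Sum>e\<in>incident v. \<Prod>u\<in>e - {v}. x u)"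
    \<comment> \<open>The slack of the homogeneous bound when only the coordinate at
      \<open>v\<close> moves. It is nonnegative for t \<ge> 0 and zero at x v, an interior point by
      positivity, so its derivative vanishes there and the eigenvalue equation follows.\<close>
    define f where "f t = \<mu> * (t ^ k - x v ^ k) - D * (t ^ k - x v ^ k) - real k * P * (t - x v)" for t
    have "0 \<le> f t" if t: "0 \<le> t" for t
    proof -
      have "hform (x(v := t)) \<le> \<mu> * (\<Sum>u\<in>verts G. (x(v := t)) u ^ k)"
        by (rule max) (use x t in auto)
      moreover have "(\<Sum>u\<in>verts G - {v}. (x(v := t)) u ^ k) = (\<Sum>u\<in>verts G - {v}. x u ^ k)"
        by (intro sum.cong) auto
      then have "(\<Sum>u\<in>verts G. (x(v := t)) u ^ k) = 1 + (t ^ k - x v ^ k)"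
        using x(2) by (simp add: sum.remove[OF finite_verts v] del: fun_upd_apply) simp
      ultimately have "hform (x(v := t)) \<le> \<mu> * (1 + (t ^ k - x v ^ k))" by metis
      then show ?thesis
        unfolding hform_fun_upd[OF v] x(3) f_def D_def P_def by (simp add: algebra_simps)
    qed
    then have "\<forall>t. \<bar>x v - t\<bar> < x v \<longrightarrow> f (x v) \<le> f t"
      by (simp add: f_def abs_if split: if_splits)
    moreover have "(f has_real_derivative \<mu> * (real k * x v ^ (k - 1)) - D * (real k * x v ^ (k - 1))
        - real k * P) (at (x v))"
      unfolding f_def by (auto intro!: derivative_eq_intros)
    ultimately have "\<mu> * (real k * x v ^ (k - 1)) - D * (real k * x v ^ (k - 1)) - real k * P = 0"
      using DERIV_local_min pos[OF v] by blast
    then have "real k * (D * x v ^ (k - 1) + P) = real k * (\<mu> * x v ^ (k - 1))"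
      by (simp add: algebra_simps)
    then show ?thesis using k by (simp add: D_def P_def)
  qed
  have "tensor_eigenvalue k (verts G) (A_alpha \<alpha> k G) (of_real \<mu>)"
    unfolding tensor_eigenvalue_def
  proof (intro exI[of _ "\<lambda>v. of_real (x v)"] conjI ballI)
    show "\<exists>i\<in>verts G. complex_of_real (x i) \<noteq> 0"
      using verts_nonempty pos by fastforce
    fix i assume i: "i \<in> verts G"
    show "(\<Sum>js | set js \<subseteq> verts G \<and> length js = k - 1.
          A_alpha \<alpha> k G (i # js) * (\<Prod>j\<leftarrow>js. complex_of_real (x j)))
        = of_real \<mu> * of_real (x i) ^ (k - 1)"
      unfolding A_alpha_apply[OF i] using arg_cong[OF eig[OF i], of complex_of_real] by simp
  qed
  then have "alpha_spectral_radius \<alpha> k G = \<mu>"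
    unfolding alpha_spectral_radius_def
    using x(4) eigenvalue_bound[OF max] by (intro Greatest_equality) (auto intro!: exI[of _ "of_real \<mu>"])
  then show ?thesis using pos eig unfolding perron_def by blast
qed

abbreviation rho :: real where "rho \<equiv> alpha_spectral_radius \<alpha> k G"

lemma perron_hform: "perron \<mu> x \<Longrightarrow> hform x = \<mu> * (\<Sum>v\<in>verts G. x v ^ k)"
proof -
  assume "perron \<mu> x"
  moreover have "x v ^ k = x v * x v ^ (k - 1)" for v using k by (cases k) auto
  ultimately show ?thesis
    unfolding hform_alt sum_distrib_left[of \<mu>]
    by (intro sum.cong refl) (simp add: perron_def mult.left_commute)
qed

text \<open>Labellings in the sense of Lu and Man, normalised so that a vertex of degree one
  carries the label one.\<close>

lemma rho_less:
  assumes \<mu>: "\<alpha> < \<mu>" and \<gamma>: "\<gamma> = \<alpha> / (\<mu> - \<alpha>)" and \<epsilon>: "\<epsilon> = ((1 - \<alpha>) / (\<mu> - \<alpha>)) ^ k"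
    and a: "\<And>e v. e \<in> hedges G \<Longrightarrow> v \<in> e \<Longrightarrow> 0 < a v e"
    and vertex: "\<And>v. v \<in> verts G \<Longrightarrow> (\<Sum>e\<in>incident v. a v e + \<gamma>) \<le> 1 + \<gamma>"
    and edge: "\<And>e. e \<in> hedges G \<Longrightarrow> \<epsilon> \<le> (\<Prod>v\<in>e. a v e)"
    and strict: "(\<exists>v\<in>verts G. (\<Sum>e\<in>incident v. a v e + \<gamma>) < 1 + \<gamma>)
      \<or> (\<exists>e\<in>hedges G. \<epsilon> < (\<Prod>v\<in>e. a v e))"
  shows "rho < \<mu>"
proof -
  obtain x where x: "perron rho x" using perron_exists by blast
  have x0: "0 < x v" if "v \<in> verts G" for v using x that by (simp add: perron_def)
  have x0e: "0 < x v" if "e \<in> hedges G" "v \<in> e" for v e using x0 that edge_subset by blast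
  let ?L = "\<lambda>e. \<alpha> * (\<Sum>v\<in>e. x v ^ k) + (1 - \<alpha>) * real k * (\<Prod>v\<in>e. x v)"
  let ?R = "\<lambda>e. \<Sum>v\<in>e. (\<alpha> + (\<mu> - \<alpha>) * a v e) * x v ^ k"
  have prod_b: "(\<Prod>v\<in>e. (\<mu> - \<alpha>) * a v e) = (\<mu> - \<alpha>) ^ k * (\<Prod>v\<in>e. a v e)"
    and split: "?R e = \<alpha> * (\<Sum>v\<in>e. x v ^ k) + (\<Sum>v\<in>e. ((\<mu> - \<alpha>) * a v e) * x v ^ k)"
    if "e \<in> hedges G" for e
    using card_edge[OF that] by (simp_all add: prod.distrib sum.distrib sum_distrib_left distrib_right mult.assoc)
  \<comment> \<open>This is what the choice of \<epsilon> is for: the edge condition becomes the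
    hypothesis of AM-GM with c = 1 - \<alpha> and coefficients (\<mu> - \<alpha>) a(v,e).\<close>
  have \<epsilon>': "(1 - \<alpha>) ^ k = (\<mu> - \<alpha>) ^ k * \<epsilon>" using \<mu> \<epsilon> by (simp add: power_divide)
  have LR: "?L e \<le> ?R e" if e: "e \<in> hedges G" for e
  proof -
    have "real k * (1 - \<alpha>) * (\<Prod>v\<in>e. x v) \<le> (\<Sum>v\<in>e. ((\<mu> - \<alpha>) * a v e) * x v ^ k)"
      using e \<mu> \<alpha> k a[OF e] x0e[OF e] edge[OF e] finite_edge card_edge
      by (intro am_gm_weighted) (auto simp: prod_b \<epsilon>' less_imp_le)
    then show ?thesis using split[OF e] by (simp add: mult_ac)
  qed
  have LR_strict: "?L e < ?R e" if e: "e \<in> hedges G" "\<epsilon> < (\<Prod>v\<in>e. a v e)" for e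
  proof -
    have "real k * (1 - \<alpha>) * (\<Prod>v\<in>e. x v) < (\<Sum>v\<in>e. ((\<mu> - \<alpha>) * a v e) * x v ^ k)"
      using e \<mu> \<alpha> k a[OF e(1)] x0e[OF e(1)] finite_edge card_edge
      by (intro am_gm_weighted_strict) (auto simp: prod_b \<epsilon>' less_imp_le)
    then show ?thesis using split[OF e(1)] by (simp add: mult_ac)
  qed
  let ?W = "\<lambda>v. \<Sum>e\<in>incident v. a v e + \<gamma>"
  have W: "(\<Sum>e\<in>incident v. (\<alpha> + (\<mu> - \<alpha>) * a v e) * x v ^ k) = (\<mu> - \<alpha>) * ?W v * x v ^ k" for v
  proof -
    have "\<alpha> + (\<mu> - \<alpha>) * a v e = (\<mu> - \<alpha>) * (a v e + \<gamma>)" for e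
      using \<mu> \<gamma> by (simp add: field_simps)
    then show ?thesis by (simp add: sum_distrib_left sum_distrib_right)
  qed
  \<comment> \<open>And this is what \<gamma> is for: a vertex filled to exactly 1 + \<gamma>
    contributes exactly \<mu> x_v^k.\<close>
  have \<mu>': "\<mu> = (\<mu> - \<alpha>) * (1 + \<gamma>)" using \<mu> \<gamma> by (simp add: field_simps)
  have le: "(\<mu> - \<alpha>) * ?W v * x v ^ k \<le> \<mu> * x v ^ k" if v: "v \<in> verts G" for v
    by (subst \<mu>') (use vertex[OF v] x0[OF v] \<mu> in \<open>simp add: mult_right_mono\<close>)
  have "rho * (\<Sum>v\<in>verts G. x v ^ k) = (\<Sum>e\<in>hedges G. ?L e)"
    using perron_hform[OF x] by (simp add: hform_def)
  also have "\<dots> < \<mu> * (\<Sum>v\<in>verts G. x v ^ k)"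
    using strict
  proof
    assume "\<exists>v\<in>verts G. ?W v < 1 + \<gamma>"
    then obtain v where v: "v \<in> verts G" "?W v < 1 + \<gamma>" by blast
    have lt: "(\<mu> - \<alpha>) * ?W v * x v ^ k < \<mu> * x v ^ k"
      by (subst \<mu>') (use v x0[OF v(1)] \<mu> in simp)
    have "(\<Sum>e\<in>hedges G. ?L e) \<le> (\<Sum>e\<in>hedges G. ?R e)" using LR by (rule sum_mono)
    also have "\<dots> = (\<Sum>v\<in>verts G. (\<mu> - \<alpha>) * ?W v * x v ^ k)"
      unfolding sum_edges_verts W ..
    also have "\<dots> < (\<Sum>v\<in>verts G. \<mu> * x v ^ k)"
      using finite_verts le lt v by (intro sum_strict_mono_ex1) auto
    finally show ?thesis by (simp add: sum_distrib_left)
  next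
    assume "\<exists>e\<in>hedges G. \<epsilon> < (\<Prod>v\<in>e. a v e)"
    then have "(\<Sum>e\<in>hedges G. ?L e) < (\<Sum>e\<in>hedges G. ?R e)"
      using finite_edges LR LR_strict by (intro sum_strict_mono_ex1) auto
    also have "\<dots> = (\<Sum>v\<in>verts G. (\<mu> - \<alpha>) * ?W v * x v ^ k)"
      unfolding sum_edges_verts W ..
    also have "\<dots> \<le> (\<Sum>v\<in>verts G. \<mu> * x v ^ k)"
      using le by (rule sum_mono)
    finally show ?thesis by (simp add: sum_distrib_left)
  qed
  finally have lt: "rho * (\<Sum>v\<in>verts G. x v ^ k) < \<mu> * (\<Sum>v\<in>verts G. x v ^ k)" .
  have "0 < (\<Sum>v\<in>verts G. x v ^ k)"
    using finite_verts verts_nonempty x0 by (intro sum_pos) auto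
  then show ?thesis using lt by simp
qed

text \<open>The label at (v, e) is the share of e in the eigenvalue equation at v, scaled by 1 /
  (\<rho> - \<alpha>). It is a constant times the product of x over e, divided by x_v^k, so the
  entries of x cancel in the product over an edge.\<close>

lemma rho_labelling:
  shows "\<alpha> < rho"
    and "\<exists>a. (\<forall>e\<in>hedges G. \<forall>v\<in>e. 0 < a v e)
      \<and> (\<forall>v\<in>verts G. (\<Sum>e\<in>incident v. a v e + \<alpha> / (rho - \<alpha>)) = 1 + \<alpha> / (rho - \<alpha>))
      \<and> (\<forall>e\<in>hedges G. (\<Prod>v\<in>e. a v e) = ((1 - \<alpha>) / (rho - \<alpha>)) ^ k)"
proof -
  obtain x where x: "perron rho x" using perron_exists by blast
  have x0: "0 < x v" if "v \<in> verts G" for v using x that by (simp add: perron_def)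
  have x0e: "0 < x v" if "e \<in> hedges G" "v \<in> e" for v e using x0 that edge_subset by blast
  have kk: "x v ^ k = x v * x v ^ (k - 1)" for v using k by (cases k) auto
  have eig: "\<alpha> * real (vdegree G v) + (1 - \<alpha>) * (\<Sum>e\<in>incident v. (\<Prod>u\<in>e. x u) / x v ^ k) = rho"
    if v: "v \<in> verts G" for v
  proof -
    have "(\<Prod>u\<in>e. x u) / x v ^ k = (\<Prod>u\<in>e - {v}. x u) / x v ^ (k - 1)" if "e \<in> hedges G" "v \<in> e" for e
      using x0[OF v] that by (simp add: prod.remove[OF finite_edge] kk)
    then have "(\<Sum>e\<in>incident v. (\<Prod>u\<in>e. x u) / x v ^ k)
        = (\<Sum>e\<in>incident v. (\<Prod>u\<in>e - {v}. x u)) / x v ^ (k - 1)"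
      by (simp add: sum_divide_distrib)
    moreover have "\<alpha> * real (vdegree G v) * x v ^ (k - 1)
       + (1 - \<alpha>) * (\<Sum>e\<in>incident v. \<Prod>u\<in>e - {v}. x u) = rho * x v ^ (k - 1)"
      using x v by (simp add: perron_def)
    ultimately have "(\<alpha> * real (vdegree G v) + (1 - \<alpha>) * (\<Sum>e\<in>incident v. (\<Prod>u\<in>e. x u) / x v ^ k))
        * x v ^ (k - 1) = rho * x v ^ (k - 1)"
      using x0[OF v] by (simp add: distrib_right mult.assoc)
    then show ?thesis using x0[OF v] by simp
  qed
  show \<alpha>_less: "\<alpha> < rho"
  proof -
    obtain e where e: "e \<in> hedges G" using edges_nonempty by blast
    then have "e \<noteq> {}" using card_edge k by fastforce
    then obtain v where v: "v \<in> e" "v \<in> verts G" using e edge_subset by blast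
    have fin: "finite (incident v)" using finite_edges by simp
    then have "card (incident v) > 0" using e v by (auto simp: card_gt_0_iff)
    then have "\<alpha> \<le> \<alpha> * real (vdegree G v)"
      using \<alpha> by (simp add: vdegree_def mult_le_cancel_left1)
    moreover have "0 < (\<Sum>e\<in>incident v. (\<Prod>u\<in>e. x u) / x v ^ k)"
      using fin e v x0e by (intro sum_pos) (auto intro!: divide_pos_pos prod_pos)
    then have "0 < (1 - \<alpha>) * (\<Sum>e\<in>incident v. (\<Prod>u\<in>e. x u) / x v ^ k)"
      using \<alpha> by simp
    ultimately show ?thesis using eig[OF v(2)] by linarith
  qed
  define a where "a v e = (1 - \<alpha>) / (rho - \<alpha>) * ((\<Prod>u\<in>e. x u) / x v ^ k)" for v e
  show "\<exists>a. (\<forall>e\<in>hedges G. \<forall>v\<in>e. 0 < a v e)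
      \<and> (\<forall>v\<in>verts G. (\<Sum>e\<in>incident v. a v e + \<alpha> / (rho - \<alpha>)) = 1 + \<alpha> / (rho - \<alpha>))
      \<and> (\<forall>e\<in>hedges G. (\<Prod>v\<in>e. a v e) = ((1 - \<alpha>) / (rho - \<alpha>)) ^ k)"
  proof (intro exI[of _ a] conjI ballI)
    fix e v assume "e \<in> hedges G" "v \<in> e"
    then show "0 < a v e"
      unfolding a_def using \<alpha> \<alpha>_less x0e by (intro mult_pos_pos divide_pos_pos prod_pos) auto
  next
    fix v assume v: "v \<in> verts G"
    have "(\<Sum>e\<in>incident v. a v e + \<alpha> / (rho - \<alpha>))
      = (\<alpha> * real (vdegree G v) + (1 - \<alpha>) * (\<Sum>e\<in>incident v. (\<Prod>u\<in>e. x u) / x v ^ k))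
        / (rho - \<alpha>)"
    proof -
      have "(\<Sum>e\<in>incident v. a v e)
          = (1 - \<alpha>) / (rho - \<alpha>) * (\<Sum>e\<in>incident v. (\<Prod>u\<in>e. x u) / x v ^ k)"
        unfolding a_def by (rule sum_distrib_left[symmetric])
      then show ?thesis
        by (simp only: sum.distrib) (simp add: vdegree_def add_divide_distrib mult.commute)
    qed
    also have "\<dots> = rho / (rho - \<alpha>)" unfolding eig[OF v] ..
    also have "\<dots> = 1 + \<alpha> / (rho - \<alpha>)" using \<alpha>_less by (simp add: field_simps)
    finally show "(\<Sum>e\<in>incident v. a v e + \<alpha> / (rho - \<alpha>)) = 1 + \<alpha> / (rho - \<alpha>)" .
  next
    fix e assume e: "e \<in> hedges G"
    have "(\<Prod>v\<in>e. x v ^ k) = (\<Prod>v\<in>e. x v) ^ k" by (simp add: prod_power_distrib)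
    moreover have "(\<Prod>v\<in>e. x v) \<noteq> 0" using x0e[OF e] finite_edge[OF e] by force
    ultimately show "(\<Prod>v\<in>e. a v e) = ((1 - \<alpha>) / (rho - \<alpha>)) ^ k"
      unfolding a_def using card_edge[OF e] by (simp add: prod.distrib prod_dividef power_mult_distrib power_divide)
  qed
qed

end

section \<open>Branches of supertrees\<close>

locale supertree = conn_hypergraph k G for k and G :: "'a hypergraph" +
  assumes acyclic: "\<nexists>vs es. is_cycle G vs es"
begin

text \<open>Adjacency of edges once \<open>v\<close> is deleted: the classes of its closure are the
  parts into which \<open>v\<close> splits the hypergraph, each recorded together with the edge that
  attaches it to \<open>v\<close>.\<close>

definition link :: "'a \<Rightarrow> ('a set \<times> 'a set) set" where
  "link v = {(e, f). e \<in> hedges G \<and> f \<in> hedges G \<and> (\<exists>x. x \<noteq> v \<and> x \<in> e \<and> x \<in> f)}"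

definition branch :: "'a \<Rightarrow> 'a set \<Rightarrow> 'a set set" where
  "branch v e = {f. (e, f) \<in> (link v)\<^sup>*}"

definition bsize :: "'a \<Rightarrow> 'a set \<Rightarrow> nat" where
  "bsize v e = card (branch v e)"

lemma link_rtrancl_sym: "(e, f) \<in> (link v)\<^sup>* \<Longrightarrow> (f, e) \<in> (link v)\<^sup>*"
  by (rule symD[OF sym_rtrancl]) (auto simp: sym_def link_def)

lemma branch_subset: "e \<in> hedges G \<Longrightarrow> branch v e \<subseteq> hedges G"
proof
  fix f assume "e \<in> hedges G" "f \<in> branch v e"
  then have "(e, f) \<in> (link v)\<^sup>*" by (simp add: branch_def)
  then show "f \<in> hedges G" using \<open>e \<in> hedges G\<close>
    by (induction rule: rtrancl_induct) (auto simp: link_def)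
qed

lemma self_branch: "e \<in> branch v e"
  by (simp add: branch_def)

text \<open>A shortest chain of edges avoiding \<open>v\<close> between two edges through \<open>v\<close> closes up to a cycle.\<close>

lemma branch_unique:
  assumes e: "e \<in> hedges G" "v \<in> e" and f: "f \<in> hedges G" "v \<in> f" and ef: "(e, f) \<in> (link v)\<^sup>*"
  shows "e = f"
proof (rule ccontr)
  assume "e \<noteq> f"
  define n where "n = (LEAST n. (e, f) \<in> link v ^^ n)"
  have "\<exists>n. (e, f) \<in> link v ^^ n" using ef by (simp add: rtrancl_power)
  then have n: "(e, f) \<in> link v ^^ n" unfolding n_def by (rule LeastI_ex)
  have least: "n \<le> j" if "(e, f) \<in> link v ^^ j" for j
    unfolding n_def using that by (rule Least_le)
  obtain g where g: "g 0 = e" "g n = f" "\<And>i. i < n \<Longrightarrow> (g i, g (Suc i)) \<in> link v"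
    using n by (auto simp: relpow_fun_conv)
  have seg: "(g i, g j) \<in> link v ^^ (j - i)" if "i \<le> j" "j \<le> n" for i j
    unfolding relpow_fun_conv
    by (rule exI[of _ "\<lambda>l. g (i + l)"]) (use g that in auto)
  \<comment> \<open>Minimality of n makes every segment of the chain a shortest one. Hence its edges
    are distinct, and so are the connecting vertices: x i = x j would link g i to g (Suc j) in one
    step.\<close>
  have shortcut: "j - i \<le> l" if ij: "i \<le> j" "j \<le> n" and l: "(g i, g j) \<in> link v ^^ l" for i j l
  proof -
    have "(e, g i) \<in> link v ^^ i" using seg[of 0 i] ij g by simp
    then have "(e, g j) \<in> link v ^^ (i + l)" using l by (auto simp: relpow_add)
    moreover have "(g j, f) \<in> link v ^^ (n - j)" using seg[of j n] ij g by simp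
    ultimately have "(e, f) \<in> link v ^^ (i + l + (n - j))" by (auto simp: relpow_add[of "i + l"])
    then show ?thesis using least ij by fastforce
  qed
  have gE: "g i \<in> hedges G" if "i \<le> n" for i
  proof (cases i)
    case 0 then show ?thesis using g e by simp
  next
    case (Suc j) then show ?thesis using g(3)[of j] that by (auto simp: link_def)
  qed
  have "\<forall>i. \<exists>x. i < n \<longrightarrow> x \<noteq> v \<and> x \<in> g i \<and> x \<in> g (Suc i)"
    using g(3) unfolding link_def by blast
  then obtain x where x: "\<And>i. i < n \<Longrightarrow> x i \<noteq> v \<and> x i \<in> g i \<and> x i \<in> g (Suc i)" by metis
  have "n \<noteq> 0" using g \<open>e \<noteq> f\<close> by auto
  have g_inj: "g i \<noteq> g j" if "i < j" "j \<le> n" for i j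
    using shortcut[of i j 0] that by auto
  have x_inj: "x i \<noteq> x j" if "i < j" "j < n" for i j
  proof
    assume eq: "x i = x j"
    have "(g i, g (Suc j)) \<in> link v"
      unfolding link_def using gE[of i] gE[of "Suc j"] x[of i] x[of j] that eq by auto
    then show False using shortcut[of i "Suc j" 1] that by auto
  qed
  \<comment> \<open>The vertex v, common to the first and the last edge, closes the chain; putting
    it in front of the connectors makes entry i of \<open>vs\<close> lie on entry i of
    \<open>es\<close> and on the preceding edge.\<close>
  define es where "es = map g [0..<Suc n]"
  define vs where "vs = v # map x [0..<n]"
  have "is_cycle G vs es"
    unfolding is_cycle_def
  proof (intro conjI allI impI)
    show "length vs = length es" "2 \<le> length es" using \<open>n \<noteq> 0\<close> by (simp_all add: es_def vs_def)
    have "inj_on x {0..<n}" using x_inj by (intro linorder_inj_onI) auto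
    moreover have "v \<notin> x ` {0..<n}" using x by fastforce
    ultimately show "distinct vs" by (simp add: vs_def distinct_map)
    have "inj_on g {0..<Suc n}" using g_inj by (intro linorder_inj_onI) auto
    then show "distinct es" unfolding es_def distinct_map by (simp del: upt_Suc)
    show "set es \<subseteq> hedges G" using gE by (auto simp: es_def)
    have "x i \<in> verts G" if "i < n" for i using x[OF that] gE[of i] that edge_subset by auto
    then show "set vs \<subseteq> verts G" using e edge_subset by (auto simp: vs_def)
    fix i assume "i < length es"
    then have i: "i \<le> n" by (simp add: es_def)
    then have esi: "es ! i = g i" unfolding es_def by (subst nth_map) (simp_all del: upt_Suc)
    show "vs ! i \<in> es ! i"
    proof (cases i)
      case 0 then show ?thesis using esi g e by (simp add: vs_def)
    next
      case (Suc j) then show ?thesis using esi x[of j] i by (simp add: vs_def)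
    qed
    show "vs ! (Suc i mod length vs) \<in> es ! i"
    proof (cases "i = n")
      case True then show ?thesis using esi g f by (simp add: vs_def)
    next
      case False then show ?thesis using esi x[of i] i by (simp add: vs_def)
    qed
  qed
  then show False using acyclic by blast
qed

text \<open>A second common vertex would link the two edges while avoiding the first one.\<close>

lemma linear:
  assumes "e \<in> hedges G" "f \<in> hedges G" "x \<in> e" "x \<in> f" "y \<in> e" "y \<in> f" "e \<noteq> f"
  shows "x = y"
proof (rule ccontr)
  assume "x \<noteq> y"
  then have "(e, f) \<in> link x" using assms by (auto simp: link_def)
  then show False using branch_unique[of e x f] assms by blast
qed

text \<open>Follow a path from \<open>v\<close> to a vertex of \<open>f\<close>; whenever it returns
  to \<open>v\<close>, a new branch is entered.\<close>

lemma branch_cover: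
  assumes v: "v \<in> verts G" and f: "f \<in> hedges G"
  shows "\<exists>e\<in>hedges G. v \<in> e \<and> f \<in> branch v e"
proof -
  have "card f \<ge> 2" using card_edge[OF f] k by simp
  \<comment> \<open>The end of the path must differ from v, since only such a vertex can link the
    last edge to \<open>f\<close>.\<close>
  then obtain y where y: "y \<in> f" "y \<noteq> v"
    by (metis One_nat_def card_le_Suc0_iff_eq card.infinite not_less_eq_eq numeral_2_eq_2 zero_le)
  have "(v, y) \<in> {(x, y). \<exists>e\<in>hedges G. x \<in> e \<and> y \<in> e}\<^sup>*"
    using connected v y f edge_subset by (auto simp: hconnected_def)
  then have "y = v \<or> (\<exists>e\<in>hedges G. v \<in> e \<and> (\<exists>h\<in>branch v e. y \<in> h))"
  proof (induction rule: rtrancl_induct)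
    case (step y z)
    then obtain h where h: "h \<in> hedges G" "y \<in> h" "z \<in> h" by auto
    show ?case
    proof (cases "y = v")
      case True
      then show ?thesis using h self_branch by blast
    next
      case False
      then obtain e h' where eh: "e \<in> hedges G" "v \<in> e" "h' \<in> branch v e" "y \<in> h'"
        using step.IH by blast
      then have "(h', h) \<in> link v" using h False branch_subset by (auto simp: link_def)
      then have "h \<in> branch v e" using eh by (simp add: branch_def)
      then show ?thesis using eh h by blast
    qed
  qed simp
  then obtain e h where eh: "e \<in> hedges G" "v \<in> e" "h \<in> branch v e" "y \<in> h" using y by blast
  then have "(h, f) \<in> link v" using f y branch_subset by (auto simp: link_def)
  then show ?thesis using eh by (auto simp: branch_def)
qed

lemma branch_disjoint:
  assumes "e \<in> hedges G" "v \<in> e" "f \<in> hedges G" "v \<in> f" "e \<noteq> f"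
  shows "branch v e \<inter> branch v f = {}"
proof (rule ccontr)
  assume "branch v e \<inter> branch v f \<noteq> {}"
  then obtain h where "(e, h) \<in> (link v)\<^sup>*" "(f, h) \<in> (link v)\<^sup>*" by (auto simp: branch_def)
  then have "(e, f) \<in> (link v)\<^sup>*" by (meson link_rtrancl_sym rtrancl_trans)
  then show False using branch_unique assms by blast
qed

lemma finite_branch: "e \<in> hedges G \<Longrightarrow> finite (branch v e)"
  using branch_subset finite_edges finite_subset by metis

lemma sum_bsize:
  assumes "v \<in> verts G"
  shows "(\<Sum>e\<in>incident v. bsize v e) = card (hedges G)"
proof -
  have "hedges G = (\<Union>e\<in>incident v. branch v e)"
    using branch_cover[OF assms] branch_subset by blast
  moreover have "card (\<Union>e\<in>incident v. branch v e)
      = (\<Sum>e\<in>incident v. card (branch v e))"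
    using finite_edges finite_branch branch_disjoint by (intro card_UN_disjoint) auto
  ultimately show ?thesis by (simp add: bsize_def)
qed

lemma bsize_pos: "e \<in> hedges G \<Longrightarrow> 0 < bsize v e"
  using self_branch[of e v] finite_branch by (auto simp: bsize_def card_gt_0_iff)

lemma bsize_le: "e \<in> hedges G \<Longrightarrow> bsize v e \<le> card (hedges G)"
  unfolding bsize_def using branch_subset finite_edges by (rule card_mono[rotated])

text \<open>If \<open>f\<close> is cut off from \<open>e\<close> by \<open>w\<close>, then a chain
  reaches it from \<open>w\<close> without using \<open>e\<close>. This chain never meets
  \<open>w'\<close>, because at \<open>w'\<close> it would be linked to \<open>e\<close>; so it
  stays on the side of \<open>e\<close> when \<open>w'\<close> is deleted.\<close>

lemma beyond_at_most_one:
  assumes e: "e \<in> hedges G" "w \<in> e" "w' \<in> e" "w \<noteq> w'"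
    and f: "f \<in> hedges G" "f \<notin> branch w e"
  shows "f \<in> branch w' e"
proof -
  obtain e1 where e1: "e1 \<in> hedges G" "w \<in> e1" "(e1, f) \<in> (link w)\<^sup>*"
    using branch_cover[of w f] e f edge_subset by (auto simp: branch_def)
  then have "e1 \<noteq> e" using f by (auto simp: branch_def)
  have "(e1, h) \<in> (link w)\<^sup>* \<Longrightarrow> h \<in> branch w' e" for h
  proof (induction rule: rtrancl_induct)
    case base
    have "(e, e1) \<in> link w'" using e e1 by (auto simp: link_def)
    then show ?case by (auto simp: branch_def)
  next
    case (step g h)
    then obtain x where x: "g \<in> hedges G" "h \<in> hedges G" "x \<noteq> w" "x \<in> g" "x \<in> h" by (auto simp: link_def)
    have "x \<noteq> w'"
    proof
      assume "x = w'"
      then have "(g, e) \<in> link w" using x e by (auto simp: link_def)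
      then have "(e1, e) \<in> (link w)\<^sup>*" using step.hyps(1) by simp
      then show False using branch_unique e e1 \<open>e1 \<noteq> e\<close> by blast
    qed
    then have "(g, h) \<in> link w'" using x by (auto simp: link_def)
    then show ?case using step.IH by (simp add: branch_def)
  qed
  then show ?thesis using e1 by blast
qed

text \<open>The induction runs along a path starting on \<open>e\<close>. Its invariant concerns all
  edges at the current vertex, because any of them may be the next one.\<close>

lemma beyond_some:
  assumes e: "e \<in> hedges G" and f: "f \<in> hedges G" "f \<noteq> e"
  shows "\<exists>w\<in>e. f \<notin> branch w e"
proof -
  obtain u where u: "u \<in> e" using card_edge[OF e] k by fastforce
  have "\<forall>h\<in>hedges G. y \<in> h \<longrightarrow> h = e \<or> (\<exists>w\<in>e. \<exists>g\<in>hedges G. w \<in> g \<and> g \<noteq> e \<and> h \<in> branch w g)"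
    if "(u, y) \<in> {(x, y). \<exists>e\<in>hedges G. x \<in> e \<and> y \<in> e}\<^sup>*" for y
    using that
  proof (induction rule: rtrancl_induct)
    case base
    then show ?case using u self_branch by blast
  next
    case (step y z)
    then obtain h where h: "h \<in> hedges G" "y \<in> h" "z \<in> h" by auto
    show ?case
    proof (intro ballI impI)
      fix h' assume h': "h' \<in> hedges G" "z \<in> h'"
      consider "h = e" | w g where "w \<in> e" "g \<in> hedges G" "w \<in> g" "g \<noteq> e" "h \<in> branch w g"
        using step.IH h by blast
      then show "h' = e \<or> (\<exists>w\<in>e. \<exists>g\<in>hedges G. w \<in> g \<and> g \<noteq> e \<and> h' \<in> branch w g)"
      proof cases
        case 1
        then show ?thesis using h h' self_branch by blast
      next
        case (2 w g)
        show ?thesis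
        proof (cases "z = w")
          case True
          then show ?thesis using 2 h' self_branch by blast
        next
          case False
          then have "(h, h') \<in> link w" using h h' by (auto simp: link_def)
          then have "h' \<in> branch w g" using 2 by (simp add: branch_def)
          then show ?thesis using 2 by blast
        qed
      qed
    qed
  qed
  moreover obtain y where y: "y \<in> f" using card_edge[OF f(1)] k by fastforce
  moreover have "(u, y) \<in> {(x, y). \<exists>e\<in>hedges G. x \<in> e \<and> y \<in> e}\<^sup>*"
    using connected u y e f edge_subset by (auto simp: hconnected_def)
  ultimately obtain w g where "w \<in> e" "g \<in> hedges G" "w \<in> g" "g \<noteq> e" "f \<in> branch w g"
    using f by blast
  then show ?thesis using branch_disjoint[of g w e] e by blast
qed

text \<open>The dual of \<open>sum_bsize\<close>: seen from an edge, the remaining edges are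
  partitioned according to the vertex of \<open>e\<close> behind which they hang.\<close>

lemma sum_beyond:
  assumes e: "e \<in> hedges G"
  shows "(\<Sum>w\<in>e. card (hedges G) - bsize w e) = card (hedges G) - 1"
proof -
  have "hedges G - {e} = (\<Union>w\<in>e. hedges G - branch w e)"
    using beyond_some[OF e] self_branch by blast
  moreover have "card (\<Union>w\<in>e. hedges G - branch w e) = (\<Sum>w\<in>e. card (hedges G - branch w e))"
    using finite_edge[OF e] finite_edges beyond_at_most_one[OF e] by (intro card_UN_disjoint) blast+
  moreover have "card (hedges G - branch w e) = card (hedges G) - bsize w e" for w
    unfolding bsize_def by (rule card_Diff_subset[OF finite_branch[OF e] branch_subset[OF e]])
  moreover have "card (hedges G - {e}) = card (hedges G) - 1" using e finite_edges by simp
  ultimately show ?thesis by simp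
qed

text \<open>Sum m over all incidences, splitting it into \<open>bsize w e\<close> and its
  complement. The first part is evaluated at vertices by \<open>sum_bsize\<close>, the second at
  edges by \<open>sum_beyond\<close>, which gives k m^2 = m (m - 1) + |V| m.\<close>

lemma card_verts: "card (verts G) = card (hedges G) * (k - 1) + 1"
proof -
  let ?m = "card (hedges G)"
  have m: "?m > 0" using edges_nonempty finite_edges by (simp add: card_gt_0_iff)
  have "?m * k * ?m = (\<Sum>e\<in>hedges G. \<Sum>w\<in>e. ?m)"
    using card_edge by simp
  also have "\<dots> = (\<Sum>e\<in>hedges G. \<Sum>w\<in>e. (?m - bsize w e) + bsize w e)"
    using bsize_le by (intro sum.cong refl) simp
  also have "\<dots> = (\<Sum>e\<in>hedges G. ?m - 1) + (\<Sum>w\<in>verts G. \<Sum>e\<in>incident w. bsize w e)"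
    unfolding sum.distrib by (subst (2) sum_edges_verts) (simp add: sum_beyond)
  also have "\<dots> = ?m * (?m - 1) + card (verts G) * ?m"
    using sum_bsize by simp
  finally have "?m * (k * ?m) = ?m * ((?m - 1) + card (verts G))" by (simp add: algebra_simps)
  then have "k * ?m = (?m - 1) + card (verts G)" using m by simp
  then show ?thesis using m k by (cases k; cases ?m) (auto simp: algebra_simps)
qed

lemma vdegree_pos:
  assumes "v \<in> verts G" shows "0 < vdegree G v"
proof -
  obtain f where "f \<in> hedges G" using edges_nonempty by blast
  then obtain e where "e \<in> hedges G" "v \<in> e" using branch_cover assms by blast
  then show ?thesis using finite_edges by (auto simp: vdegree_def card_gt_0_iff)
qed

text \<open>The total excess d_v - 1 is fixed, so a vertex of degree close to m leaves very little
  to distribute. The recognition of the eight supertrees rests on this budget.\<close>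

lemma sum_vdegree: "(\<Sum>v\<in>verts G. vdegree G v - 1) = card (hedges G) - 1"
proof -
  have "(\<Sum>v\<in>verts G. vdegree G v) = (\<Sum>e\<in>hedges G. \<Sum>v\<in>e. 1)"
    unfolding sum_edges_verts by (simp add: vdegree_def)
  also have "\<dots> = k * card (hedges G)" using card_edge by simp
  finally have "(\<Sum>v\<in>verts G. vdegree G v) = k * card (hedges G)" .
  moreover have "(\<Sum>v\<in>verts G. vdegree G v) = (\<Sum>v\<in>verts G. (vdegree G v - 1) + 1)"
    using vdegree_pos by (intro sum.cong refl) fastforce
  ultimately have "(\<Sum>v\<in>verts G. vdegree G v - 1) + card (verts G) = k * card (hedges G)"
    by (simp only: sum.distrib) simp
  then show ?thesis unfolding card_verts using k by (cases k) (auto simp: algebra_simps)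
qed

text \<open>On the way from \<open>u\<close> to an edge that misses \<open>u\<close>, the
  neighbourhood of \<open>u\<close> has to be left, and the vertex where this happens lies on two
  edges.\<close>

lemma branching_neighbour:
  assumes u: "u \<in> verts G" and g: "g \<in> hedges G" "u \<notin> g"
  obtains e w where "e \<in> hedges G" "u \<in> e" "w \<in> e" "w \<noteq> u" "2 \<le> vdegree G w"
proof -
  have two: "2 \<le> vdegree G w" if "e \<in> hedges G" "f \<in> hedges G" "w \<in> e" "w \<in> f" "e \<noteq> f" for w e f
  proof -
    have "card {e, f} \<le> vdegree G w"
      unfolding vdegree_def using that finite_edges by (intro card_mono) auto
    then show ?thesis using that by simp
  qed
  define P where "P x \<longleftrightarrow> (\<exists>e\<in>hedges G. u \<in> e \<and> x \<in> e)" for x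
  have Pu: "P u" using vdegree_pos[OF u] unfolding P_def vdegree_def
    by (metis (mono_tags, lifting) card.empty empty_Collect_eq less_irrefl)
  obtain z where z: "z \<in> g" using card_edge[OF g(1)] k by fastforce
  show ?thesis
  proof (cases "P z")
    case True
    then show ?thesis using two[of _ g z] g z that unfolding P_def by metis
  next
    case False
    moreover have "z \<in> verts G" using z g edge_subset by blast
    ultimately obtain h a b where h: "h \<in> hedges G" "a \<in> h" "b \<in> h" "P a" "\<not> P b"
      using boundary_edge[of u P z] u Pu by blast
    then obtain e where e: "e \<in> hedges G" "u \<in> e" "a \<in> e" unfolding P_def by blast
    then have "e \<noteq> h" "a \<noteq> u" using h unfolding P_def by blast+
    then show ?thesis using that[of e a] e h two[of e h a] by blast
  qed
qed

end

section \<open>Hypergraphs with pendent edges attached to a core\<close>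

text \<open>Shaped so that the core and the number of pendent edges at each of its vertices
  determine the hypergraph up to isomorphism, see \<open>pendent_over_iso\<close>.\<close>

definition pendent_over :: "nat \<Rightarrow> 'a hypergraph \<Rightarrow> 'a set \<Rightarrow> 'a set set \<Rightarrow> bool" where
  "pendent_over k G C F \<longleftrightarrow>
     uniform_hypergraph k G \<and> C \<subseteq> verts G \<and> F \<subseteq> hedges G \<and> (\<forall>e\<in>F. e \<subseteq> C) \<and>
     (\<forall>g\<in>hedges G - F. \<exists>!v. v \<in> C \<inter> g) \<and> (\<forall>x\<in>verts G - C. \<exists>!g. g \<in> hedges G \<and> x \<in> g)"

definition pendents :: "'a hypergraph \<Rightarrow> 'a set set \<Rightarrow> 'a \<Rightarrow> nat" where
  "pendents G F v = card {g \<in> hedges G - F. v \<in> g}"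

text \<open>A bijection of the cores extends in two stages: equal counts match the pendent edges at
  corresponding core vertices, and uniformity matches the k - 1 outer vertices of matched
  edges.\<close>

lemma pendent_over_iso:
  assumes G: "pendent_over k G C F" and H: "pendent_over k H D F'"
    and f: "bij_betw f C D" "(\<lambda>e. f ` e) ` F = F'"
    and count: "\<And>v. v \<in> C \<Longrightarrow> pendents G F v = pendents H F' (f v)"
  shows "G \<cong>\<^sub>h H"
proof -
  have finG: "finite (verts G)" and edgeG: "\<And>e. e \<in> hedges G \<Longrightarrow> e \<subseteq> verts G \<and> card e = k"
    and G1: "C \<subseteq> verts G" "F \<subseteq> hedges G" "\<And>e. e \<in> F \<Longrightarrow> e \<subseteq> C"
    and G2: "\<And>g. g \<in> hedges G - F \<Longrightarrow> \<exists>!v. v \<in> C \<inter> g"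
    and G3: "\<And>x. x \<in> verts G - C \<Longrightarrow> \<exists>!g. g \<in> hedges G \<and> x \<in> g"
    using G by (auto simp: pendent_over_def uniform_hypergraph_def)
  have finH: "finite (verts H)" and edgeH: "\<And>e. e \<in> hedges H \<Longrightarrow> e \<subseteq> verts H \<and> card e = k"
    and H1: "D \<subseteq> verts H" "F' \<subseteq> hedges H" "\<And>e. e \<in> F' \<Longrightarrow> e \<subseteq> D"
    and H2: "\<And>g. g \<in> hedges H - F' \<Longrightarrow> \<exists>!v. v \<in> D \<inter> g"
    and H3: "\<And>x. x \<in> verts H - D \<Longrightarrow> \<exists>!g. g \<in> hedges H \<and> x \<in> g"
    using H by (auto simp: pendent_over_def uniform_hypergraph_def)
  have fD: "f v \<in> D" if "v \<in> C" for v using f(1) that by (rule bij_betwE[rule_format])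
  have f_inj: "u = v" if "f u = f v" "u \<in> C" "v \<in> C" for u v
    using f(1) that unfolding bij_betw_def by (blast dest: inj_onD)
  have f_surj: "\<exists>v\<in>C. f v = d" if "d \<in> D" for d
    using f(1) that unfolding bij_betw_def by blast
  have finE: "finite (hedges G)" "finite (hedges H)"
    using finG finH edgeG edgeH by (meson PowI finite_Pow_iff finite_subset subsetI)+
  define P where "P v = {g \<in> hedges G - F. v \<in> g}" for v
  define Q where "Q v = {g \<in> hedges H - F'. v \<in> g}" for v
  have "\<forall>v. \<exists>b. v \<in> C \<longrightarrow> bij_betw b (P v) (Q (f v))"
    using count finE by (auto simp: pendents_def P_def Q_def intro!: finite_same_card_bij)
  then obtain b where b: "\<And>v. v \<in> C \<Longrightarrow> bij_betw (b v) (P v) (Q (f v))" by metis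
  define att where "att g = (THE v. v \<in> C \<inter> g)" for g
  have att: "att g \<in> C" "att g \<in> g" and att_eq: "\<And>v. v \<in> C \<Longrightarrow> v \<in> g \<Longrightarrow> att g = v"
    if "g \<in> hedges G - F" for g
    using theI'[OF G2[OF that]] G2[OF that] unfolding att_def by auto
  define \<beta> where "\<beta> g = b (att g) g" for g
  have \<beta>Q: "\<beta> g \<in> Q (f (att g))" if "g \<in> hedges G - F" for g
    using b[OF att(1)[OF that]] that att(2)[OF that] unfolding \<beta>_def
    by (auto simp: P_def dest!: bij_betwE)
  have \<beta>H: "\<beta> g \<in> hedges H - F'" "f (att g) \<in> \<beta> g" if "g \<in> hedges G - F" for g
    using \<beta>Q[OF that] by (auto simp: Q_def)
  have \<beta>D: "D \<inter> \<beta> g = {f (att g)}" if "g \<in> hedges G - F" for g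
    using H2[OF \<beta>H(1)[OF that]] \<beta>H(2)[OF that] fD[OF att(1)[OF that]] by auto
  have gC: "C \<inter> g = {att g}" if "g \<in> hedges G - F" for g
    using G2[OF that] att[OF that] by auto
  have \<beta>_inj: "g = g'" if g: "g \<in> hedges G - F" "g' \<in> hedges G - F" "\<beta> g = \<beta> g'" for g g'
  proof -
    have "f (att g) = f (att g')" using \<beta>D[OF g(1)] \<beta>D[OF g(2)] g(3) by auto
    then have "att g = att g'"
      using f(1) att(1) g by (auto simp: bij_betw_def inj_on_def)
    moreover have "inj_on (b (att g)) (P (att g))" using b[OF att(1)[OF g(1)]] by (simp add: bij_betw_def)
    moreover have "g \<in> P (att g)" "g' \<in> P (att g)"
      using g att(2)[OF g(1)] att(2)[OF g(2)] \<open>att g = att g'\<close> by (auto simp: P_def)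
    ultimately show ?thesis using g(3) by (auto simp: \<beta>_def dest: inj_onD)
  qed
  have \<beta>_surj: "\<exists>g\<in>hedges G - F. \<beta> g = h" if h: "h \<in> hedges H - F'" for h
  proof -
    obtain d where d: "d \<in> D" "d \<in> h" using H2[OF h] by blast
    then obtain v where v: "v \<in> C" "f v = d" using f_surj by blast
    then have "h \<in> Q (f v)" using d h by (simp add: Q_def)
    then have "h \<in> b v ` P v" using b[OF v(1)] by (simp add: bij_betw_def)
    then obtain g where g: "g \<in> P v" "b v g = h" by blast
    then have gE: "g \<in> hedges G - F" "v \<in> g" by (auto simp: P_def)
    then have "\<beta> g = h" using att_eq[OF gE(1) v(1)] g(2) by (simp add: \<beta>_def)
    then show ?thesis using gE by blast
  qed
  have "\<exists>t. bij_betw t (g - C) (\<beta> g - D)" if g: "g \<in> hedges G - F" for g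
  proof (rule finite_same_card_bij)
    have "finite g" "card g = k" using edgeG[of g] g finG finite_subset by auto
    moreover have "finite (\<beta> g)" "card (\<beta> g) = k"
      using edgeH[of "\<beta> g"] \<beta>H[OF g] finH finite_subset by auto
    moreover have "g - C = g - {att g}" "\<beta> g - D = \<beta> g - {f (att g)}"
      using gC[OF g] \<beta>D[OF g] by auto
    ultimately show "finite (g - C)" "finite (\<beta> g - D)" "card (g - C) = card (\<beta> g - D)"
      using att(2)[OF g] \<beta>H(2)[OF g] by simp_all
  qed
  then obtain t where t: "\<And>g. g \<in> hedges G - F \<Longrightarrow> bij_betw (t g) (g - C) (\<beta> g - D)" by metis
  define ed where "ed x = (THE g. g \<in> hedges G \<and> x \<in> g)" for x
  have ed: "ed x \<in> hedges G - F" "x \<in> ed x" and ed_eq: "\<And>g. g \<in> hedges G \<Longrightarrow> x \<in> g \<Longrightarrow> ed x = g"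
    if x: "x \<in> verts G - C" for x
    using theI'[OF G3[OF x]] G3[OF x] G1(3) x unfolding ed_def by auto
  \<comment> \<open>Outside the core, a vertex is moved by the bijection belonging to the only edge
    that contains it.\<close>
  define h where "h x = (if x \<in> C then f x else t (ed x) x)" for x
  have h_out: "h x \<in> \<beta> (ed x) - D" if x: "x \<in> verts G - C" for x
    using t[OF ed(1)[OF x]] ed(2)[OF x] x by (auto simp: h_def dest!: bij_betwE)
  have h_in: "h v \<in> D" if "v \<in> C" for v using that fD by (simp add: h_def)
  have "bij_betw h (verts G) (verts H)"
    unfolding bij_betw_def
  proof (intro conjI inj_onI equalityI subsetI)
    fix x y assume xy: "x \<in> verts G" "y \<in> verts G" "h x = h y"
    show "x = y"
    proof (cases "x \<in> C")
      case True
      then have "y \<in> C" using h_out[of y] xy h_in by (metis Diff_iff)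
      then show ?thesis using True xy f_inj by (simp add: h_def)
    next
      case False
      then have x: "x \<in> verts G - C" using xy by simp
      have "y \<notin> C" using h_out[OF x] xy(3) h_in by (metis Diff_iff)
      then have y: "y \<in> verts G - C" using xy by simp
      have ex: "ed x \<in> hedges G - F" and ey: "ed y \<in> hedges G - F" using ed(1) x y by blast+
      have "h x \<in> \<beta> (ed x)" "h x \<in> \<beta> (ed y)" "h x \<notin> D"
        using h_out[OF x] h_out[OF y] xy(3) by auto
      moreover have "\<beta> (ed x) \<in> hedges H" "\<beta> (ed y) \<in> hedges H"
        using \<beta>H(1) ex ey by auto
      ultimately have "\<beta> (ed x) = \<beta> (ed y)" using H3[of "h x"] edgeH by blast
      then have eq: "ed x = ed y" using \<beta>_inj ex ey by blast
      have "t (ed x) x = t (ed x) y" using xy(3) x y eq by (simp add: h_def)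
      moreover have "inj_on (t (ed x)) (ed x - C)" using t[OF ex] by (simp add: bij_betw_def)
      moreover have "x \<in> ed x - C" "y \<in> ed x - C" using ed(2)[OF x] ed(2)[OF y] x y eq by auto
      ultimately show ?thesis by (blast dest: inj_onD)
    qed
  next
    fix z assume "z \<in> h ` verts G"
    then obtain x where x: "x \<in> verts G" "z = h x" by blast
    show "z \<in> verts H"
    proof (cases "x \<in> C")
      case True then show ?thesis using x h_in H1(1) by blast
    next
      case False
      then have "x \<in> verts G - C" using x by simp
      then have "h x \<in> \<beta> (ed x)" "\<beta> (ed x) \<in> hedges H" using h_out \<beta>H(1) ed(1) by blast+
      then show ?thesis using edgeH x(2) by blast
    qed
  next
    fix z assume z: "z \<in> verts H"
    show "z \<in> h ` verts G"
    proof (cases "z \<in> D")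
      case True
      then obtain v where v: "v \<in> C" "f v = z" using f_surj by blast
      then have "h v = z" "v \<in> verts G" using G1(1) by (auto simp: h_def)
      then show ?thesis by blast
    next
      case False
      then obtain e where e: "e \<in> hedges H" "z \<in> e" using H3[of z] z by blast
      then have "e \<in> hedges H - F'" using H1(3) False by auto
      then obtain g where g: "g \<in> hedges G - F" "\<beta> g = e" using \<beta>_surj by blast
      then have "z \<in> t g ` (g - C)" using t[OF g(1)] e False by (simp add: bij_betw_def)
      then obtain x where x: "x \<in> g - C" "z = t g x" by blast
      then have xG: "x \<in> verts G - C" using g edgeG by auto
      then have "ed x = g" using ed_eq g x by blast
      then have "h x = z" "x \<in> verts G" using x xG by (auto simp: h_def)
      then show ?thesis by blast
    qed
  qed
  moreover have "(\<lambda>e. h ` e) ` hedges G = hedges H"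
  proof -
    have core: "h ` e = f ` e" if "e \<in> F" for e
      using G1(3)[OF that] by (intro image_cong) (auto simp: h_def)
    have pend: "h ` g = \<beta> g" if g: "g \<in> hedges G - F" for g
    proof -
      have "g = insert (att g) (g - C)" using gC[OF g] att(2)[OF g] by auto
      then have "h ` g = insert (h (att g)) (h ` (g - C))" by (metis image_insert)
      moreover have "h (att g) = f (att g)" using att(1)[OF g] by (simp add: h_def)
      moreover have "h ` (g - C) = t g ` (g - C)"
      proof (rule image_cong)
        fix x assume x: "x \<in> g - C"
        then have "x \<in> verts G - C" using g edgeG by auto
        then have "ed x = g" using ed_eq g x by blast
        then show "h x = t g x" using x by (simp add: h_def)
      qed simp
      moreover have "t g ` (g - C) = \<beta> g - D" using t[OF g] by (simp add: bij_betw_def)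
      moreover have "insert (f (att g)) (\<beta> g - D) = \<beta> g" using \<beta>D[OF g] \<beta>H(2)[OF g] by auto
      ultimately show ?thesis by simp
    qed
    have "(\<lambda>e. h ` e) ` hedges G = (\<lambda>e. h ` e) ` F \<union> (\<lambda>e. h ` e) ` (hedges G - F)"
      using G1(2) by blast
    also have "(\<lambda>e. h ` e) ` F = (\<lambda>e. f ` e) ` F" by (rule image_cong[OF refl core])
    also have "\<dots> = F'" by (rule f(2))
    also have "(\<lambda>e. h ` e) ` (hedges G - F) = \<beta> ` (hedges G - F)"
      by (rule image_cong[OF refl pend])
    also have "\<beta> ` (hedges G - F) = hedges H - F'"
      using \<beta>_surj \<beta>H(1) by blast
    finally show ?thesis using H1(2) by blast
  qed
  ultimately show ?thesis unfolding hypergraph_iso_def by blast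
qed

lemma pendent_over_connected:
  assumes G: "pendent_over k G C F" and "C \<noteq> {}"
    and core: "\<And>u v. u \<in> C \<Longrightarrow> v \<in> C \<Longrightarrow> (u, v) \<in> {(x, y). \<exists>e\<in>hedges G. x \<in> e \<and> y \<in> e}\<^sup>*"
  shows "hconnected G"
proof -
  let ?R = "{(x, y). \<exists>e\<in>hedges G. x \<in> e \<and> y \<in> e}"
  have sym: "(y, x) \<in> ?R\<^sup>*" if "(x, y) \<in> ?R\<^sup>*" for x y
    by (rule symD[OF sym_rtrancl that]) (auto simp: sym_def)
  have to_core: "\<exists>v\<in>C. (x, v) \<in> ?R\<^sup>*" if x: "x \<in> verts G" for x
  proof (cases "x \<in> C")
    case False
    then obtain g where g: "g \<in> hedges G" "x \<in> g"
      using G x unfolding pendent_over_def by (metis DiffI)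
    then have "g \<notin> F" using G False unfolding pendent_over_def by blast
    then obtain v where "v \<in> C" "v \<in> g" using G g unfolding pendent_over_def by (metis DiffI IntE)
    then show ?thesis using g by blast
  qed auto
  show ?thesis
    unfolding hconnected_def
  proof (intro ballI)
    fix u v assume "u \<in> verts G" "v \<in> verts G"
    then obtain u' v' where uv: "u' \<in> C" "(u, u') \<in> ?R\<^sup>*" "v' \<in> C" "(v, v') \<in> ?R\<^sup>*"
      using to_core[of u] to_core[of v] by blast
    show "(u, v) \<in> ?R\<^sup>*"
      by (rule rtrancl_trans[OF rtrancl_trans[OF uv(2) core[OF uv(1,3)]] sym[OF uv(4)]])
  qed
qed

section \<open>Labellings reduced to the core\<close>

context alpha_hypergraph
begin

lemma pendent_split:
  assumes G: "pendent_over k G C F" and v: "v \<in> C"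
    and pend: "\<And>g. g \<in> hedges G - F \<Longrightarrow> v \<in> g \<Longrightarrow> b g = c"
  shows "(\<Sum>e\<in>incident v. b e) = (\<Sum>e | e \<in> F \<and> v \<in> e. b e) + real (pendents G F v) * c"
proof -
  have F: "F \<subseteq> hedges G" using G by (simp add: pendent_over_def)
  have eq: "incident v = {e \<in> F. v \<in> e} \<union> {e \<in> hedges G - F. v \<in> e}" using F by blast
  have "(\<Sum>e\<in>incident v. b e)
      = (\<Sum>e | e \<in> F \<and> v \<in> e. b e) + (\<Sum>e | e \<in> hedges G - F \<and> v \<in> e. b e)"
    unfolding eq using F finite_edges by (intro sum.union_disjoint) (auto intro: finite_subset)
  also have "(\<Sum>e | e \<in> hedges G - F \<and> v \<in> e. b e) = (\<Sum>e | e \<in> hedges G - F \<and> v \<in> e. c)"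
    using pend by (intro sum.cong) auto
  finally show ?thesis by (simp add: pendents_def)
qed

lemma pendent_outside:
  assumes G: "pendent_over k G C F" and v: "v \<in> verts G - C"
  obtains g where "g \<in> hedges G - F" "incident v = {g}"
proof -
  obtain g where g: "g \<in> hedges G" "v \<in> g" "\<And>e. e \<in> hedges G \<Longrightarrow> v \<in> e \<Longrightarrow> e = g"
    using G v unfolding pendent_over_def by metis
  moreover have "g \<notin> F" using G v g unfolding pendent_over_def by blast
  ultimately show ?thesis using that[of g] by blast
qed

lemma pendent_prod:
  assumes G: "pendent_over k G C F" and g: "g \<in> hedges G - F"
    and pend: "\<And>v. v \<in> g - C \<Longrightarrow> b v = 1" and v: "v \<in> C" "v \<in> g"
  shows "(\<Prod>u\<in>g. b u) = (b v :: real)"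
proof -
  have "\<exists>!v. v \<in> C \<inter> g" using G g by (simp add: pendent_over_def)
  then have "(\<Prod>u\<in>g - {v}. b u) = 1" using v pend by (intro prod.neutral) auto
  moreover have "finite g" using g finite_edge by simp
  ultimately show ?thesis using prod.remove[of g v b] v by simp
qed

text \<open>A pendent edge gets the label \<epsilon> at its attachment vertex and 1 elsewhere. It
  then satisfies its own conditions with equality and costs exactly \<epsilon> + \<gamma> in the
  core.\<close>

lemma rho_less_pendent:
  assumes G: "pendent_over k G C F"
    and \<mu>: "\<alpha> < \<mu>" and \<gamma>: "\<gamma> = \<alpha> / (\<mu> - \<alpha>)" and \<epsilon>: "\<epsilon> = ((1 - \<alpha>) / (\<mu> - \<alpha>)) ^ k"
    and a: "\<And>e v. e \<in> F \<Longrightarrow> v \<in> e \<Longrightarrow> 0 < a v e"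
    and vertex: "\<And>v. v \<in> C \<Longrightarrow>
      (\<Sum>e | e \<in> F \<and> v \<in> e. a v e + \<gamma>) + real (pendents G F v) * (\<epsilon> + \<gamma>) \<le> 1 + \<gamma>"
    and edge: "\<And>e. e \<in> F \<Longrightarrow> \<epsilon> \<le> (\<Prod>v\<in>e. a v e)"
    and strict: "(\<exists>v\<in>C. (\<Sum>e | e \<in> F \<and> v \<in> e. a v e + \<gamma>) + real (pendents G F v) * (\<epsilon> + \<gamma>) < 1 + \<gamma>)
      \<or> (\<exists>e\<in>F. \<epsilon> < (\<Prod>v\<in>e. a v e))"
  shows "rho < \<mu>"
proof -
  define b where "b v e = (if e \<in> F then a v e else if v \<in> C then \<epsilon> else 1)" for v e
  have sub: "C \<subseteq> verts G" "F \<subseteq> hedges G" using G by (auto simp: pendent_over_def)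
  have \<epsilon>0: "0 < \<epsilon>" using \<mu> \<alpha> by (simp add: \<epsilon>)
  have core: "(\<Sum>e\<in>incident v. b v e + \<gamma>)
      = (\<Sum>e | e \<in> F \<and> v \<in> e. a v e + \<gamma>) + real (pendents G F v) * (\<epsilon> + \<gamma>)" if v: "v \<in> C" for v
  proof -
    have "(\<Sum>e | e \<in> F \<and> v \<in> e. b v e + \<gamma>) = (\<Sum>e | e \<in> F \<and> v \<in> e. a v e + \<gamma>)"
      by (intro sum.cong) (auto simp: b_def)
    then show ?thesis
      using pendent_split[OF G v, of "\<lambda>e. b v e + \<gamma>" "\<epsilon> + \<gamma>"] v by (simp add: b_def)
  qed
  have prodF: "(\<Prod>v\<in>e. b v e) = (\<Prod>v\<in>e. a v e)" if "e \<in> F" for e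
    using that by (simp add: b_def)
  show ?thesis
  proof (rule rho_less[OF \<mu> \<gamma> \<epsilon>, of b])
    fix e v assume "e \<in> hedges G" "v \<in> e"
    then show "0 < b v e" using a \<epsilon>0 by (simp add: b_def)
  next
    fix v assume v: "v \<in> verts G"
    show "(\<Sum>e\<in>incident v. b v e + \<gamma>) \<le> 1 + \<gamma>"
    proof (cases "v \<in> C")
      case True
      then show ?thesis using core vertex by simp
    next
      case False
      then obtain g where "g \<in> hedges G - F" "incident v = {g}"
        using pendent_outside[OF G] v by blast
      then show ?thesis using False by (simp add: b_def)
    qed
  next
    fix e assume e: "e \<in> hedges G"
    show "\<epsilon> \<le> (\<Prod>v\<in>e. b v e)"
    proof (cases "e \<in> F")
      case True
      then show ?thesis using prodF edge by simp
    next
      case False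
      then have e': "e \<in> hedges G - F" using e by simp
      then obtain v where v: "v \<in> C" "v \<in> e" using G unfolding pendent_over_def by (metis IntE)
      show ?thesis
        using pendent_prod[OF G e' _ v, of "\<lambda>v. b v e"] False v by (simp add: b_def)
    qed
  next
    show "(\<exists>v\<in>verts G. (\<Sum>e\<in>incident v. b v e + \<gamma>) < 1 + \<gamma>)
        \<or> (\<exists>e\<in>hedges G. \<epsilon> < (\<Prod>v\<in>e. b v e))"
      using strict
    proof
      assume "\<exists>v\<in>C. (\<Sum>e | e \<in> F \<and> v \<in> e. a v e + \<gamma>)
        + real (pendents G F v) * (\<epsilon> + \<gamma>) < 1 + \<gamma>"
      then show ?thesis using core sub(1) by force
    next
      assume "\<exists>e\<in>F. \<epsilon> < (\<Prod>v\<in>e. a v e)"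
      then show ?thesis using prodF sub(2) by force
    qed
  qed
qed

text \<open>Conversely, equality at a vertex of degree one forces the label 1, and then equality on
  a pendent edge forces \<epsilon> at its attachment vertex.\<close>

lemma rho_labelling_pendent:
  assumes G: "pendent_over k G C F"
  defines "\<gamma> \<equiv> \<alpha> / (rho - \<alpha>)" and "\<epsilon> \<equiv> ((1 - \<alpha>) / (rho - \<alpha>)) ^ k"
  shows "\<exists>a. (\<forall>e\<in>F. \<forall>v\<in>e. 0 < a v e) \<and> (\<forall>e\<in>F. (\<Prod>v\<in>e. a v e) = \<epsilon>) \<and>
    (\<forall>v\<in>C. (\<Sum>e | e \<in> F \<and> v \<in> e. a v e + \<gamma>) + real (pendents G F v) * (\<epsilon> + \<gamma>) = 1 + \<gamma>)"
proof -
  have sub: "C \<subseteq> verts G" "F \<subseteq> hedges G" using G by (auto simp: pendent_over_def)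
  obtain a where a: "\<And>e v. e \<in> hedges G \<Longrightarrow> v \<in> e \<Longrightarrow> 0 < a v e"
    and vertex: "\<And>v. v \<in> verts G \<Longrightarrow> (\<Sum>e\<in>incident v. a v e + \<gamma>) = 1 + \<gamma>"
    and edge: "\<And>e. e \<in> hedges G \<Longrightarrow> (\<Prod>v\<in>e. a v e) = \<epsilon>"
    using rho_labelling(2) unfolding \<gamma>_def \<epsilon>_def by blast
  have one: "a v g = 1" if g: "g \<in> hedges G" "v \<in> g - C" for v g
  proof -
    have v: "v \<in> verts G - C" using g edge_subset by blast
    then obtain g' where g': "incident v = {g'}"
      using pendent_outside[OF G] by metis
    moreover have "g \<in> incident v" using g by simp
    ultimately have "incident v = {g}" by simp
    then show ?thesis using vertex[of v] v by simp
  qed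
  have "a v g = \<epsilon>" if "g \<in> hedges G - F" "v \<in> C" "v \<in> g" for v g
    using pendent_prod[OF G that(1), of "\<lambda>v. a v g"] one that edge by auto
  then have "(\<Sum>e | e \<in> F \<and> v \<in> e. a v e + \<gamma>) + real (pendents G F v) * (\<epsilon> + \<gamma>) = 1 + \<gamma>" if "v \<in> C" for v
    using pendent_split[OF G that, of "\<lambda>e. a v e + \<gamma>" "\<epsilon> + \<gamma>"] vertex[of v] that sub by auto
  moreover have "\<forall>e\<in>F. \<forall>v\<in>e. 0 < a v e" "\<forall>e\<in>F. (\<Prod>v\<in>e. a v e) = \<epsilon>"
    using a edge sub(2) by blast+
  ultimately show ?thesis by blast
qed

end

text \<open>Zero counts are allowed, so the star (m - 1, 0, 0) and the double stars (a, b, 0) fall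
  under the same shape as T(t1,t2,t3).\<close>

definition edge_cored :: "nat \<Rightarrow> 'a hypergraph \<Rightarrow> nat \<Rightarrow> nat \<Rightarrow> nat \<Rightarrow> bool" where
  "edge_cored k G t1 t2 t3 \<longleftrightarrow> (\<exists>e u1 u2 u3. pendent_over k G e {e} \<and>
     {u1, u2, u3} \<subseteq> e \<and> u1 \<noteq> u2 \<and> u1 \<noteq> u3 \<and> u2 \<noteq> u3 \<and>
     pendents G {e} u1 = t1 \<and> pendents G {e} u2 = t2 \<and> pendents G {e} u3 = t3 \<and>
     (\<forall>v\<in>e - {u1, u2, u3}. pendents G {e} v = 0))"

text \<open>The counts exclude the two core edges; the middle vertex therefore has degree s2 + 2,
  and the outer ones have degrees s1 + 1 and s3 + 1.\<close>

definition path_cored :: "nat \<Rightarrow> 'a hypergraph \<Rightarrow> nat \<Rightarrow> nat \<Rightarrow> nat \<Rightarrow> bool" where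
  "path_cored k G s1 s2 s3 \<longleftrightarrow> (\<exists>e1 e2 u1 u2 u3. pendent_over k G (e1 \<union> e2) {e1, e2} \<and>
     e1 \<inter> e2 = {u2} \<and> u1 \<in> e1 - {u2} \<and> u3 \<in> e2 - {u2} \<and>
     pendents G {e1, e2} u1 = s1 \<and> pendents G {e1, e2} u2 = s2 \<and> pendents G {e1, e2} u3 = s3 \<and>
     (\<forall>v\<in>e1 \<union> e2 - {u1, u2, u3}. pendents G {e1, e2} v = 0))"

lemma pendent_over_edge:
  assumes "pendent_over k G C F" "e \<in> F"
  shows "e \<in> hedges G" "card e = k" "finite e"
proof -
  show e: "e \<in> hedges G" using assms by (auto simp: pendent_over_def)
  then have "e \<subseteq> verts G" "finite (verts G)" "card e = k"
    using assms by (auto simp: pendent_over_def uniform_hypergraph_def)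
  then show "card e = k" "finite e" by (auto intro: finite_subset)
qed

lemma bij_betw_fun_updI:
  assumes "bij_betw f A B" "x \<notin> A" "y \<notin> B"
  shows "bij_betw (f(x := y)) (insert x A) (insert y B)"
proof -
  have "bij_betw (f(x := y)) A B"
    using assms(1,2) by (subst bij_betw_cong[of A "f(x := y)" f]) auto
  then show ?thesis using notIn_Un_bij_betw[of x A "f(x := y)" B] assms by simp
qed

lemma edge_cored_iso:
  assumes G: "edge_cored k G t1 t2 t3" and H: "edge_cored k H t1 t2 t3"
  shows "G \<cong>\<^sub>h H"
proof -
  obtain e u1 u2 u3 where e: "pendent_over k G e {e}"
    and u: "{u1, u2, u3} \<subseteq> e" "u1 \<noteq> u2" "u1 \<noteq> u3" "u2 \<noteq> u3"
    and t: "pendents G {e} u1 = t1" "pendents G {e} u2 = t2" "pendents G {e} u3 = t3"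
      "\<And>v. v \<in> e - {u1, u2, u3} \<Longrightarrow> pendents G {e} v = 0"
    using G unfolding edge_cored_def by metis
  obtain e' u1' u2' u3' where e': "pendent_over k H e' {e'}"
    and u': "{u1', u2', u3'} \<subseteq> e'" "u1' \<noteq> u2'" "u1' \<noteq> u3'" "u2' \<noteq> u3'"
    and t': "pendents H {e'} u1' = t1" "pendents H {e'} u2' = t2" "pendents H {e'} u3' = t3"
      "\<And>v. v \<in> e' - {u1', u2', u3'} \<Longrightarrow> pendents H {e'} v = 0"
    using H unfolding edge_cored_def by metis
  have "card (e - {u1, u2, u3}) = card (e' - {u1', u2', u3'})"
    using pendent_over_edge(2,3)[OF e singletonI] pendent_over_edge(2,3)[OF e' singletonI] u u'
    by (simp add: card_Diff_subset)
  then obtain f where f: "bij_betw f (e - {u1, u2, u3}) (e' - {u1', u2', u3'})"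
    using finite_same_card_bij pendent_over_edge(3)[OF e singletonI] pendent_over_edge(3)[OF e' singletonI]
    by (metis finite_Diff)
  define h where "h = f(u3 := u3', u2 := u2', u1 := u1')"
  have "bij_betw h (insert u1 (insert u2 (insert u3 (e - {u1, u2, u3}))))
      (insert u1' (insert u2' (insert u3' (e' - {u1', u2', u3'}))))"
    unfolding h_def using u u' by (intro bij_betw_fun_updI f) blast+
  moreover have "insert u1 (insert u2 (insert u3 (e - {u1, u2, u3}))) = e"
    "insert u1' (insert u2' (insert u3' (e' - {u1', u2', u3'}))) = e'"
    using u u' by auto
  ultimately have h: "bij_betw h e e'" by simp
  have "pendents G {e} v = pendents H {e'} (h v)" if v: "v \<in> e" for v
  proof (cases "v \<in> {u1, u2, u3}")
    case True
    then show ?thesis using t t' u by (auto simp: h_def)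
  next
    case False
    then have "h v = f v" by (simp add: h_def)
    moreover have "f v \<in> e' - {u1', u2', u3'}" using f v False by (auto dest: bij_betwE)
    ultimately show ?thesis using t(4) t'(4) v False by simp
  qed
  moreover have "(\<lambda>e. h ` e) ` {e} = {e'}" using h by (simp add: bij_betw_def)
  ultimately show ?thesis using pendent_over_iso[OF e e' h] by blast
qed

lemma path_cored_iso:
  assumes G: "path_cored k G s1 s2 s3" and H: "path_cored k H s1 s2 s3"
  shows "G \<cong>\<^sub>h H"
proof -
  obtain e1 e2 u1 u2 u3 where e: "pendent_over k G (e1 \<union> e2) {e1, e2}"
    and u: "e1 \<inter> e2 = {u2}" "u1 \<in> e1 - {u2}" "u3 \<in> e2 - {u2}"
    and s: "pendents G {e1, e2} u1 = s1" "pendents G {e1, e2} u2 = s2" "pendents G {e1, e2} u3 = s3"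
      "\<And>v. v \<in> e1 \<union> e2 - {u1, u2, u3} \<Longrightarrow> pendents G {e1, e2} v = 0"
    using G unfolding path_cored_def by metis
  obtain e1' e2' u1' u2' u3' where e': "pendent_over k H (e1' \<union> e2') {e1', e2'}"
    and u': "e1' \<inter> e2' = {u2'}" "u1' \<in> e1' - {u2'}" "u3' \<in> e2' - {u2'}"
    and s': "pendents H {e1', e2'} u1' = s1" "pendents H {e1', e2'} u2' = s2" "pendents H {e1', e2'} u3' = s3"
      "\<And>v. v \<in> e1' \<union> e2' - {u1', u2', u3'} \<Longrightarrow> pendents H {e1', e2'} v = 0"
    using H unfolding path_cored_def by metis
  note fin = pendent_over_edge(2,3)[OF e, of e1] pendent_over_edge(2,3)[OF e, of e2]
    pendent_over_edge(2,3)[OF e', of e1'] pendent_over_edge(2,3)[OF e', of e2']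
  have in_e: "u2 \<in> e1" "u2 \<in> e2" "u2' \<in> e1'" "u2' \<in> e2'" using u(1) u'(1) by auto
  have "card (e1 - {u1, u2}) = card (e1' - {u1', u2'})" "card (e2 - {u3, u2}) = card (e2' - {u3', u2'})"
    using fin u u' in_e by (simp_all add: card_Diff_subset)
  then obtain f g where f: "bij_betw f (e1 - {u1, u2}) (e1' - {u1', u2'})"
    and g: "bij_betw g (e2 - {u3, u2}) (e2' - {u3', u2'})"
    using finite_same_card_bij fin by (metis finite_Diff insertCI)
  define f' where "f' = f(u2 := u2', u1 := u1')"
  define g' where "g' = g(u3 := u3')"
  have "bij_betw f' (insert u1 (insert u2 (e1 - {u1, u2}))) (insert u1' (insert u2' (e1' - {u1', u2'})))"
    unfolding f'_def using u u' in_e by (intro bij_betw_fun_updI f) blast+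
  moreover have "insert u1 (insert u2 (e1 - {u1, u2})) = e1" "insert u1' (insert u2' (e1' - {u1', u2'})) = e1'"
    using u u' in_e by auto
  ultimately have f': "bij_betw f' e1 e1'" by simp
  have "bij_betw g' (insert u3 (e2 - {u3, u2})) (insert u3' (e2' - {u3', u2'}))"
    unfolding g'_def using u u' in_e by (intro bij_betw_fun_updI g) blast+
  moreover have "insert u3 (e2 - {u3, u2}) = e2 - e1" "insert u3' (e2' - {u3', u2'}) = e2' - e1'"
    using u u' in_e by auto
  ultimately have g': "bij_betw g' (e2 - e1) (e2' - e1')" by simp
  \<comment> \<open>The shared vertex u2 is assigned by the map on e1 alone, so the pieces e1 and e2
    - e1 can be glued.\<close>
  define h where "h v = (if v \<in> e1 then f' v else g' v)" for v
  have h1: "bij_betw h e1 e1'" using f' by (rule bij_betw_cong[THEN iffD1, rotated]) (simp add: h_def)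
  have h2: "bij_betw h (e2 - e1) (e2' - e1')"
    using g' by (rule bij_betw_cong[THEN iffD1, rotated]) (simp add: h_def)
  have "bij_betw h (e1 \<union> (e2 - e1)) (e1' \<union> (e2' - e1'))"
    using h1 h2 by (rule bij_betw_combine) auto
  then have h: "bij_betw h (e1 \<union> e2) (e1' \<union> e2')" by simp
  have hu: "h u1 = u1'" "h u2 = u2'" "h u3 = u3'"
  proof -
    have "u3 \<notin> e1" using u by auto
    then show "h u1 = u1'" "h u2 = u2'" "h u3 = u3'"
      using u in_e by (auto simp: h_def f'_def g'_def)
  qed
  have img: "h ` e1 = e1'" using h1 by (simp add: bij_betw_def)
  have "h ` (e2 - e1) = e2' - e1'" using h2 by (simp add: bij_betw_def)
  moreover have "e2 = insert u2 (e2 - e1)" "e2' = insert u2' (e2' - e1')" using u(1) u'(1) by auto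
  ultimately have img2: "h ` e2 = e2'" using hu(2) by (metis image_insert)
  have "pendents G {e1, e2} v = pendents H {e1', e2'} (h v)" if v: "v \<in> e1 \<union> e2" for v
  proof (cases "v \<in> {u1, u2, u3}")
    case True
    then show ?thesis using s s' hu by auto
  next
    case False
    have "h v \<noteq> h w" if "w \<in> {u1, u2, u3}" for w
    proof
      assume "h v = h w"
      moreover have "w \<in> e1 \<union> e2" using that u in_e by auto
      ultimately have "v = w" using h v by (meson bij_betw_imp_inj_on inj_onD)
      then show False using False that by simp
    qed
    then have "h v \<noteq> h u1" "h v \<noteq> h u2" "h v \<noteq> h u3" by simp_all
    then have "h v \<notin> {u1', u2', u3'}" using hu by simp
    moreover have "h v \<in> e1' \<union> e2'" using h v by (auto dest: bij_betwE)
    ultimately show ?thesis using s(4) s'(4) v False by simp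
  qed
  moreover have "(\<lambda>e. h ` e) ` {e1, e2} = {e1', e2'}" using img img2 by simp
  ultimately show ?thesis using pendent_over_iso[OF e e' h] by blast
qed

lemma edge_cored_alpha:
  assumes "edge_cored k G t1 t2 t3" "3 \<le> k" "0 \<le> \<alpha>" "\<alpha> < 1"
  shows "alpha_hypergraph k G \<alpha>"
proof -
  obtain e u1 where e: "pendent_over k G e {e}" "u1 \<in> e"
    using assms(1) unfolding edge_cored_def by blast
  note eG = pendent_over_edge[OF e(1) singletonI]
  have "hconnected G"
    by (rule pendent_over_connected[OF e(1)]) (use e(2) eG(1) in \<open>auto intro!: r_into_rtrancl\<close>)
  then show ?thesis
    using assms e(1) eG(1) by unfold_locales (auto simp: pendent_over_def)
qed

lemma path_cored_alpha:
  assumes "path_cored k G t1 t2 t3" "3 \<le> k" "0 \<le> \<alpha>" "\<alpha> < 1"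
  shows "alpha_hypergraph k G \<alpha>"
proof -
  obtain e1 e2 u2 where e: "pendent_over k G (e1 \<union> e2) {e1, e2}" "e1 \<inter> e2 = {u2}"
    using assms(1) unfolding path_cored_def by blast
  have eG: "e1 \<in> hedges G" "e2 \<in> hedges G" using pendent_over_edge(1)[OF e(1)] by auto
  have u2: "u2 \<in> e1" "u2 \<in> e2" using e(2) by auto
  let ?R = "{(x, y). \<exists>e\<in>hedges G. x \<in> e \<and> y \<in> e}"
  have "(u, u2) \<in> ?R" "(u2, u) \<in> ?R" if "u \<in> e1 \<union> e2" for u
    using that eG u2 by auto
  then have "(u, v) \<in> ?R\<^sup>*" if "u \<in> e1 \<union> e2" "v \<in> e1 \<union> e2" for u v
    using that by (meson converse_rtrancl_into_rtrancl r_into_rtrancl)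
  then have "hconnected G"
    using pendent_over_connected[OF e(1)] u2 by blast
  then show ?thesis
    using assms e(1) eG(1) by unfold_locales (auto simp: pendent_over_def)
qed

text \<open>With \<open>\<mu>\<close> the spectral parameter, \<open>eps\<close> is the product of the labels over an edge and
  \<open>del\<close> the weight which a pendent edge takes up at its attachment vertex.\<close>

definition gam :: "real \<Rightarrow> real \<Rightarrow> real" where "gam \<alpha> \<mu> = \<alpha> / (\<mu> - \<alpha>)"
definition eps :: "real \<Rightarrow> nat \<Rightarrow> real \<Rightarrow> real" where "eps \<alpha> k \<mu> = ((1 - \<alpha>) / (\<mu> - \<alpha>)) ^ k"
definition del :: "real \<Rightarrow> nat \<Rightarrow> real \<Rightarrow> real" where "del \<alpha> k \<mu> = eps \<alpha> k \<mu> + gam \<alpha> \<mu>"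

lemma eps_gam_pos:
  assumes "0 \<le> \<alpha>" "\<alpha> < 1" "\<alpha> < \<mu>"
  shows "0 < eps \<alpha> k \<mu>" "0 \<le> gam \<alpha> \<mu>" "eps \<alpha> k \<mu> \<le> del \<alpha> k \<mu>" "0 < del \<alpha> k \<mu>"
proof -
  show *: "0 < eps \<alpha> k \<mu>" "0 \<le> gam \<alpha> \<mu>" using assms by (simp_all add: eps_def gam_def)
  then show "eps \<alpha> k \<mu> \<le> del \<alpha> k \<mu>" "0 < del \<alpha> k \<mu>" by (simp_all add: del_def)
qed

lemma prod_three:
  fixes f :: "'a \<Rightarrow> real"
  assumes "finite e" "{u1, u2, u3} \<subseteq> e" "u1 \<noteq> u2" "u1 \<noteq> u3" "u2 \<noteq> u3"
    and "\<And>v. v \<in> e - {u1, u2, u3} \<Longrightarrow> f v = 1"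
  shows "(\<Prod>v\<in>e. f v) = f u1 * f u2 * f u3"
proof -
  have "(\<Prod>v\<in>e. f v) = (\<Prod>v\<in>{u1, u2, u3}. f v)"
    using assms by (intro prod.mono_neutral_right) auto
  then show ?thesis using assms(3-5) by (simp add: mult.assoc)
qed

lemma prod_two:
  fixes f :: "'a \<Rightarrow> real"
  assumes "finite e" "{u1, u2} \<subseteq> e" "u1 \<noteq> u2" and "\<And>v. v \<in> e - {u1, u2} \<Longrightarrow> f v = 1"
  shows "(\<Prod>v\<in>e. f v) = f u1 * f u2"
proof -
  have "(\<Prod>v\<in>e. f v) = (\<Prod>v\<in>{u1, u2}. f v)"
    using assms by (intro prod.mono_neutral_right) auto
  then show ?thesis using assms(3) by simp
qed

text \<open>Every core vertex lies on one core edge only, so its label is what the pendent edges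
  leave over. Core vertices without pendent edges get the label 1, which is how k drops out of the
  product.\<close>

lemma edge_cored_eq:
  assumes G: "edge_cored k G t1 t2 t3" and k: "3 \<le> k" and \<alpha>: "0 \<le> \<alpha>" "\<alpha> < 1"
    and \<mu>: "\<mu> = alpha_spectral_radius \<alpha> k G" and \<delta>: "\<delta> = del \<alpha> k \<mu>"
  shows "\<alpha> < \<mu>" "real t1 * \<delta> < 1" "real t2 * \<delta> < 1" "real t3 * \<delta> < 1"
    "(1 - real t1 * \<delta>) * (1 - real t2 * \<delta>) * (1 - real t3 * \<delta>) = eps \<alpha> k \<mu>"
proof -
  interpret alpha_hypergraph k G \<alpha> using edge_cored_alpha[OF G k \<alpha>] .
  show "\<alpha> < \<mu>" using rho_labelling(1) \<mu> by simp
  obtain e u1 u2 u3 where e: "pendent_over k G e {e}"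
    and u: "{u1, u2, u3} \<subseteq> e" "u1 \<noteq> u2" "u1 \<noteq> u3" "u2 \<noteq> u3"
    and t: "pendents G {e} u1 = t1" "pendents G {e} u2 = t2" "pendents G {e} u3 = t3"
      "\<And>v. v \<in> e - {u1, u2, u3} \<Longrightarrow> pendents G {e} v = 0"
    using G unfolding edge_cored_def by metis
  obtain a where a: "\<forall>f\<in>{e}. \<forall>v\<in>f. 0 < a v f" "\<forall>f\<in>{e}. (\<Prod>v\<in>f. a v f) = eps \<alpha> k \<mu>"
    "\<forall>v\<in>e. (\<Sum>f | f \<in> {e} \<and> v \<in> f. a v f + gam \<alpha> \<mu>) + real (pendents G {e} v) * \<delta> = 1 + gam \<alpha> \<mu>"
    using rho_labelling_pendent[OF e] unfolding eps_def gam_def \<delta> del_def \<mu> by blast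
  have av: "a v e = 1 - real (pendents G {e} v) * \<delta>" if "v \<in> e" for v
  proof -
    have S: "{f. f \<in> {e} \<and> v \<in> f} = {e}" using that by auto
    show ?thesis using bspec[OF a(3) that] unfolding S by simp
  qed
  have pos: "0 < a v e" if "v \<in> e" for v using a(1) that by simp
  show "real t1 * \<delta> < 1" "real t2 * \<delta> < 1" "real t3 * \<delta> < 1"
    using av[of u1] av[of u2] av[of u3] pos[of u1] pos[of u2] pos[of u3] u t by auto
  have "(\<Prod>v\<in>e. a v e) = a u1 e * a u2 e * a u3 e"
    using u t(4) av pendent_over_edge(3)[OF e singletonI] by (intro prod_three) auto
  then show "(1 - real t1 * \<delta>) * (1 - real t2 * \<delta>) * (1 - real t3 * \<delta>) = eps \<alpha> k \<mu>"
    using a(2) av u t by simp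
qed

text \<open>The labels forced in \<open>edge_cored_eq\<close>, now at a foreign \<mu>: all vertices
  are filled exactly, and the slack shows up in the product over the core edge.\<close>

lemma edge_cored_less:
  assumes G: "edge_cored k G t1 t2 t3" and k: "3 \<le> k" and \<alpha>: "0 \<le> \<alpha>" "\<alpha> < 1"
    and \<mu>: "\<alpha> < \<mu>" and \<delta>: "\<delta> = del \<alpha> k \<mu>"
    and "real t1 * \<delta> < 1" "real t2 * \<delta> < 1" "real t3 * \<delta> < 1"
    and lt: "eps \<alpha> k \<mu> < (1 - real t1 * \<delta>) * (1 - real t2 * \<delta>) * (1 - real t3 * \<delta>)"
  shows "alpha_spectral_radius \<alpha> k G < \<mu>"
proof -
  interpret alpha_hypergraph k G \<alpha> using edge_cored_alpha[OF G k \<alpha>] .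
  obtain e u1 u2 u3 where e: "pendent_over k G e {e}"
    and u: "{u1, u2, u3} \<subseteq> e" "u1 \<noteq> u2" "u1 \<noteq> u3" "u2 \<noteq> u3"
    and t: "pendents G {e} u1 = t1" "pendents G {e} u2 = t2" "pendents G {e} u3 = t3"
      "\<And>v. v \<in> e - {u1, u2, u3} \<Longrightarrow> pendents G {e} v = 0"
    using G unfolding edge_cored_def by metis
  define a where "a v f = 1 - real (pendents G {e} v) * \<delta>" for v and f :: "'a set"
  have prod: "(\<Prod>v\<in>e. a v e) = a u1 e * a u2 e * a u3 e"
    using u t(4) pendent_over_edge(3)[OF e singletonI] by (intro prod_three) (auto simp: a_def)
  have ineq: "eps \<alpha> k \<mu> < (\<Prod>v\<in>e. a v e)" using lt t unfolding prod by (simp add: a_def)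
  show ?thesis
  proof (rule rho_less_pendent[OF e \<mu> gam_def eps_def, of a])
    fix f v assume "f \<in> {e}" "v \<in> f"
    then show "0 < a v f" using assms(7-9) t by (cases "v \<in> {u1, u2, u3}") (auto simp: a_def)
  next
    fix v assume "v \<in> e"
    then have S: "{f. f \<in> {e} \<and> v \<in> f} = {e}" by auto
    show "(\<Sum>f | f \<in> {e} \<and> v \<in> f. a v f + gam \<alpha> \<mu>)
        + real (pendents G {e} v) * (eps \<alpha> k \<mu> + gam \<alpha> \<mu>) \<le> 1 + gam \<alpha> \<mu>"
      unfolding S by (simp add: a_def \<delta> del_def)
  qed (use ineq in auto)
qed

text \<open>The labels at the two outer attachment vertices are forced; each core edge then
  determines its label at the middle vertex, where the remaining equation is read off.\<close>

lemma path_cored_eq: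
  assumes G: "path_cored k G s1 s2 s3" and k: "3 \<le> k" and \<alpha>: "0 \<le> \<alpha>" "\<alpha> < 1"
    and \<mu>: "\<mu> = alpha_spectral_radius \<alpha> k G" and \<delta>: "\<delta> = del \<alpha> k \<mu>" and \<epsilon>: "\<epsilon> = eps \<alpha> k \<mu>"
  shows "\<alpha> < \<mu>" "real s1 * \<delta> < 1" "real s3 * \<delta> < 1"
    "real s2 * \<delta> + (\<delta> - \<epsilon>) + \<epsilon> / (1 - real s1 * \<delta>) + \<epsilon> / (1 - real s3 * \<delta>) = 1"
proof -
  interpret alpha_hypergraph k G \<alpha> using path_cored_alpha[OF G k \<alpha>] .
  show "\<alpha> < \<mu>" using rho_labelling(1) \<mu> by simp
  obtain e1 e2 u1 u2 u3 where e: "pendent_over k G (e1 \<union> e2) {e1, e2}"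
    and u: "e1 \<inter> e2 = {u2}" "u1 \<in> e1 - {u2}" "u3 \<in> e2 - {u2}"
    and s: "pendents G {e1, e2} u1 = s1" "pendents G {e1, e2} u2 = s2" "pendents G {e1, e2} u3 = s3"
      "\<And>v. v \<in> e1 \<union> e2 - {u1, u2, u3} \<Longrightarrow> pendents G {e1, e2} v = 0"
    using G unfolding path_cored_def by metis
  let ?p = "\<lambda>v. real (pendents G {e1, e2} v)"
  obtain a where a: "\<forall>f\<in>{e1, e2}. \<forall>v\<in>f. 0 < a v f" "\<forall>f\<in>{e1, e2}. (\<Prod>v\<in>f. a v f) = \<epsilon>"
    "\<forall>v\<in>e1 \<union> e2. (\<Sum>f | f \<in> {e1, e2} \<and> v \<in> f. a v f + gam \<alpha> \<mu>) + ?p v * \<delta> = 1 + gam \<alpha> \<mu>"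
    using rho_labelling_pendent[OF e] unfolding eps_def gam_def \<epsilon> \<delta> del_def \<mu> by blast
  have u0: "x = u2" if "x \<in> e1" "x \<in> e2" for x using u(1) that by blast
  have u': "u2 \<in> e1" "u2 \<in> e2" "u1 \<notin> e2" "u3 \<notin> e1" "e1 \<noteq> e2" using u by auto
  have a1: "a v e1 = 1 - ?p v * \<delta>" if "v \<in> e1 - {u2}" for v
  proof -
    have S: "{f. f \<in> {e1, e2} \<and> v \<in> f} = {e1}" using that u0 by auto
    have "v \<in> e1 \<union> e2" using that by simp
    from bspec[OF a(3) this] show ?thesis unfolding S by simp
  qed
  have a2: "a v e2 = 1 - ?p v * \<delta>" if "v \<in> e2 - {u2}" for v
  proof -
    have S: "{f. f \<in> {e1, e2} \<and> v \<in> f} = {e2}" using that u0 by auto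
    have "v \<in> e1 \<union> e2" using that by simp
    from bspec[OF a(3) this] show ?thesis unfolding S by simp
  qed
  have "0 < a u1 e1" "0 < a u3 e2" using a(1) u(2,3) by blast+
  then show s1: "real s1 * \<delta> < 1" and s3: "real s3 * \<delta> < 1" using a1[OF u(2)] a2[OF u(3)] s by simp_all
  have "(\<Prod>v\<in>e1. a v e1) = a u1 e1 * a u2 e1"
  proof (rule prod_two)
    fix v assume v: "v \<in> e1 - {u1, u2}"
    then have "v \<in> e1 \<union> e2 - {u1, u2, u3}" using u' by blast
    then show "a v e1 = 1" using a1[of v] s(4) v by simp
  qed (use u u' pendent_over_edge(3)[OF e, of e1] in auto)
  then have "a u2 e1 = \<epsilon> / (1 - real s1 * \<delta>)" using a(2) a1[OF u(2)] s s1 by (simp add: field_simps)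
  moreover have "(\<Prod>v\<in>e2. a v e2) = a u3 e2 * a u2 e2"
  proof (rule prod_two)
    fix v assume v: "v \<in> e2 - {u3, u2}"
    then have "v \<in> e1 \<union> e2 - {u1, u2, u3}" using u' by blast
    then show "a v e2 = 1" using a2[of v] s(4) v by simp
  qed (use u u' pendent_over_edge(3)[OF e, of e2] in auto)
  then have "a u2 e2 = \<epsilon> / (1 - real s3 * \<delta>)" using a(2) a2[OF u(3)] s s3 by (simp add: field_simps)
  moreover have S: "{f. f \<in> {e1, e2} \<and> u2 \<in> f} = {e1, e2}" using u' by auto
  have "u2 \<in> e1 \<union> e2" using u' by simp
  from bspec[OF a(3) this]
  have "a u2 e1 + gam \<alpha> \<mu> + (a u2 e2 + gam \<alpha> \<mu>) + ?p u2 * \<delta> = 1 + gam \<alpha> \<mu>"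
    unfolding S using u' by simp
  moreover have "gam \<alpha> \<mu> = \<delta> - \<epsilon>" by (simp add: \<delta> \<epsilon> del_def)
  ultimately show "real s2 * \<delta> + (\<delta> - \<epsilon>) + \<epsilon> / (1 - real s1 * \<delta>) + \<epsilon> / (1 - real s3 * \<delta>) = 1"
    using s(2) by simp
qed

text \<open>Here both core edges are kept at product exactly \<epsilon>, and the slack sits at the
  middle vertex.\<close>

lemma path_cored_less:
  assumes G: "path_cored k G s1 s2 s3" and k: "3 \<le> k" and \<alpha>: "0 \<le> \<alpha>" "\<alpha> < 1"
    and \<mu>: "\<alpha> < \<mu>" and \<delta>: "\<delta> = del \<alpha> k \<mu>" and \<epsilon>: "\<epsilon> = eps \<alpha> k \<mu>"
    and s1: "real s1 * \<delta> < 1" and s3: "real s3 * \<delta> < 1"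
    and lt: "real s2 * \<delta> + (\<delta> - \<epsilon>) + \<epsilon> / (1 - real s1 * \<delta>) + \<epsilon> / (1 - real s3 * \<delta>) < 1"
  shows "alpha_spectral_radius \<alpha> k G < \<mu>"
proof -
  interpret alpha_hypergraph k G \<alpha> using path_cored_alpha[OF G k \<alpha>] .
  obtain e1 e2 u1 u2 u3 where e: "pendent_over k G (e1 \<union> e2) {e1, e2}"
    and u: "e1 \<inter> e2 = {u2}" "u1 \<in> e1 - {u2}" "u3 \<in> e2 - {u2}"
    and s: "pendents G {e1, e2} u1 = s1" "pendents G {e1, e2} u2 = s2" "pendents G {e1, e2} u3 = s3"
      "\<And>v. v \<in> e1 \<union> e2 - {u1, u2, u3} \<Longrightarrow> pendents G {e1, e2} v = 0"
    using G unfolding path_cored_def by metis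
  let ?p = "\<lambda>v. real (pendents G {e1, e2} v)"
  have u0: "x = u2" if "x \<in> e1" "x \<in> e2" for x using u(1) that by blast
  have u': "u2 \<in> e1" "u2 \<in> e2" "u1 \<notin> e2" "u3 \<notin> e1" "e1 \<noteq> e2" "u1 \<noteq> u2" "u3 \<noteq> u2" using u by auto
  have \<epsilon>0: "0 < \<epsilon>" using eps_gam_pos[OF \<alpha> \<mu>] \<epsilon> by simp
  define a where "a v f = (if v \<noteq> u2 then 1 - ?p v * \<delta> else
    if f = e1 then \<epsilon> / (1 - real s1 * \<delta>) else \<epsilon> / (1 - real s3 * \<delta>))" for v and f :: "'a set"
  have vertex: "(\<Sum>f | f \<in> {e1, e2} \<and> v \<in> f. a v f + gam \<alpha> \<mu>) + ?p v * (\<epsilon> + gam \<alpha> \<mu>) \<le> 1 + gam \<alpha> \<mu>"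
    if v: "v \<in> e1 \<union> e2" "v \<noteq> u2" for v
  proof -
    have "{f. f \<in> {e1, e2} \<and> v \<in> f} = {e1} \<or> {f. f \<in> {e1, e2} \<and> v \<in> f} = {e2}" using v u0 by auto
    then show ?thesis
    proof
      assume S: "{f. f \<in> {e1, e2} \<and> v \<in> f} = {e1}"
      show ?thesis unfolding S using v by (simp add: a_def \<delta> \<epsilon> del_def)
    next
      assume S: "{f. f \<in> {e1, e2} \<and> v \<in> f} = {e2}"
      show ?thesis unfolding S using v by (simp add: a_def \<delta> \<epsilon> del_def)
    qed
  qed
  have S: "{f. f \<in> {e1, e2} \<and> u2 \<in> f} = {e1, e2}" using u' by auto
  have centre: "(\<Sum>f | f \<in> {e1, e2} \<and> u2 \<in> f. a u2 f + gam \<alpha> \<mu>) + ?p u2 * (\<epsilon> + gam \<alpha> \<mu>) < 1 + gam \<alpha> \<mu>"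
    unfolding S using lt u' s(2) by (simp add: a_def \<delta> \<epsilon> del_def)
  have "(\<Prod>v\<in>e1. a v e1) = a u1 e1 * a u2 e1"
  proof (rule prod_two)
    fix v assume v: "v \<in> e1 - {u1, u2}"
    then have "v \<in> e1 \<union> e2 - {u1, u2, u3}" using u' by blast
    then show "a v e1 = 1" using s(4) v by (simp add: a_def)
  qed (use u u' pendent_over_edge(3)[OF e, of e1] in auto)
  then have p1: "(\<Prod>v\<in>e1. a v e1) = \<epsilon>" using s u' s1 by (simp add: a_def)
  have "(\<Prod>v\<in>e2. a v e2) = a u3 e2 * a u2 e2"
  proof (rule prod_two)
    fix v assume v: "v \<in> e2 - {u3, u2}"
    then have "v \<in> e1 \<union> e2 - {u1, u2, u3}" using u' by blast
    then show "a v e2 = 1" using s(4) v by (simp add: a_def)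
  qed (use u u' pendent_over_edge(3)[OF e, of e2] in auto)
  then have p2: "(\<Prod>v\<in>e2. a v e2) = \<epsilon>" using s u' s3 by (simp add: a_def)
  show ?thesis
  proof (rule rho_less_pendent[OF e \<mu> gam_def \<epsilon>[unfolded eps_def], of a])
    fix f v assume "f \<in> {e1, e2}" "v \<in> f"
    then have "v \<in> e1 \<union> e2" by auto
    then show "0 < a v f"
      using s s1 s3 \<epsilon>0 by (cases "v \<in> {u1, u2, u3}") (auto simp: a_def)
  next
    fix v assume "v \<in> e1 \<union> e2"
    then show "(\<Sum>f | f \<in> {e1, e2} \<and> v \<in> f. a v f + gam \<alpha> \<mu>) + ?p v * (\<epsilon> + gam \<alpha> \<mu>) \<le> 1 + gam \<alpha> \<mu>"
      using vertex centre by (cases "v = u2") auto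
  next
    fix f assume "f \<in> {e1, e2}"
    then show "\<epsilon> \<le> (\<Prod>v\<in>f. a v f)" using p1 p2 by auto
  qed (use centre u' in blast)
qed

section \<open>The eight supertrees\<close>

definition power_edge :: "nat \<Rightarrow> 'a set \<Rightarrow> ('a + 'a set \<times> nat) set" where
  "power_edge k e = e <+> ({e} \<times> {..<k - 2})"

lemma in_power_edge [simp]:
  "Inl v \<in> power_edge k e \<longleftrightarrow> v \<in> e" "Inr (f, i) \<in> power_edge k e \<longleftrightarrow> f = e \<and> i < k - 2"
  by (auto simp: power_edge_def)

lemma inj_power_edge: "inj (power_edge k)"
  by (rule injI, rule set_eqI) (metis in_power_edge(1))

lemma hedges_power: "hedges (power_hypergraph k H) = power_edge k ` hedges H"
  by (simp add: power_hypergraph_def power_edge_def)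

lemma verts_power: "verts (power_hypergraph k H) = verts H <+> (hedges H \<times> {..<k - 2})"
  by (simp add: power_hypergraph_def)

lemma power_edges_diff:
  "power_edge k ` E - power_edge k ` F = power_edge k ` (E - F)"
  by (rule image_set_diff[OF inj_power_edge, symmetric])

text \<open>The k - 2 vertices added to a core edge join the core, while those added to a pendent
  edge become outer vertices of it.\<close>

lemma power_pendent:
  assumes H: "pendent_over 2 H C F" and k: "3 \<le> k"
  shows "pendent_over k (power_hypergraph k H) (C <+> F \<times> {..<k - 2}) (power_edge k ` F)"
proof -
  have H1: "finite (verts H)" "verts H \<noteq> {}" "\<And>e. e \<in> hedges H \<Longrightarrow> e \<subseteq> verts H \<and> card e = 2"
    "C \<subseteq> verts H" "F \<subseteq> hedges H" "\<And>e. e \<in> F \<Longrightarrow> e \<subseteq> C"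
    "\<And>g. g \<in> hedges H - F \<Longrightarrow> \<exists>!v. v \<in> C \<inter> g"
    "\<And>x. x \<in> verts H - C \<Longrightarrow> \<exists>!g. g \<in> hedges H \<and> x \<in> g"
    using H by (simp_all add: pendent_over_def uniform_hypergraph_def)
  have "hedges H \<subseteq> Pow (verts H)" using H1(3) by blast
  then have finE: "finite (hedges H)" using H1(1) by (meson finite_Pow_iff finite_subset)
  show ?thesis
    unfolding pendent_over_def hedges_power verts_power power_edges_diff
  proof (intro conjI ballI)
    have "card (power_edge k e) = k" if e: "e \<in> hedges H" for e
    proof -
      have "finite e" using H1(1,3) e by (meson finite_subset)
      then show ?thesis using H1(3)[OF e] k by (simp add: power_edge_def card_Plus card_cartesian_product)
    qed
    moreover have "power_edge k e \<subseteq> verts H <+> (hedges H \<times> {..<k - 2})" if "e \<in> hedges H" for e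
      using H1(3)[OF that] that by (auto simp: power_edge_def)
    moreover have "verts H <+> (hedges H \<times> {..<k - 2}) \<noteq> {}" using H1(2) by auto
    ultimately show "uniform_hypergraph k (power_hypergraph k H)"
      using H1(1) finE by (simp add: uniform_hypergraph_def hedges_power verts_power)
    show "C <+> F \<times> {..<k - 2} \<subseteq> verts H <+> hedges H \<times> {..<k - 2}"
      using H1(4,5) by blast
    show "power_edge k ` F \<subseteq> power_edge k ` hedges H" using H1(5) by blast
    show "e \<subseteq> C <+> F \<times> {..<k - 2}" if "e \<in> power_edge k ` F" for e
      using that H1(6) by (auto simp: power_edge_def)
    show "\<exists>!v. v \<in> (C <+> F \<times> {..<k - 2}) \<inter> g" if g: "g \<in> power_edge k ` (hedges H - F)" for g
    proof -
      obtain h where h: "h \<in> hedges H - F" "g = power_edge k h" using g by blast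
      obtain c where c: "c \<in> C" "c \<in> h" "\<And>v. v \<in> C \<Longrightarrow> v \<in> h \<Longrightarrow> v = c"
        using H1(7)[OF h(1)] by blast
      show ?thesis
      proof (rule ex1I[of _ "Inl c"])
        show "Inl c \<in> (C <+> F \<times> {..<k - 2}) \<inter> g" using c(1,2) h(2) by auto
        fix w assume w: "w \<in> (C <+> F \<times> {..<k - 2}) \<inter> g"
        show "w = Inl c"
        proof (cases w)
          case (Inl v)
          have "v \<in> C" using w Inl by auto
          moreover have "v \<in> h" using w Inl h(2) by simp
          ultimately show ?thesis using c(3) Inl by simp
        next
          case (Inr p)
          obtain f i where p: "p = (f, i)" by (cases p)
          have "f \<in> F" using w Inr p by auto
          moreover have "f = h" using w Inr p h(2) by simp
          ultimately show ?thesis using h(1) by simp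
        qed
      qed
    qed
    show "\<exists>!g. g \<in> power_edge k ` hedges H \<and> x \<in> g"
      if x: "x \<in> (verts H <+> hedges H \<times> {..<k - 2}) - (C <+> F \<times> {..<k - 2})" for x
    proof (cases x)
      case (Inl v)
      then have "v \<in> verts H - C" using x by auto
      then obtain g where g: "g \<in> hedges H" "v \<in> g" "\<And>h. h \<in> hedges H \<Longrightarrow> v \<in> h \<Longrightarrow> h = g"
        using H1(8) by metis
      show ?thesis
      proof (rule ex1I[of _ "power_edge k g"])
        show "power_edge k g \<in> power_edge k ` hedges H \<and> x \<in> power_edge k g" using g(1,2) Inl by simp
        fix f assume f: "f \<in> power_edge k ` hedges H \<and> x \<in> f"
        then obtain h where h: "h \<in> hedges H" "f = power_edge k h" by blast
        moreover have "v \<in> h" using f Inl h(2) by simp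
        ultimately show "f = power_edge k g" using g(3)[of h] by simp
      qed
    next
      case (Inr p)
      then obtain e i where p: "p = (e, i)" "e \<in> hedges H" "i < k - 2" using x by auto
      show ?thesis
      proof (rule ex1I[of _ "power_edge k e"])
        show "power_edge k e \<in> power_edge k ` hedges H \<and> x \<in> power_edge k e" using p Inr by simp
        fix f assume f: "f \<in> power_edge k ` hedges H \<and> x \<in> f"
        then obtain h where h: "h \<in> hedges H" "f = power_edge k h" by blast
        then have "e = h" using f Inr p(1) by simp
        then show "f = power_edge k e" using h by simp
      qed
    qed
  qed
qed

lemma pendents_power:
  "pendents (power_hypergraph k H) (power_edge k ` F) (Inl v) = pendents H F v"
  "e \<in> F \<Longrightarrow> pendents (power_hypergraph k H) (power_edge k ` F) (Inr (e, i)) = 0"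
proof -
  have "{g \<in> power_edge k ` (hedges H - F). Inl v \<in> g} = power_edge k ` {g \<in> hedges H - F. v \<in> g}"
    by auto
  then show "pendents (power_hypergraph k H) (power_edge k ` F) (Inl v) = pendents H F v"
    unfolding pendents_def hedges_power power_edges_diff
    using card_image[OF inj_on_subset[OF inj_power_edge subset_UNIV]] by metis
  assume "e \<in> F"
  then have "{g \<in> power_edge k ` (hedges H - F). Inr (e, i) \<in> g} = {}" by auto
  then show "pendents (power_hypergraph k H) (power_edge k ` F) (Inr (e, i)) = 0"
    unfolding pendents_def hedges_power power_edges_diff by (metis card.empty)
qed

lemma edge_cored_power:
  assumes H: "pendent_over 2 H {x, y} {{x, y}}" and "x \<noteq> y" and k: "3 \<le> k"
  shows "edge_cored k (power_hypergraph k H) (pendents H {{x, y}} x) (pendents H {{x, y}} y) 0"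
proof -
  let ?c = "{x, y}" and ?P = "power_hypergraph k H"
  let ?e = "power_edge k ?c"
  have e: "?c <+> {?c} \<times> {..<k - 2} = ?e" by (simp add: power_edge_def)
  have P: "pendent_over k ?P ?e {?e}" using power_pendent[OF H k] unfolding e by simp
  note pp = pendents_power[where k = k and H = H and F = "{?c}", unfolded image_insert image_empty]
  show ?thesis
    unfolding edge_cored_def
  \<comment> \<open>The third distinguished vertex is one of those added by the power construction,
    available because k \<ge> 3; it carries no pendent edges.\<close>
  proof (rule exI[of _ ?e], rule exI[of _ "Inl x"], rule exI[of _ "Inl y"], rule exI[of _ "Inr (?c, 0)"], intro conjI P ballI)
    show "{Inl x, Inl y, Inr (?c, 0)} \<subseteq> ?e" using k by simp
    fix v assume v: "v \<in> ?e - {Inl x, Inl y, Inr (?c, 0)}"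
    then obtain i where "v = Inr (?c, i)" by (cases v) auto
    then show "pendents ?P {?e} v = 0" using pp(2) by simp
  qed (use \<open>x \<noteq> y\<close> pp in simp_all)
qed

lemma path_cored_power:
  assumes H: "pendent_over 2 H {x, y, z} {{x, y}, {y, z}}" and xyz: "x \<noteq> y" "y \<noteq> z" "x \<noteq> z"
    and k: "3 \<le> k"
  shows "path_cored k (power_hypergraph k H) (pendents H {{x, y}, {y, z}} x)
    (pendents H {{x, y}, {y, z}} y) (pendents H {{x, y}, {y, z}} z)"
proof -
  let ?c = "{x, y}" and ?d = "{y, z}" and ?P = "power_hypergraph k H"
  let ?e = "power_edge k ?c" and ?f = "power_edge k ?d"
  have e: "{x, y, z} <+> {?c, ?d} \<times> {..<k - 2} = ?e \<union> ?f" by (auto simp: power_edge_def)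
  have P: "pendent_over k ?P (?e \<union> ?f) {?e, ?f}" using power_pendent[OF H k] unfolding e by simp
  note pp = pendents_power[where k = k and H = H and F = "{?c, ?d}", unfolded image_insert image_empty]
  have cd: "?c \<noteq> ?d" using xyz by (metis doubleton_eq_iff)
  show ?thesis
    unfolding path_cored_def
  proof (rule exI[of _ ?e], rule exI[of _ ?f], rule exI[of _ "Inl x"], rule exI[of _ "Inl y"], rule exI[of _ "Inl z"], intro conjI P ballI)
    show "?e \<inter> ?f = {Inl y}"
    proof (intro equalityI subsetI)
      fix v assume "v \<in> ?e \<inter> ?f"
      then show "v \<in> {Inl y}" using xyz cd by (cases v) auto
    qed auto
    fix v assume v: "v \<in> ?e \<union> ?f - {Inl x, Inl y, Inl z}"
    then obtain g i where "v = Inr (g, i)" "g \<in> {?c, ?d}" by (cases v) auto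
    then show "pendents ?P {?e, ?f} v = 0" using pp(2) by simp
  qed (use xyz pp in simp_all)
qed

section \<open>The trees S_{a,b}, S_{s1,s2,s3} and the star, and T(t1,t2,t3)\<close>

definition spine :: "nat list \<Rightarrow> (nat \<times> nat) set set" where
  "spine s = {{(i, 0), (Suc i, 0)} | i. Suc i < length s}"

lemma caterpillar_pendent_edges:
  "hedges (caterpillar s) - spine s = {{(i, 0), (i, j)} | i j. i < length s \<and> 1 \<le> j \<and> j \<le> s ! i}"
  (is "_ = ?B")
proof -
  have "hedges (caterpillar s) = spine s \<union> ?B" by (simp add: caterpillar_def spine_def)
  moreover have "g \<notin> spine s" if g: "g \<in> ?B" for g
  proof -
    obtain i j where "(i, j) \<in> g" "1 \<le> j" using g by blast
    moreover have "snd p = 0" if "p \<in> f" "f \<in> spine s" for p f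
      using that unfolding spine_def by fastforce
    ultimately show ?thesis by fastforce
  qed
  ultimately show ?thesis by blast
qed

lemma uniform_caterpillar:
  assumes "s \<noteq> []"
  shows "uniform_hypergraph 2 (caterpillar s)"
proof -
  have "verts (caterpillar s) = Sigma {..<length s} (\<lambda>i. {..s ! i})"
    by (auto simp: caterpillar_def)
  then have "finite (verts (caterpillar s))" "(0, 0) \<in> verts (caterpillar s)" using assms by simp_all
  then show ?thesis
    unfolding uniform_hypergraph_def by (auto simp: caterpillar_def card_insert_if)
qed

lemma caterpillar_pendent:
  assumes s: "s \<noteq> []"
  shows "pendent_over 2 (caterpillar s) ((\<lambda>i. (i, 0)) ` {..<length s}) (spine s)"
  unfolding pendent_over_def caterpillar_pendent_edges
proof (intro conjI ballI uniform_caterpillar[OF s])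
  show "(\<lambda>i. (i, 0)) ` {..<length s} \<subseteq> verts (caterpillar s)" by (auto simp: caterpillar_def)
  show "spine s \<subseteq> hedges (caterpillar s)" by (auto simp: caterpillar_def spine_def)
  show "e \<subseteq> (\<lambda>i. (i, 0)) ` {..<length s}" if "e \<in> spine s" for e
    using that by (auto simp: spine_def)
  show "\<exists>!v. v \<in> (\<lambda>i. (i, 0)) ` {..<length s} \<inter> g"
    if g: "g \<in> {{(i, 0), (i, j)} | i j. i < length s \<and> 1 \<le> j \<and> j \<le> s ! i}" for g
  proof -
    obtain i j where "g = {(i, 0), (i, j)}" "i < length s" "1 \<le> j" using g by blast
    then show ?thesis by (intro ex1I[of _ "(i, 0)"]) auto
  qed
  show "\<exists>!g. g \<in> hedges (caterpillar s) \<and> x \<in> g"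
    if x: "x \<in> verts (caterpillar s) - (\<lambda>i. (i, 0)) ` {..<length s}" for x
  proof -
    obtain i j where ij: "x = (i, j)" "i < length s" "1 \<le> j" "j \<le> s ! i"
    proof (cases x)
      case (Pair i j)
      then have "i < length s" "j \<le> s ! i" using x by (auto simp: caterpillar_def)
      moreover have "j \<noteq> 0" using x Pair \<open>i < length s\<close> by auto
      ultimately show ?thesis using that Pair by simp
    qed
    show ?thesis
    proof (rule ex1I[of _ "{(i, 0), (i, j)}"])
      show "{(i, 0), (i, j)} \<in> hedges (caterpillar s) \<and> x \<in> {(i, 0), (i, j)}"
        using ij by (auto simp: caterpillar_def)
      fix g assume "g \<in> hedges (caterpillar s) \<and> x \<in> g"
      then show "g = {(i, 0), (i, j)}" using ij by (auto simp: caterpillar_def)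
    qed
  qed
qed

lemma inj_pendent_edge: "inj (\<lambda>j. {(i, 0 :: nat), (i, j)})" for i :: nat
proof (rule injI)
  fix a b :: nat assume "{(i, 0), (i, a)} = {(i, 0), (i, b)}"
  then show "a = b" unfolding doubleton_eq_iff by auto
qed

lemma caterpillar_pendents:
  assumes "i < length s"
  shows "pendents (caterpillar s) (spine s) (i, 0) = s ! i"
proof -
  have "{g \<in> hedges (caterpillar s) - spine s. (i, 0) \<in> g} = (\<lambda>j. {(i, 0), (i, j)}) ` {1..s ! i}"
    unfolding caterpillar_pendent_edges using assms by auto blast
  then show ?thesis unfolding pendents_def using card_image[OF inj_on_subset[OF inj_pendent_edge[of i] subset_UNIV], of "{1..s ! i}"] by simp
qed

lemma S2_edge_cored:
  assumes "3 \<le> k"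
  shows "edge_cored k (power_hypergraph k (S2_tree a b)) a b 0"
proof -
  have sp: "spine [a, b] = {{(0, 0), (1, 0)}}" by (auto simp: spine_def)
  have core: "(\<lambda>i. (i, 0)) ` {..<length [a, b]} = {(0, 0), (1, 0)}"
    by (auto simp: less_Suc_eq numeral_2_eq_2)
  have "pendent_over 2 (caterpillar [a, b]) {(0, 0), (1, 0)} {{(0, 0), (1, 0)}}"
    using caterpillar_pendent[of "[a, b]"] unfolding core sp by blast
  from edge_cored_power[OF this _ assms] show ?thesis
    using caterpillar_pendents[of 0 "[a, b]"] caterpillar_pendents[of 1 "[a, b]"]
    by (simp add: S2_tree_def sp)
qed

lemma S3_path_cored:
  assumes "3 \<le> k"
  shows "path_cored k (power_hypergraph k (S3_tree s1 s2 s3)) s1 s2 s3"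
proof -
  have sp: "spine [s1, s2, s3] = {{(0, 0), (1, 0)}, {(1, 0), (2, 0)}}"
    unfolding spine_def by (auto simp: less_Suc_eq numeral_2_eq_2)
  have core: "(\<lambda>i. (i, 0)) ` {..<length [s1, s2, s3]} = {(0, 0), (1, 0), (2, 0)}"
    by (auto simp: less_Suc_eq numeral_3_eq_3 numeral_2_eq_2)
  have "pendent_over 2 (caterpillar [s1, s2, s3]) {(0, 0), (1, 0), (2, 0)} {{(0, 0), (1, 0)}, {(1, 0), (2, 0)}}"
    using caterpillar_pendent[of "[s1, s2, s3]"] unfolding core sp by blast
  from path_cored_power[OF this _ _ _ assms] show ?thesis
    using caterpillar_pendents[of 0 "[s1, s2, s3]"] caterpillar_pendents[of 1 "[s1, s2, s3]"]
      caterpillar_pendents[of 2 "[s1, s2, s3]"]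
    by (simp add: S3_tree_def sp)
qed

text \<open>As a caterpillar the star has a one-vertex spine and no core edge. One of its m edges is
  promoted to the core, which leaves m - 1 pendent edges.\<close>

lemma star_edge_cored:
  assumes k: "3 \<le> k" and m: "1 \<le> m"
  shows "edge_cored k (power_hypergraph k (star_tree (m + 1))) (m - 1) 0 0"
proof -
  let ?H = "caterpillar [m]" and ?x = "(0, 0) :: nat \<times> nat" and ?y = "(0, 1) :: nat \<times> nat"
  let ?f = "\<lambda>j. {(0, 0), (0, j)} :: (nat \<times> nat) set"
  have edges: "hedges ?H = ?f ` {1..m}" by (auto simp: caterpillar_def)
  have verts: "verts ?H = {(0, j) | j. j \<le> m}" by (auto simp: caterpillar_def)
  have "{1..m} - {1} = {2..m}" by auto
  then have pend: "hedges ?H - {{?x, ?y}} = ?f ` {2..m}"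
    unfolding edges using image_set_diff[OF inj_pendent_edge[of 0], of "{1..m}" "{1}"] by simp
  have "pendent_over 2 ?H {?x, ?y} {{?x, ?y}}"
    unfolding pendent_over_def pend
  proof (intro conjI ballI uniform_caterpillar)
    show "\<exists>!v. v \<in> {?x, ?y} \<inter> g" if g: "g \<in> ?f ` {2..m}" for g
    proof -
      obtain j where "g = {?x, (0, j)}" "2 \<le> j" using g by auto
      then show ?thesis by (intro ex1I[of _ ?x]) auto
    qed
    show "\<exists>!g. g \<in> hedges ?H \<and> x \<in> g" if x: "x \<in> verts ?H - {?x, ?y}" for x
    proof -
      obtain j where "x = (0, j)" "j \<noteq> 0" "j \<le> m" using x by (auto simp: verts)
      then show ?thesis unfolding edges by (intro ex1I[of _ "?f j"]) auto
    qed
    show "{{?x, ?y}} \<subseteq> hedges ?H" unfolding edges using m by auto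
  qed (use m in \<open>auto simp: verts\<close>)
  moreover have "pendents ?H {{?x, ?y}} ?x = m - 1"
  proof -
    have "{g \<in> hedges ?H - {{?x, ?y}}. ?x \<in> g} = ?f ` {2..m}"
      unfolding pend by auto
    then show ?thesis unfolding pendents_def
      using card_image[OF inj_on_subset[OF inj_pendent_edge[of 0] subset_UNIV], of "{2..m}"] by simp
  qed
  moreover have "pendents ?H {{?x, ?y}} ?y = 0"
  proof -
    have "{g \<in> hedges ?H - {{?x, ?y}}. ?y \<in> g} = {}" unfolding pend by auto
    then show ?thesis unfolding pendents_def by (metis card.empty)
  qed
  ultimately show ?thesis
    using edge_cored_power[of ?H ?x ?y k] k by (simp add: star_tree_def)
qed

lemma T3_edge_cored:
  assumes k: "3 \<le> k"
  shows "edge_cored k (T3_supertree k t1 t2 t3) t1 t2 t3"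
proof -
  define t where "t = [t1, t2, t3]"
  define core :: "(nat \<times> nat \<times> nat) set" where "core = (\<lambda>i. (i, 0, 0)) ` {..<k}"
  define new :: "nat \<Rightarrow> nat \<Rightarrow> (nat \<times> nat \<times> nat) set" where "new i j = (\<lambda>c. (i, j, c)) ` {1..k - 1}" for i j
  define I where "I = Sigma {..<3} (\<lambda>i. {1..t ! i})"
  define N where "N p = insert (fst p, 0, 0) (new (fst p) (snd p))" for p
  let ?G = "T3_supertree k t1 t2 t3"
  have core: "{(i, 0, 0) | i. i < k} = core" by (auto simp: core_def)
  have new: "{(i, j, c) | c. 1 \<le> c \<and> c \<le> k - 1} = new i j" for i j by (auto simp: new_def)
  have verts: "verts ?G = core \<union> (\<Union>p\<in>I. new (fst p) (snd p))"
    unfolding T3_supertree_def Let_def hypergraph.sel core new t_def[symmetric] I_def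
    by (intro arg_cong2[where f = "(\<union>)"] refl) fastforce
  have edges: "hedges ?G = insert core (N ` I)"
    unfolding T3_supertree_def Let_def hypergraph.sel core new t_def[symmetric] I_def N_def
    by force
  have in_N: "(i, j, c) \<in> N p \<longleftrightarrow> i = fst p \<and> (j = 0 \<and> c = 0 \<or> j = snd p \<and> 1 \<le> c \<and> c \<le> k - 1)" for i j c p
    by (auto simp: N_def new_def)
  have in_core: "(i, j, c) \<in> core \<longleftrightarrow> i < k \<and> j = 0 \<and> c = 0" for i j c by (auto simp: core_def)
  have N_core: "N p \<noteq> core" if "p \<in> I" for p
  proof -
    have "(fst p, snd p, 1) \<in> N p" using k by (simp add: in_N)
    moreover have "(fst p, snd p, 1) \<notin> core" by (simp add: in_core)
    ultimately show ?thesis by auto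
  qed
  have inj: "inj_on N I"
  proof (rule inj_onI)
    fix p q assume pq: "p \<in> I" "q \<in> I" "N p = N q"
    have "(fst p, snd p, 1) \<in> N p" using k by (simp add: in_N)
    then have "(fst p, snd p, 1) \<in> N q" using pq by simp
    then show "p = q" by (simp add: in_N prod_eq_iff)
  qed
  have pend: "hedges ?G - {core} = N ` I" unfolding edges using N_core by auto
  have finI: "finite I" by (simp add: I_def)
  have card_new: "card (N p) = k" if "p \<in> I" for p
  proof -
    have "card (new (fst p) (snd p)) = k - 1" unfolding new_def by (subst card_image) (auto simp: inj_on_def)
    moreover have "(fst p, 0, 0) \<notin> new (fst p) (snd p)" by (auto simp: new_def)
    moreover have "finite (new (fst p) (snd p))" by (simp add: new_def)
    ultimately show ?thesis using k by (simp add: N_def)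
  qed
  have card_core: "card core = k" unfolding core_def by (subst card_image) (auto simp: inj_on_def)
  have I3: "fst p < 3" "1 \<le> snd p" if "p \<in> I" for p using that by (auto simp: I_def)
  have P: "pendent_over k ?G core {core}"
    unfolding pendent_over_def pend
  proof (intro conjI ballI)
    have "N p \<subseteq> verts ?G" if "p \<in> I" for p
      using that I3[OF that] k unfolding verts N_def by (auto simp: in_core)
    moreover have "finite (verts ?G)" unfolding verts using finI by (auto simp: core_def new_def)
    moreover have "(0, 0, 0) \<in> verts ?G" using k by (auto simp: verts in_core)
    ultimately show "uniform_hypergraph k ?G"
      unfolding uniform_hypergraph_def edges using card_core card_new by (auto simp: verts)
    show "\<exists>!v. v \<in> core \<inter> g" if g: "g \<in> N ` I" for g
    proof -
      obtain p where p: "p \<in> I" "g = N p" using g by blast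
      show ?thesis
      proof (rule ex1I[of _ "(fst p, 0, 0)"])
        show "(fst p, 0, 0) \<in> core \<inter> g" using p I3[OF p(1)] k by (simp add: in_core in_N)
        fix v assume "v \<in> core \<inter> g"
        then show "v = (fst p, 0, 0)" using p I3[OF p(1)] by (cases v) (auto simp: in_core in_N)
      qed
    qed
    show "\<exists>!g. g \<in> hedges ?G \<and> x \<in> g" if x: "x \<in> verts ?G - core" for x
    proof -
      obtain p where p: "p \<in> I" "x \<in> new (fst p) (snd p)" using x by (auto simp: verts)
      then obtain c where c: "x = (fst p, snd p, c)" "1 \<le> c" "c \<le> k - 1" by (auto simp: new_def)
      show ?thesis
      proof (rule ex1I[of _ "N p"])
        show "N p \<in> hedges ?G \<and> x \<in> N p" using p c by (simp add: edges in_N)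
        fix g assume g: "g \<in> hedges ?G \<and> x \<in> g"
        then obtain q where q: "q \<in> I" "g = N q" using x by (auto simp: edges)
        then show "g = N p" using g c I3[OF p(1)] by (auto simp: in_N prod_eq_iff)
      qed
    qed
  qed (auto simp: verts edges)
  have pends: "pendents ?G {core} (i, 0, 0) = (if i < 3 then t ! i else 0)" for i
  proof -
    have "{g \<in> hedges ?G - {core}. (i, 0, 0) \<in> g} = N ` {p \<in> I. fst p = i}"
      unfolding pend by (auto simp: in_N)
    moreover have "card (N ` {p \<in> I. fst p = i}) = card {p \<in> I. fst p = i}"
      using inj by (intro card_image) (auto simp: inj_on_def)
    moreover have "{p \<in> I. fst p = i} = (if i < 3 then {i} \<times> {1..t ! i} else {})"
      by (auto simp: I_def)
    ultimately show ?thesis by (simp add: pendents_def)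
  qed
  have p0: "pendents ?G {core} (0, 0, 0) = t1" using pends[of 0] by (simp add: t_def)
  have p1: "pendents ?G {core} (1, 0, 0) = t2" using pends[of 1] by (simp add: t_def)
  have p2: "pendents ?G {core} (2, 0, 0) = t3" using pends[of 2] by (simp add: t_def)
  show ?thesis
    unfolding edge_cored_def
  proof (rule exI[of _ core], rule exI[of _ "(0, 0, 0)"], rule exI[of _ "(1, 0, 0)"], rule exI[of _ "(2, 0, 0)"], intro conjI P ballI p0 p1 p2)
    show "{(0, 0, 0), (1, 0, 0), (2, 0, 0)} \<subseteq> core" using k by (auto simp: in_core)
    fix v assume v: "v \<in> core - {(0, 0, 0), (1, 0, 0), (2, 0, 0)}"
    then obtain i where i: "v = (i, 0, 0)" "i \<noteq> 0" "i \<noteq> 1" "i \<noteq> 2" by (auto simp: core_def)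
    then show "pendents ?G {core} v = 0" using pends[of i] by simp
  qed simp_all
qed

section \<open>Recognising the shapes from vertex degrees\<close>

context supertree
begin

text \<open>By \<open>one\<close>, no edge outside \<open>F\<close> is counted at two core vertices.
  So if the counts add up to the number of all such edges, each of them must meet the core.\<close>

lemma pendent_overI:
  assumes F: "F \<subseteq> hedges G"
    and one: "\<And>g v w. g \<in> hedges G - F \<Longrightarrow> v \<in> \<Union>F \<Longrightarrow> w \<in> \<Union>F \<Longrightarrow> v \<in> g \<Longrightarrow> w \<in> g \<Longrightarrow> v = w"
    and count: "(\<Sum>v\<in>\<Union>F. pendents G F v) = card (hedges G) - card F"
    and deg: "\<And>x. x \<in> verts G - \<Union>F \<Longrightarrow> vdegree G x = 1"
  shows "pendent_over k G (\<Union>F) F"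
proof -
  have fin: "finite (\<Union>F)" using F finite_edges finite_edge by (auto intro: finite_subset)
  let ?U = "\<Union>v\<in>\<Union>F. {g \<in> hedges G - F. v \<in> g}"
  have "card ?U = (\<Sum>v\<in>\<Union>F. card {g \<in> hedges G - F. v \<in> g})"
    using fin finite_edges one by (intro card_UN_disjoint) fastforce+
  also have "\<dots> = card (hedges G - F)"
    using count F finite_edges by (simp add: pendents_def card_Diff_subset finite_subset)
  finally have "?U = hedges G - F"
    using finite_edges by (intro card_subset_eq) auto
  then have "\<exists>v. v \<in> \<Union>F \<inter> g" if "g \<in> hedges G - F" for g using that by blast
  then have "\<exists>!v. v \<in> \<Union>F \<inter> g" if "g \<in> hedges G - F" for g using that one by (metis IntE)
  moreover have "\<exists>!g. g \<in> hedges G \<and> x \<in> g" if x: "x \<in> verts G - \<Union>F" for x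
  proof -
    obtain g where g: "incident x = {g}"
      using deg[OF x] unfolding vdegree_def by (auto simp: card_1_singleton_iff)
    have "h \<in> hedges G \<and> x \<in> h \<longleftrightarrow> h = g" for h
      using arg_cong[OF g, of "\<lambda>S. h \<in> S"] by simp
    then show ?thesis by simp
  qed
  moreover have "\<Union>F \<subseteq> verts G" using F edge_subset by blast
  ultimately show ?thesis
    using F uniform unfolding pendent_over_def by (simp add: Union_upper)
qed

text \<open>Vertices of \<open>U\<close> that use up the whole excess of \<open>sum_vdegree\<close>
  leave degree one for all the others.\<close>

lemma vdegree_outside:
  assumes U: "U \<subseteq> verts G" and sum: "(\<Sum>u\<in>U. vdegree G u - 1) = card (hedges G) - 1"
    and x: "x \<in> verts G - U"
  shows "vdegree G x = 1"
proof -
  have "(\<Sum>u\<in>verts G. vdegree G u - 1) = (\<Sum>u\<in>verts G - U. vdegree G u - 1) + (\<Sum>u\<in>U. vdegree G u - 1)"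
    using sum.subset_diff[OF U finite_verts] by simp
  then have "(\<Sum>u\<in>verts G - U. vdegree G u - 1) = 0" using sum_vdegree sum by simp
  then have "vdegree G x - 1 = 0" using x finite_verts by simp
  then show ?thesis using vdegree_pos[of x] x by simp
qed

lemma edge_coredI:
  assumes e: "e \<in> hedges G" and u: "{u1, u2, u3} \<subseteq> e" "u1 \<noteq> u2" "u1 \<noteq> u3" "u2 \<noteq> u3"
    and sum: "(vdegree G u1 - 1) + (vdegree G u2 - 1) + (vdegree G u3 - 1) = card (hedges G) - 1"
  shows "edge_cored k G (vdegree G u1 - 1) (vdegree G u2 - 1) (vdegree G u3 - 1)"
proof -
  have pe: "pendents G {e} v = vdegree G v - 1" if "v \<in> e" for v
  proof -
    have "{g \<in> hedges G - {e}. v \<in> g} = incident v - {e}" by auto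
    then show ?thesis unfolding pendents_def vdegree_def using e that finite_edges by simp
  qed
  have U: "{u1, u2, u3} \<subseteq> verts G" using u e edge_subset by blast
  have "(\<Sum>v\<in>{u1, u2, u3}. vdegree G v - 1) = card (hedges G) - 1" using u sum by (simp add: add.assoc)
  note out = vdegree_outside[OF U this]
  have zero: "pendents G {e} v = 0" if "v \<in> e - {u1, u2, u3}" for v
  proof -
    have "v \<in> verts G - {u1, u2, u3}" using that e edge_subset by blast
    then show ?thesis using out pe that by simp
  qed
  have "(\<Sum>v\<in>e. pendents G {e} v) = (\<Sum>v\<in>{u1, u2, u3}. pendents G {e} v)"
    using u zero finite_edge[OF e] by (intro sum.mono_neutral_right) auto
  also have "\<dots> = card (hedges G) - 1" using u sum pe by (simp add: add.assoc)
  finally have count: "(\<Sum>v\<in>e. pendents G {e} v) = card (hedges G) - 1" .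
  have "pendent_over k G (\<Union>{e}) {e}"
  proof (rule pendent_overI)
    fix g v w assume "g \<in> hedges G - {e}" "v \<in> \<Union>{e}" "w \<in> \<Union>{e}" "v \<in> g" "w \<in> g"
    then show "v = w" using linear[of g e v w] e by simp
  next
    fix x assume "x \<in> verts G - \<Union>{e}"
    then show "vdegree G x = 1" using out[of x] u by blast
  qed (use e count in auto)
  moreover have "pendents G {e} u1 = vdegree G u1 - 1" "pendents G {e} u2 = vdegree G u2 - 1"
    "pendents G {e} u3 = vdegree G u3 - 1"
    using pe u(1) by auto
  ultimately show ?thesis
    unfolding edge_cored_def using u zero by (metis cSup_singleton)
qed

lemma path_coredI:
  assumes e: "e1 \<in> hedges G" "e2 \<in> hedges G" "e1 \<noteq> e2"
    and u: "u2 \<in> e1" "u2 \<in> e2" "u1 \<in> e1 - {u2}" "u3 \<in> e2 - {u2}"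
    and sum: "(vdegree G u1 - 1) + (vdegree G u2 - 1) + (vdegree G u3 - 1) = card (hedges G) - 1"
  shows "path_cored k G (vdegree G u1 - 1) (vdegree G u2 - 2) (vdegree G u3 - 1)"
proof -
  have I: "e1 \<inter> e2 = {u2}" using linear[OF e(1,2)] e(3) u by blast
  have u': "u1 \<notin> e2" "u3 \<notin> e1" "u1 \<noteq> u3" "u1 \<noteq> u2" "u3 \<noteq> u2" using I u by blast+
  have p1: "pendents G {e1, e2} v = vdegree G v - 1" if "v \<in> e1 \<union> e2 - {u2}" for v
  proof -
    have "{g \<in> hedges G - {e1, e2}. v \<in> g} = incident v - {if v \<in> e1 then e1 else e2}"
      using that I by auto
    moreover have "(if v \<in> e1 then e1 else e2) \<in> incident v" using e that by auto
    ultimately show ?thesis unfolding pendents_def vdegree_def by (simp only: card_Diff_singleton)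
  qed
  have p2: "pendents G {e1, e2} u2 = vdegree G u2 - 2"
  proof -
    have "{g \<in> hedges G - {e1, e2}. u2 \<in> g} = incident u2 - {e1, e2}" by auto
    moreover have "{e1, e2} \<subseteq> incident u2" "card {e1, e2} = 2" using e u by auto
    ultimately show ?thesis unfolding pendents_def vdegree_def
      using finite_edges by (metis card_Diff_subset finite.emptyI finite.insertI)
  qed
  have d2: "2 \<le> vdegree G u2"
  proof -
    have "card {e1, e2} \<le> vdegree G u2"
      unfolding vdegree_def using e u finite_edges by (intro card_mono) auto
    then show ?thesis using e by simp
  qed
  have U: "{u1, u2, u3} \<subseteq> verts G" using u e edge_subset by blast
  have "(\<Sum>v\<in>{u1, u2, u3}. vdegree G v - 1) = card (hedges G) - 1" using u' sum by (simp add: add.assoc)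
  note out = vdegree_outside[OF U this]
  have zero: "pendents G {e1, e2} v = 0" if "v \<in> e1 \<union> e2 - {u1, u2, u3}" for v
  proof -
    have "v \<in> verts G - {u1, u2, u3}" using that e edge_subset by blast
    then show ?thesis using out p1 that by simp
  qed
  have "(\<Sum>v\<in>e1 \<union> e2. pendents G {e1, e2} v) = (\<Sum>v\<in>{u1, u2, u3}. pendents G {e1, e2} v)"
    using u zero finite_edge e by (intro sum.mono_neutral_right) auto
  also have "\<dots> = (vdegree G u1 - 1) + (vdegree G u2 - 2) + (vdegree G u3 - 1)"
    using u u' p1 p2 by (simp add: add.assoc)
  \<comment> \<open>Both core edges pass through u2, so the count there is one less than its excess,
    and the total drops from m - 1 to m - 2.\<close>
  also have "\<dots> = card (hedges G) - card {e1, e2}"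
    using sum d2 e(3) by simp
  finally have count: "(\<Sum>v\<in>e1 \<union> e2. pendents G {e1, e2} v) = card (hedges G) - card {e1, e2}" .
  \<comment> \<open>An edge meeting e1 and e2 in different vertices would close a triangle: deleting
    v leaves it linked through e2 to e1, although it meets e1 in v.\<close>
  have one: "v = w" if g: "g \<in> hedges G - {e1, e2}" and "v \<in> e1" "w \<in> e2" "v \<in> g" "w \<in> g" for g v w
  proof (rule ccontr)
    assume "v \<noteq> w"
    show False
    proof (cases "v = u2")
      case True
      then show ?thesis using linear[of g e2 v w] g that e u \<open>v \<noteq> w\<close> by blast
    next
      case False
      have "(g, e2) \<in> link v" using g that e \<open>v \<noteq> w\<close> by (auto simp: link_def)
      moreover have "(e2, e1) \<in> link v" using e u False by (auto simp: link_def)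
      ultimately have "(g, e1) \<in> (link v)\<^sup>*" by (meson r_into_rtrancl rtrancl_trans)
      then show ?thesis using branch_unique[of g v e1] g that e by blast
    qed
  qed
  have "pendent_over k G (\<Union>{e1, e2}) {e1, e2}"
  proof (rule pendent_overI)
    fix g v w assume g: "g \<in> hedges G - {e1, e2}" "v \<in> \<Union>{e1, e2}" "w \<in> \<Union>{e1, e2}" "v \<in> g" "w \<in> g"
    then consider "v \<in> e1" "w \<in> e1" | "v \<in> e2" "w \<in> e2" | "v \<in> e1" "w \<in> e2" | "v \<in> e2" "w \<in> e1"
      by blast
    then show "v = w"
      using one[OF g(1), of v w] one[OF g(1), of w v] linear[of g e1 v w] linear[of g e2 v w] g e
      by cases blast+
  next
    fix x assume "x \<in> verts G - \<Union>{e1, e2}"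
    then show "vdegree G x = 1" using out[of x] u by blast
  qed (use e count in auto)
  moreover have "\<Union>{e1, e2} = e1 \<union> e2" by simp
  moreover have "pendents G {e1, e2} u1 = vdegree G u1 - 1" "pendents G {e1, e2} u3 = vdegree G u3 - 1"
    using p1 u by auto
  ultimately show ?thesis
    unfolding path_cored_def using u I p2 zero by metis
qed

end

section \<open>The labelling of an arbitrary supertree\<close>

text \<open>With every entry at most A and total at most 2A, the product is smallest when the mass
  is concentrated in two entries equal to A.\<close>

lemma prod_one_minus_ge_square:
  fixes x :: "'v \<Rightarrow> real"
  assumes "finite S" and x: "\<And>v. v \<in> S \<Longrightarrow> 0 \<le> x v \<and> x v \<le> A" and A: "A \<le> 1"
    and sum: "(\<Sum>v\<in>S. x v) \<le> 2 * A"
  shows "(1 - A)\<^sup>2 \<le> (\<Prod>v\<in>S. 1 - x v)"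
proof -
  \<comment> \<open>The value of the product when mass s is poured in greedily: a first entry up to
    A, then a second one. \<open>step\<close> says that adding an entry anywhere else does no more
    harm.\<close>
  define \<psi> where "\<psi> s = (if s \<le> A then 1 - s else (1 - A) * (1 - (s - A)))" for s
  have step: "\<psi> (s + a) \<le> \<psi> s * (1 - a)" if "0 \<le> a" "a \<le> A" "0 \<le> s" for s a
  proof -
    consider "s + a \<le> A" | "s \<le> A" "A < s + a" | "A < s" by linarith
    then show ?thesis
    proof cases
      case 1
      then have "\<psi> (s + a) = 1 - s - a" "\<psi> s * (1 - a) = 1 - s - a + s * a"
        using that by (simp_all add: \<psi>_def algebra_simps)
      then show ?thesis using that by simp
    next
      case 2
      have "\<psi> s * (1 - a) - \<psi> (s + a) = (A - s) * (A - a)"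
        using 2 by (simp add: \<psi>_def algebra_simps)
      moreover have "0 \<le> (A - s) * (A - a)" using 2 that by simp
      ultimately show ?thesis by linarith
    next
      case 3
      then have "\<psi> s * (1 - a) - \<psi> (s + a) = (1 - A) * ((s - A) * a)"
        using that by (simp add: \<psi>_def algebra_simps)
      moreover have "0 \<le> (1 - A) * ((s - A) * a)" using 3 that A by simp
      ultimately show ?thesis by linarith
    qed
  qed
  have "\<psi> (\<Sum>v\<in>S. x v) \<le> (\<Prod>v\<in>S. 1 - x v) \<and> 0 \<le> (\<Sum>v\<in>S. x v)" if "0 \<le> A"
    using assms(1) x
  proof (induction S rule: finite_induct)
    case empty
    then show ?case using that by (simp add: \<psi>_def)
  next
    case (insert v S)
    then have IH: "\<psi> (\<Sum>v\<in>S. x v) \<le> (\<Prod>v\<in>S. 1 - x v)" "0 \<le> (\<Sum>v\<in>S. x v)" and v: "0 \<le> x v" "x v \<le> A"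
      by auto
    have "\<psi> (x v + (\<Sum>v\<in>S. x v)) \<le> \<psi> (\<Sum>v\<in>S. x v) * (1 - x v)"
      using step[OF v IH(2)] by (simp add: add.commute)
    also have "\<dots> \<le> (\<Prod>v\<in>S. 1 - x v) * (1 - x v)"
      using IH(1) v A by (intro mult_right_mono) auto
    finally show ?case using insert IH v by (simp add: mult.commute)
  qed
  moreover have "(1 - A)\<^sup>2 \<le> \<psi> (\<Sum>v\<in>S. x v)" if "0 \<le> A"
  proof (cases "(\<Sum>v\<in>S. x v) \<le> A")
    case True
    have "(1 - A)\<^sup>2 \<le> 1 - A" using that A by (simp add: power2_eq_square mult_left_le)
    then show ?thesis using True by (simp add: \<psi>_def)
  next
    case False
    have "(1 - A) * (1 - A) \<le> (1 - A) * (1 - ((\<Sum>v\<in>S. x v) - A))"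
      using sum A by (intro mult_left_mono) auto
    then show ?thesis using False by (simp add: \<psi>_def power2_eq_square)
  qed
  \<comment> \<open>Vacuous, as a sum of nonnegative numbers cannot be at most 2A < 0.\<close>
  moreover have "(1 - A)\<^sup>2 \<le> (\<Prod>v\<in>S. 1 - x v)" if "A < 0"
  proof -
    have "(\<Sum>v\<in>S. x v) < 0" using that sum by linarith
    moreover have "0 \<le> (\<Sum>v\<in>S. x v)" using x by (simp add: sum_nonneg)
    ultimately show ?thesis by simp
  qed
  ultimately show ?thesis by (meson le_less_linear order_trans)
qed

text \<open>The assumption \<open>eq\<close> is the equation of T(1,2,m-4) at its spectral radius.
  \<open>max_degree\<close> rules out the six supertrees that have a vertex of degree at least m -
  2, \<open>not_4\<close> rules out the power of S_{3,m-4}, and \<open>not_3_2\<close> rules out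
  T(1,2,m-4) itself.\<close>

locale comparison = supertree k G for k and G :: "'a hypergraph" +
  fixes \<delta> \<epsilon> :: real
  assumes many: "13 \<le> card (hedges G)"
    and \<epsilon>: "0 < \<epsilon>" "\<epsilon> \<le> \<delta>"
    and small: "(real (card (hedges G)) - 4) * \<delta> < 1"
    and eq: "(1 - \<delta>) * (1 - 2 * \<delta>) * (1 - (real (card (hedges G)) - 4) * \<delta>) = \<epsilon>"
    and max_degree: "v \<in> verts G \<Longrightarrow> vdegree G v \<le> card (hedges G) - 3"
    and not_4: "\<lbrakk>e \<in> hedges G; {r, w} \<subseteq> e; r \<noteq> w; vdegree G r = card (hedges G) - 3\<rbrakk>
      \<Longrightarrow> vdegree G w \<noteq> 4"
    and not_3_2: "\<lbrakk>e \<in> hedges G; {r, w, w'} \<subseteq> e; r \<noteq> w; r \<noteq> w'; w \<noteq> w';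
        vdegree G r = card (hedges G) - 3; vdegree G w = 3\<rbrakk> \<Longrightarrow> vdegree G w' \<noteq> 2"
begin

abbreviation m :: nat where "m \<equiv> card (hedges G)"

text \<open>The factor 9 is 13 - 4. The fifth fact is \<open>eq\<close> divided by (1 - \<delta>)(1
  - 2\<delta>): in T(1,2,m-4) the m - 4 pendent edges and the core edge fill the large vertex
  exactly. It is the budget against which degree m - 3 is measured.\<close>

lemma numbers:
  "0 < \<delta>" "\<delta> < 1 / 9" "\<epsilon> < 1 / 10" "(real m - 4) * \<delta> + \<epsilon> < 1"
  "(real m - 4) * \<delta> + \<epsilon> / ((1 - \<delta>) * (1 - 2 * \<delta>)) = 1" "0 < (1 - \<delta>) * (1 - 2 * \<delta>)"
proof -
  show \<delta>0: "0 < \<delta>" using \<epsilon> by linarith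
  have "9 * \<delta> \<le> (real m - 4) * \<delta>" using many \<delta>0 by (intro mult_right_mono) auto
  then show \<delta>9: "\<delta> < 1 / 9" using small by linarith
  define c where "c = (1 - \<delta>) * (1 - 2 * \<delta>)"
  have c: "0 < c" "c < 1"
  proof -
    show "0 < c" unfolding c_def using \<delta>9 by (intro mult_pos_pos) auto
    have "(1 - \<delta>) * (1 - 2 * \<delta>) < 1 * 1" using \<delta>0 \<delta>9 by (intro mult_strict_mono) auto
    then show "c < 1" by (simp add: c_def)
  qed
  have "c * (1 - (real m - 4) * \<delta>) = \<epsilon>" using eq by (simp add: c_def)
  then have e: "1 - (real m - 4) * \<delta> = \<epsilon> / c" using c by (simp add: field_simps)
  then show "(real m - 4) * \<delta> + \<epsilon> / ((1 - \<delta>) * (1 - 2 * \<delta>)) = 1" by (simp add: c_def)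
  have "\<epsilon> < \<epsilon> / c" using c \<epsilon> by (simp add: field_simps)
  then show lt: "(real m - 4) * \<delta> + \<epsilon> < 1" using e by linarith
  then show "\<epsilon> < 1 / 10" using \<open>9 * \<delta> \<le> (real m - 4) * \<delta>\<close> \<epsilon> by linarith
  show "0 < (1 - \<delta>) * (1 - 2 * \<delta>)" using c by (simp add: c_def)
qed

text \<open>Turns a bound on a number of edges in units of m - 4 into a numerical one, as (m - 4)
  \<delta> < 1 - \<epsilon>.\<close>

lemma scaled: "x \<le> c * (real m - 4) \<Longrightarrow> 0 \<le> c \<Longrightarrow> x * \<delta> \<le> c * (1 - \<epsilon>)"
proof -
  assume x: "x \<le> c * (real m - 4)" and c: "0 \<le> c"
  have "x * \<delta> \<le> c * (real m - 4) * \<delta>" using x numbers(1) by (intro mult_right_mono) auto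
  also have "\<dots> = c * ((real m - 4) * \<delta>)" by simp
  also have "\<dots> \<le> c * (1 - \<epsilon>)" using numbers(4) c by (intro mult_left_mono) auto
  finally show ?thesis .
qed

text \<open>The weight that suffices at the top vertex of a branch with \<open>n\<close> edges.\<close>

definition top_weight :: "nat \<Rightarrow> real" where
  "top_weight n = (\<delta> - \<epsilon>) + \<epsilon> / (1 - (real n - 1) * \<delta>)"

lemma denominator:
  assumes "2 * n \<le> m"
  shows "\<epsilon> \<le> 1 - (real n - 1) * \<delta>" "4 * \<epsilon> \<le> 1 - (real m / 2 - 1) * \<delta>"
    "1 - (real m / 2 - 1) * \<delta> \<le> 1 - (real n - 1) * \<delta>"
proof -
  \<comment> \<open>The inequality m / 2 - 1 \<le> 11 / 18 (m - 4) is an equality at m = 13. The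
    rest, 7 / 18 + 11 / 18 \<epsilon> \<ge> 4 \<epsilon>, follows from \<epsilon> < 1 / 10.\<close>
  have "(real m / 2 - 1) * \<delta> \<le> 11 / 18 * (1 - \<epsilon>)" using many by (intro scaled) auto
  then show 4: "4 * \<epsilon> \<le> 1 - (real m / 2 - 1) * \<delta>" using numbers(3) by (simp add: algebra_simps)
  show D: "1 - (real m / 2 - 1) * \<delta> \<le> 1 - (real n - 1) * \<delta>"
    using assms numbers(1) by (simp add: mult_right_mono)
  show "\<epsilon> \<le> 1 - (real n - 1) * \<delta>" using 4 D \<epsilon> by linarith
qed

text \<open>Separates the price \<delta> of a pendent edge from the surcharge for the n - 1 further
  edges of the branch.\<close>

lemma top_alt:
  assumes "2 * n \<le> m"
  shows "top_weight n = \<delta> + \<epsilon> * \<delta> * (real n - 1) / (1 - (real n - 1) * \<delta>)"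
proof -
  define d where "d = 1 - (real n - 1) * \<delta>"
  have "0 < d" using denominator(1)[OF assms] \<epsilon> by (simp add: d_def)
  moreover have "(real n - 1) * \<delta> = 1 - d" by (simp add: d_def)
  moreover from \<open>0 < d\<close> have "\<epsilon> / d - \<epsilon> = \<epsilon> * (1 - d) / d" by (simp add: field_simps)
  ultimately have "\<epsilon> / d - \<epsilon> = \<epsilon> * \<delta> * (real n - 1) / d" by (metis mult.assoc mult.commute)
  then show ?thesis unfolding top_weight_def d_def[symmetric] by simp
qed

text \<open>A denominator common to all branches makes the bound affine in n, so it can be summed
  over a vertex with only the total branch size known.\<close>

lemma top_le_denominator:
  assumes "2 * n \<le> m" "1 \<le> n" "0 < d" "d \<le> 1 - (real n - 1) * \<delta>"
  shows "top_weight n \<le> \<delta> + \<epsilon> * \<delta> / d * (real n - 1)"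
proof -
  have "\<epsilon> * \<delta> * (real n - 1) / (1 - (real n - 1) * \<delta>) \<le> \<epsilon> * \<delta> * (real n - 1) / d"
    using assms \<epsilon> numbers(1) by (intro divide_left_mono mult_nonneg_nonneg mult_pos_pos) auto
  then show ?thesis unfolding top_alt[OF assms(1)] by simp
qed

text \<open>A branch with at most half of the edges never costs more than the same number of pendent
  edges at its top vertex; this is the condition \<epsilon> \<le> 1 - (n - 1) \<delta>.\<close>

lemma top_bounds:
  assumes "2 * n \<le> m" "1 \<le> n"
  shows "0 \<le> top_weight n" "top_weight n \<le> real n * \<delta>"
proof -
  have d: "0 < 1 - (real n - 1) * \<delta>" using denominator(1)[OF assms(1)] \<epsilon> by linarith
  then show "0 \<le> top_weight n" unfolding top_weight_def using \<epsilon> by simp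
  have "\<epsilon> * (real n - 1) * \<delta> / (1 - (real n - 1) * \<delta>) \<le> (real n - 1) * \<delta>"
  proof -
    have "\<epsilon> * ((real n - 1) * \<delta>) \<le> (1 - (real n - 1) * \<delta>) * ((real n - 1) * \<delta>)"
      using denominator(1)[OF assms(1)] assms numbers(1) by (intro mult_right_mono) auto
    then show ?thesis using d by (simp add: field_simps)
  qed
  then show "top_weight n \<le> real n * \<delta>" unfolding top_alt[OF assms(1)] by (simp add: algebra_simps)
qed

section \<open>Heavy and light incidences\<close>

definition heavy :: "'a \<Rightarrow> 'a set \<Rightarrow> bool" where
  "heavy v e \<longleftrightarrow> m < 2 * bsize v e"

definition others :: "'a \<Rightarrow> 'a set \<Rightarrow> 'a set set" where
  "others v e = incident v - {e}"

definition load :: "'a \<Rightarrow> 'a set \<Rightarrow> real" where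
  "load v e = (\<Sum>f\<in>others v e. top_weight (bsize v f))"

text \<open>The number of edges that \<open>v\<close> separates from \<open>e\<close>, that is, the
  total size of the other branches at \<open>v\<close>.\<close>

definition beyond :: "'a \<Rightarrow> 'a set \<Rightarrow> nat" where
  "beyond v e = m - bsize v e"

lemma finite_others: "finite (others v e)"
  using finite_edges by (simp add: others_def)

lemma sum_others:
  assumes "e \<in> hedges G" "v \<in> e"
  shows "(\<Sum>f\<in>others v e. bsize v f) = beyond v e"
    and "(\<Sum>f\<in>incident v. g f) = (g e + (\<Sum>f\<in>others v e. g f) :: real)"
proof -
  have fin: "finite (incident v)" and e: "e \<in> incident v"
    using assms finite_edges by auto
  have "(\<Sum>f\<in>incident v. bsize v f) = m" using assms edge_subset by (intro sum_bsize) blast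
  then show "(\<Sum>f\<in>others v e. bsize v f) = beyond v e"
    unfolding others_def beyond_def using sum.remove[OF fin e, of "bsize v"] by simp
  show "(\<Sum>f\<in>incident v. g f) = (g e + (\<Sum>f\<in>others v e. g f) :: real)"
    unfolding others_def using sum.remove[OF fin e] by simp
qed

lemma others_le:
  assumes "e \<in> hedges G" "v \<in> e" "f \<in> others v e"
  shows "1 \<le> bsize v f" "bsize v f \<le> beyond v e"
proof -
  show "1 \<le> bsize v f" using assms(3) bsize_pos by (simp add: others_def Suc_le_eq)
  show "bsize v f \<le> beyond v e"
    using sum_others(1)[OF assms(1,2)] member_le_sum[of f "others v e" "bsize v"] assms(3) finite_others
    by simp
qed

lemma heavy_beyond: "heavy v e \<Longrightarrow> 2 * beyond v e < m"
  using many unfolding heavy_def beyond_def by linarith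

text \<open>Branch sizes at a vertex add up to m, so at most one branch contains more than half of
  the edges.\<close>

lemma others_light:
  assumes "e \<in> hedges G" "v \<in> e" "heavy v e" "f \<in> others v e"
  shows "\<not> heavy v f"
  using others_le(2)[OF assms(1,2,4)] heavy_beyond[OF assms(3)] by (simp add: heavy_def)

lemma load_bounds:
  assumes e: "e \<in> hedges G" "v \<in> e" and h: "heavy v e"
  shows "0 \<le> load v e" "load v e \<le> real (beyond v e) * \<delta>" "real (beyond v e) * \<delta> < 2 / 3"
proof -
  have half: "2 * bsize v f \<le> m" and pos: "1 \<le> bsize v f" if "f \<in> others v e" for f
    using others_light[OF e h that] others_le[OF e that] by (simp_all add: heavy_def)
  show "0 \<le> load v e" unfolding load_def using top_bounds(1) half pos by (simp add: sum_nonneg)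
  have "load v e \<le> (\<Sum>f\<in>others v e. real (bsize v f) * \<delta>)"
    unfolding load_def using top_bounds(2) half pos by (simp add: sum_mono)
  also have "\<dots> = real (\<Sum>f\<in>others v e. bsize v f) * \<delta>" by (simp add: sum_distrib_right)
  finally show "load v e \<le> real (beyond v e) * \<delta>" using sum_others(1)[OF e] by simp
  \<comment> \<open>By integrality \<open>beyond v e\<close> is at most (m - 1) / 2, and (m - 1) / 2
    \<le> 2 / 3 (m - 4) is an equality at m = 13.\<close>
  have "real (beyond v e) * \<delta> \<le> 2 / 3 * (1 - \<epsilon>)"
    using heavy_beyond[OF h] many by (intro scaled) auto
  also have "\<dots> < 2 / 3" using \<epsilon>(1) by simp
  finally show "real (beyond v e) * \<delta> < 2 / 3" .
qed

lemma sum_beyond_edge: "e \<in> hedges G \<Longrightarrow> (\<Sum>w\<in>e. beyond w e) = m - 1"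
  unfolding beyond_def by (rule sum_beyond)

lemma sum_beyond_light:
  assumes "e \<in> hedges G" "v \<in> e"
  shows "(\<Sum>w\<in>e - {v}. beyond w e) = bsize v e - 1"
proof -
  have "beyond v e + (\<Sum>w\<in>e - {v}. beyond w e) = m - 1"
    using sum_beyond_edge[OF assms(1)] sum.remove[OF finite_edge[OF assms(1)] assms(2), of "\<lambda>w. beyond w e"]
    by simp
  moreover have "bsize v e \<le> m" "0 < bsize v e" using bsize_le bsize_pos assms by auto
  ultimately show ?thesis by (simp add: beyond_def)
qed

text \<open>The counterpart of \<open>others_light\<close> on edges: what lies beyond another vertex
  of \<open>e\<close> is part of the light branch at \<open>v\<close> and misses at least
  \<open>e\<close> itself, so it is less than half.\<close>

lemma light_unique:
  assumes e: "e \<in> hedges G" "v \<in> e" and l: "\<not> heavy v e" and w: "w \<in> e - {v}"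
  shows "heavy w e"
proof -
  have "beyond w e \<le> (\<Sum>w\<in>e - {v}. beyond w e)"
    using w finite_edge[OF e(1)] by (intro member_le_sum) auto
  then have "beyond w e \<le> bsize v e - 1" using sum_beyond_light[OF e] by simp
  moreover have "bsize w e \<le> m" "0 < bsize v e" using bsize_le bsize_pos e by auto
  ultimately show ?thesis using l by (simp add: heavy_def beyond_def)
qed

text \<open>This is where the double star is extremal: by Weierstrass, spreading the remaining edges
  of the branch over several vertices only enlarges the product.\<close>

lemma prod_load:
  assumes e: "e \<in> hedges G" "v \<in> e" and l: "\<not> heavy v e"
  shows "1 - (real (bsize v e) - 1) * \<delta> \<le> (\<Prod>w\<in>e - {v}. 1 - load w e)"
    "0 < (\<Prod>w\<in>e - {v}. 1 - load w e)"
proof -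
  have w: "0 \<le> load w e" "load w e \<le> real (beyond w e) * \<delta>" "load w e < 1" if "w \<in> e - {v}" for w
    using load_bounds[OF e(1) _ light_unique[OF e l that]] that by auto
  have "(\<Sum>w\<in>e - {v}. load w e) \<le> (\<Sum>w\<in>e - {v}. real (beyond w e) * \<delta>)"
    using w(2) by (rule sum_mono)
  also have "\<dots> = real (\<Sum>w\<in>e - {v}. beyond w e) * \<delta>" by (simp add: sum_distrib_right)
  also have "\<dots> = (real (bsize v e) - 1) * \<delta>"
    unfolding sum_beyond_light[OF e] using bsize_pos[OF e(1), of v] by (simp add: of_nat_diff)
  finally have "1 - (real (bsize v e) - 1) * \<delta> \<le> 1 - (\<Sum>w\<in>e - {v}. load w e)" by simp
  also have "\<dots> \<le> (\<Prod>w\<in>e - {v}. 1 - load w e)"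
    using w by (intro Weierstrass_prod_ineq) (auto simp: less_imp_le)
  finally show "1 - (real (bsize v e) - 1) * \<delta> \<le> (\<Prod>w\<in>e - {v}. 1 - load w e)" .
  show "0 < (\<Prod>w\<in>e - {v}. 1 - load w e)" using w(3) by (intro prod_pos) auto
qed

text \<open>For an edge that is the centroid, the total (m - 1) \<delta> may exceed 1, where
  Weierstrass says nothing. But no vertex has more than (m - 1) / 2 edges beyond it, so the product
  is at least (1 - A)^2 \<ge> 1 / 9, while \<epsilon> < 1 / 10.\<close>

lemma prod_no_light:
  assumes e: "e \<in> hedges G" and h: "\<And>w. w \<in> e \<Longrightarrow> heavy w e"
  shows "\<epsilon> < (\<Prod>w\<in>e. 1 - load w e)"
proof -
  define A where "A = (real m - 1) / 2 * \<delta>"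
  have A: "A < 2 / 3"
  proof -
    have "A \<le> 2 / 3 * (1 - \<epsilon>)" unfolding A_def using many by (intro scaled) auto
    also have "\<dots> < 2 / 3" using \<epsilon>(1) by simp
    finally show ?thesis .
  qed
  have "(1 - A)\<^sup>2 \<le> (\<Prod>w\<in>e. 1 - load w e)"
  proof (rule prod_one_minus_ge_square)
    fix w assume w: "w \<in> e"
    have "real (beyond w e) * \<delta> \<le> A"
      unfolding A_def using heavy_beyond[OF h[OF w]] numbers(1) by (intro mult_right_mono) auto
    then show "0 \<le> load w e \<and> load w e \<le> A" using load_bounds[OF e w h[OF w]] by linarith
  next
    have "(\<Sum>w\<in>e. load w e) \<le> (\<Sum>w\<in>e. real (beyond w e) * \<delta>)"
      using load_bounds(2)[OF e _ h] by (simp add: sum_mono)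
    also have "\<dots> = real (\<Sum>w\<in>e. beyond w e) * \<delta>" by (simp add: sum_distrib_right)
    also have "\<dots> = 2 * A" unfolding sum_beyond_edge[OF e] A_def using many by (simp add: of_nat_diff)
    finally show "(\<Sum>w\<in>e. load w e) \<le> 2 * A" .
  qed (use A finite_edge[OF e] in auto)
  moreover have "(1 / 3)\<^sup>2 \<le> (1 - A)\<^sup>2" using A by (intro power_mono) auto
  ultimately show ?thesis using numbers(3) by (simp add: power2_eq_square)
qed

section \<open>Vertices that are centroids\<close>

definition central :: "'a \<Rightarrow> bool" where
  "central v \<longleftrightarrow> (\<forall>e\<in>hedges G. v \<in> e \<longrightarrow> \<not> heavy v e)"

text \<open>The smallest label at \<open>r\<close> that brings the edge up to \<epsilon>. It uses
  the actual loads rather than the double star bound, which would be too weak at degree m -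
  3.\<close>

definition spoke :: "'a \<Rightarrow> 'a set \<Rightarrow> real" where
  "spoke r e = \<epsilon> / (\<Prod>w\<in>e - {r}. 1 - load w e)"

lemma spoke_le_top:
  assumes e: "e \<in> hedges G" "r \<in> e" and l: "\<not> heavy r e"
  shows "spoke r e + (\<delta> - \<epsilon>) \<le> top_weight (bsize r e)"
proof -
  have "0 < 1 - (real (bsize r e) - 1) * \<delta>"
    using denominator(1)[of "bsize r e"] l \<epsilon> by (simp add: heavy_def)
  then show ?thesis
    unfolding spoke_def top_weight_def using prod_load[OF e l] \<epsilon>
    by (simp add: divide_left_mono)
qed

lemma sum_excess:
  assumes r: "r \<in> verts G"
  shows "(\<Sum>e\<in>incident r. real (bsize r e) - 1) = real m - real (vdegree G r)"
proof -
  have "(\<Sum>e\<in>incident r. real (bsize r e)) = real m"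
    using sum_bsize[OF r] by (metis of_nat_sum)
  then show ?thesis by (simp add: sum_subtractf vdegree_def)
qed

lemma sum_top_le:
  assumes r: "r \<in> verts G" "central r" and d: "0 < d"
    and le: "\<And>e. e \<in> hedges G \<Longrightarrow> r \<in> e \<Longrightarrow> d \<le> 1 - (real (bsize r e) - 1) * \<delta>"
  shows "(\<Sum>e\<in>incident r. spoke r e + (\<delta> - \<epsilon>))
    \<le> real (vdegree G r) * \<delta> + \<epsilon> * \<delta> / d * (real m - real (vdegree G r))"
proof -
  have "(\<Sum>e\<in>incident r. spoke r e + (\<delta> - \<epsilon>))
      \<le> (\<Sum>e\<in>incident r. \<delta> + \<epsilon> * \<delta> / d * (real (bsize r e) - 1))"
  proof (rule sum_mono)
    fix e assume "e \<in> incident r"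
    then have e: "e \<in> hedges G" "r \<in> e" by auto
    then have l: "\<not> heavy r e" using r by (simp add: central_def)
    have "spoke r e + (\<delta> - \<epsilon>) \<le> top_weight (bsize r e)" using spoke_le_top[OF e l] .
    also have "\<dots> \<le> \<delta> + \<epsilon> * \<delta> / d * (real (bsize r e) - 1)"
      using l bsize_pos[OF e(1), of r] d le[OF e] by (intro top_le_denominator) (auto simp: heavy_def)
    finally show "spoke r e + (\<delta> - \<epsilon>) \<le> \<delta> + \<epsilon> * \<delta> / d * (real (bsize r e) - 1)" .
  qed
  also have "\<dots> = real (vdegree G r) * \<delta> + \<epsilon> * \<delta> / d * (real m - real (vdegree G r))"
    unfolding sum.distrib sum_distrib_left[symmetric] sum_excess[OF r(1)] by (simp add: vdegree_def)
  finally show ?thesis .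
qed

text \<open>Each of the m - d edges that miss \<open>r\<close> replaces a pendent edge of cost
  \<delta> by a surcharge of at most \<epsilon> \<delta> / D \<le> \<delta> / 4. The bound is
  largest when four edges miss \<open>r\<close>, and their surcharges then add up to at most
  \<delta>.\<close>

lemma central_small_degree:
  assumes r: "r \<in> verts G" "central r" and deg: "vdegree G r \<le> m - 4"
  shows "(\<Sum>e\<in>incident r. spoke r e + (\<delta> - \<epsilon>)) < 1 + (\<delta> - \<epsilon>)"
proof -
  define D where "D = 1 - (real m / 2 - 1) * \<delta>"
  have D: "4 * \<epsilon> \<le> D" "0 < D" using denominator(2)[of 0] \<epsilon> by (auto simp: D_def)
  define x where "x = real m - real (vdegree G r)"
  have x: "4 \<le> x" using deg many by (simp add: x_def)
  have "(\<Sum>e\<in>incident r. spoke r e + (\<delta> - \<epsilon>))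
      \<le> real (vdegree G r) * \<delta> + \<epsilon> * \<delta> / D * (real m - real (vdegree G r))"
  proof (rule sum_top_le[OF r D(2)])
    fix e assume "e \<in> hedges G" "r \<in> e"
    then have "2 * bsize r e \<le> m" using r unfolding central_def heavy_def by (meson not_less)
    then show "D \<le> 1 - (real (bsize r e) - 1) * \<delta>" using denominator(3) by (simp add: D_def)
  qed
  also have "\<dots> = real m * \<delta> - (1 - \<epsilon> / D) * \<delta> * x"
    by (simp add: x_def algebra_simps)
  also have "\<dots> \<le> real m * \<delta> - (1 - \<epsilon> / D) * \<delta> * 4"
    using x D \<epsilon> numbers(1) by (intro diff_left_mono mult_left_mono mult_nonneg_nonneg) auto
  also have "\<dots> = (real m - 4) * \<delta> + (4 * \<epsilon> / D) * \<delta>" by (simp add: algebra_simps)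
  also have "\<dots> \<le> (real m - 4) * \<delta> + 1 * \<delta>"
    using D numbers(1) by (intro add_left_mono mult_right_mono) auto
  also have "\<dots> < 1 + (\<delta> - \<epsilon>)" using numbers(4) by simp
  finally show ?thesis .
qed

lemma card_others: "e \<in> hedges G \<Longrightarrow> v \<in> e \<Longrightarrow> card (others v e) = vdegree G v - 1"
  using finite_edges by (simp add: others_def vdegree_def)

lemma load_eq_sum:
  assumes e: "e \<in> hedges G" "w \<in> e" and h: "heavy w e" and b: "beyond w e \<le> 3"
  shows "load w e \<le> real (card (others w e)) * \<delta>
    + \<epsilon> * \<delta> / (1 - 2 * \<delta>) * (real (beyond w e) - real (card (others w e)))"
proof -
  have "load w e \<le> (\<Sum>f\<in>others w e. \<delta> + \<epsilon> * \<delta> / (1 - 2 * \<delta>) * (real (bsize w f) - 1))"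
    unfolding load_def
  proof (rule sum_mono)
    fix f assume f: "f \<in> others w e"
    have "bsize w f \<le> 3" "1 \<le> bsize w f" using others_le[OF e f] b by auto
    moreover from this have "(real (bsize w f) - 1) * \<delta> \<le> 2 * \<delta>"
      using numbers(1) by (intro mult_right_mono) auto
    ultimately show "top_weight (bsize w f) \<le> \<delta> + \<epsilon> * \<delta> / (1 - 2 * \<delta>) * (real (bsize w f) - 1)"
      using many numbers(2) by (intro top_le_denominator) auto
  qed
  also have "\<dots> = real (card (others w e)) * \<delta>
      + \<epsilon> * \<delta> / (1 - 2 * \<delta>) * (real (\<Sum>f\<in>others w e. bsize w f) - real (card (others w e)))"
    unfolding sum.distrib sum_distrib_left[symmetric] sum_subtractf of_nat_sum by simp
  finally show ?thesis using sum_others(1)[OF e] by simp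
qed

lemma card_others_le:
  assumes e: "e \<in> hedges G" "w \<in> e"
  shows "card (others w e) \<le> beyond w e" "0 < beyond w e \<Longrightarrow> 0 < card (others w e)"
proof -
  have "(\<Sum>f\<in>others w e. 1) \<le> (\<Sum>f\<in>others w e. bsize w f)"
    using others_le(1)[OF e] by (rule sum_mono)
  then show "card (others w e) \<le> beyond w e" using sum_others(1)[OF e] by simp
  assume "0 < beyond w e"
  then have "others w e \<noteq> {}" using sum_others(1)[OF e] by auto
  then show "0 < card (others w e)" using finite_others by (simp add: card_gt_0_iff)
qed

text \<open>Three edges hang below \<open>e\<close>, split as 3, 2 + 1 or 1 + 1 + 1 over its other
  vertices. Three pendent edges at one vertex would fall short of the bound and 2 + 1 pendent edges
  would attain it; \<open>not_4\<close> and \<open>not_3_2\<close> exclude precisely these, and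
  every other arrangement is strictly better.\<close>

lemma prod_load_four:
  assumes e: "e \<in> hedges G" "r \<in> e" and b: "bsize r e = 4" and deg: "vdegree G r = m - 3"
  shows "(1 - \<delta>) * (1 - 2 * \<delta>) < (\<Prod>w\<in>e - {r}. 1 - load w e)"
proof -
  have l: "\<not> heavy r e" using b many by (simp add: heavy_def)
  have fin: "finite (e - {r})" using finite_edge[OF e(1)] by simp
  have h: "heavy w e" if "w \<in> e - {r}" for w using light_unique[OF e l that] .
  have sum3: "(\<Sum>w\<in>e - {r}. beyond w e) = 3" using sum_beyond_light[OF e] b by simp
  have load: "0 \<le> load w e" "load w e \<le> real (beyond w e) * \<delta>" "load w e < 1" if "w \<in> e - {r}" for w
    using load_bounds[OF e(1) _ h[OF that]] that by auto
  have le3: "beyond w e \<le> 3" if "w \<in> e - {r}" for w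
    using member_le_sum[of w "e - {r}" "\<lambda>w. beyond w e"] that fin sum3 by auto
  have split: "(\<Prod>v\<in>e - {r}. 1 - load v e) = (1 - load w e) * (\<Prod>v\<in>e - {r} - {w}. 1 - load v e)"
    and sum_split: "(\<Sum>v\<in>e - {r} - {w}. beyond v e) = 3 - beyond w e" if "w \<in> e - {r}" for w
    using prod.remove[OF fin that, of "\<lambda>v. 1 - load v e"] sum.remove[OF fin that, of "\<lambda>v. beyond v e"] sum3
    by simp_all
  have rest: "1 - (3 - real (beyond w e)) * \<delta> \<le> (\<Prod>v\<in>e - {r} - {w}. 1 - load v e)"
    if w: "w \<in> e - {r}" for w
  proof -
    have "(\<Sum>v\<in>e - {r} - {w}. load v e) \<le> (\<Sum>v\<in>e - {r} - {w}. real (beyond v e) * \<delta>)"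
      using load(2) by (intro sum_mono) auto
    also have "\<dots> = real (\<Sum>v\<in>e - {r} - {w}. beyond v e) * \<delta>" by (simp add: sum_distrib_right)
    also have "\<dots> = (3 - real (beyond w e)) * \<delta>"
      unfolding sum_split[OF w] using le3[OF w] by (simp add: of_nat_diff)
    finally have "1 - (3 - real (beyond w e)) * \<delta> \<le> 1 - (\<Sum>v\<in>e - {r} - {w}. load v e)" by simp
    also have "\<dots> \<le> (\<Prod>v\<in>e - {r} - {w}. 1 - load v e)"
      using load by (intro Weierstrass_prod_ineq) (auto simp: less_imp_le)
    finally show ?thesis .
  qed
  \<comment> \<open>The surcharge per edge that is not itself at the top of a branch, when branches
    have at most three edges. Being below \<delta>, it makes nesting cheaper than a further pendent
    edge.\<close>
  define \<eta> where "\<eta> = \<epsilon> * \<delta> / (1 - 2 * \<delta>)"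
  have \<eta>: "0 \<le> \<eta>" "\<eta> < \<delta> * (1 - 2 * \<delta>)" "\<eta> < \<delta>"
  proof -
    have pos: "0 < 1 - 2 * \<delta>" using numbers(2) by simp
    show "0 \<le> \<eta>" unfolding \<eta>_def using pos \<epsilon> numbers(1) by simp
    have "(7 / 9) * (7 / 9) \<le> (1 - 2 * \<delta>) * (1 - 2 * \<delta>)" using numbers(2) by (intro mult_mono) auto
    then have "\<epsilon> < (1 - 2 * \<delta>) * (1 - 2 * \<delta>)" using numbers(3) by simp
    then have "\<epsilon> * \<delta> < (1 - 2 * \<delta>) * (1 - 2 * \<delta>) * \<delta>" using numbers(1) by (rule mult_strict_right_mono)
    then show lt: "\<eta> < \<delta> * (1 - 2 * \<delta>)" unfolding \<eta>_def using pos by (simp add: field_simps)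
    have "\<delta> * (1 - 2 * \<delta>) \<le> \<delta> * 1" using numbers(1) by (intro mult_left_mono) auto
    then show "\<eta> < \<delta>" using lt by simp
  qed
  consider (three) w where "w \<in> e - {r}" "beyond w e = 3" | (two) w where "w \<in> e - {r}" "beyond w e = 2"
    | (one) "\<And>w. w \<in> e - {r} \<Longrightarrow> beyond w e \<le> 1"
  proof -
    have "\<exists>w\<in>e - {r}. beyond w e = 3 \<or> beyond w e = 2" if ex: "\<not> (\<forall>w\<in>e - {r}. beyond w e \<le> 1)"
    proof -
      obtain w where w: "w \<in> e - {r}" "\<not> beyond w e \<le> 1" using ex by blast
      then have "beyond w e = 3 \<or> beyond w e = 2" using le3[OF w(1)] by linarith
      then show ?thesis using w by blast
    qed
    then show thesis using three two one by blast
  qed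
  then show ?thesis
  proof cases
    case three
    have we: "w \<in> e" "r \<noteq> w" using three by auto
    define c where "c = card (others w e)"
    have c: "c \<le> 3" "0 < c" using card_others_le[OF e(1) we(1)] three by (simp_all add: c_def)
    have "vdegree G w \<noteq> 4" using not_4[of e r w] e we deg by simp
    then have "c \<noteq> 3" using card_others[OF e(1) we(1)] by (simp add: c_def)
    then have c12: "c = 1 \<or> c = 2" using c by linarith
    have "load w e \<le> real c * \<delta> + \<eta> * (3 - real c)"
      using load_eq_sum[OF e(1) we(1) h[OF three(1)]] three(2) by (simp add: c_def \<eta>_def)
    also have "\<dots> \<le> 2 * \<delta> + \<eta>" using c12 \<eta> by auto
    \<comment> \<open>The target is the load x with 1 - x = (1 - \<delta>)(1 - 2\<delta>).\<close>
    also have "\<dots> < 3 * \<delta> - 2 * \<delta> * \<delta>" using \<eta> by (simp add: algebra_simps)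
    finally have lw: "load w e < 3 * \<delta> - 2 * \<delta> * \<delta>" .
    have "(1 - \<delta>) * (1 - 2 * \<delta>) < 1 - load w e" using lw by (simp add: algebra_simps)
    also have "\<dots> \<le> (1 - load w e) * (\<Prod>v\<in>e - {r} - {w}. 1 - load v e)"
      using rest[OF three(1)] three load(3)[OF three(1)] by (simp add: mult_left_le_one_le mult_le_cancel_left1)
    finally show ?thesis using split[OF three(1)] by simp
  next
    case two
    have we: "w \<in> e" "r \<noteq> w" using two by auto
    define c where "c = card (others w e)"
    have c: "c \<le> 2" "0 < c" using card_others_le[OF e(1) we(1)] two by (simp_all add: c_def)
    have "(\<Sum>v\<in>e - {r} - {w}. beyond v e) = 1" using sum_split[OF two(1)] two by simp
    then obtain v where v: "v \<in> e - {r} - {w}" "beyond v e = 1"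
      using fin sum_eq_1_iff[of "e - {r} - {w}" "\<lambda>v. beyond v e"] by auto
    have "card (others v e) = 1" using card_others_le[OF e(1), of v] v by simp
    then have "vdegree G v = 2" using card_others[OF e(1), of v] v by simp
    then have "vdegree G w \<noteq> 3" using not_3_2[of e r w v] e we v deg by auto
    then have "c \<noteq> 2" using card_others[OF e(1) we(1)] by (simp add: c_def)
    then have c1: "c = 1" using c by linarith
    have "load w e \<le> \<delta> + \<eta>"
      using load_eq_sum[OF e(1) we(1) h[OF two(1)]] two(2) c1 by (simp add: c_def \<eta>_def)
    then have lw: "load w e < 2 * \<delta>" using \<eta> by linarith
    have "1 - \<delta> \<le> (\<Prod>v\<in>e - {r} - {w}. 1 - load v e)" using rest[OF two(1)] two by simp
    then have "(1 - 2 * \<delta>) * (1 - \<delta>) < (1 - load w e) * (\<Prod>v\<in>e - {r} - {w}. 1 - load v e)"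
      using lw numbers(2) by (intro mult_less_le_imp_less) auto
    then show ?thesis using split[OF two(1)] by (simp add: mult.commute)
  next
    case one
    obtain w where w: "w \<in> e - {r}" "beyond w e \<noteq> 0" using sum3 by (metis sum.neutral zero_neq_numeral)
    then have w1: "beyond w e = 1" using one[OF w(1)] by linarith
    \<comment> \<open>Two of the three edges remain, at most one beyond each vertex, and (1 -
      \<delta>)^2 beats 1 - 2\<delta>.\<close>
    have "(1 - \<delta>)\<^sup>2 \<le> (\<Prod>v\<in>e - {r} - {w}. 1 - load v e)"
    proof (rule prod_one_minus_ge_square)
      fix v assume v: "v \<in> e - {r} - {w}"
      then have "real (beyond v e) * \<delta> \<le> 1 * \<delta>" using one[of v] numbers(1) by (intro mult_right_mono) auto
      then show "0 \<le> load v e \<and> load v e \<le> \<delta>" using load[of v] v by auto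
    next
      have "(\<Sum>v\<in>e - {r} - {w}. load v e) \<le> (\<Sum>v\<in>e - {r} - {w}. real (beyond v e) * \<delta>)"
        using load(2) by (intro sum_mono) auto
      also have "\<dots> = real (\<Sum>v\<in>e - {r} - {w}. beyond v e) * \<delta>" by (simp add: sum_distrib_right)
      finally show "(\<Sum>v\<in>e - {r} - {w}. load v e) \<le> 2 * \<delta>" using sum_split[OF w(1)] w1 by simp
    qed (use fin numbers(2) in auto)
    moreover have "1 - 2 * \<delta> < (1 - \<delta>)\<^sup>2" using numbers(1) by (simp add: power2_eq_square algebra_simps)
    ultimately have "1 - 2 * \<delta> < (\<Prod>v\<in>e - {r} - {w}. 1 - load v e)" by linarith
    moreover have "1 - \<delta> \<le> 1 - load w e" using load(2)[OF w(1)] w1 by simp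
    ultimately have "(1 - \<delta>) * (1 - 2 * \<delta>) < (1 - load w e) * (\<Prod>v\<in>e - {r} - {w}. 1 - load v e)"
      using numbers(1,2) by (intro mult_le_less_imp_less) auto
    then show ?thesis using split[OF w(1)] by simp
  qed
qed

text \<open>Three edges miss \<open>r\<close>. Either all of them lie in one branch of four edges,
  where \<open>prod_load_four\<close> beats the exact budget of \<open>numbers\<close>, or every
  branch has at most three edges and the denominator 1 - 2\<delta> serves for all.\<close>

lemma central_large_degree:
  assumes r: "r \<in> verts G" "central r" and deg: "vdegree G r = m - 3"
  shows "(\<Sum>e\<in>incident r. spoke r e + (\<delta> - \<epsilon>)) < 1 + (\<delta> - \<epsilon>)"
proof -
  have excess: "(\<Sum>e\<in>incident r. real (bsize r e) - 1) = 3"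
    using sum_excess[OF r(1)] deg many by (simp add: of_nat_diff)
  have fin: "finite (incident r)" using finite_edges by simp
  have nonneg: "0 \<le> real (bsize r e) - 1" if "e \<in> incident r" for e
    using bsize_pos[of e r] that by auto
  have le4: "bsize r e \<le> 4" if "e \<in> hedges G" "r \<in> e" for e
    using member_le_sum[of e "incident r" "\<lambda>e. real (bsize r e) - 1"] that fin nonneg excess
    by auto
  show ?thesis
  proof (cases "\<exists>e\<in>hedges G. r \<in> e \<and> bsize r e = 4")
    case True
    then obtain e where e: "e \<in> hedges G" "r \<in> e" "bsize r e = 4" by blast
    have ones: "bsize r f = 1" if f: "f \<in> others r e" for f
    proof -
      have "(\<Sum>f\<in>others r e. real (bsize r f) - 1) = 0"
        using sum_others(2)[OF e(1,2), of "\<lambda>f. real (bsize r f) - 1"] excess e(3) by simp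
      then have "\<forall>f\<in>others r e. real (bsize r f) - 1 = 0"
        using finite_others nonneg by (subst (asm) sum_nonneg_eq_0_iff) (auto simp: others_def)
      then show ?thesis using f by auto
    qed
    have "spoke r f + (\<delta> - \<epsilon>) \<le> \<delta>" if f: "f \<in> others r e" for f
    proof -
      have "f \<in> hedges G" "r \<in> f" using f by (auto simp: others_def)
      then have "spoke r f + (\<delta> - \<epsilon>) \<le> top_weight (bsize r f)"
        using r spoke_le_top by (simp add: central_def)
      then show ?thesis using ones[OF f] by (simp add: top_weight_def)
    qed
    then have "(\<Sum>f\<in>others r e. spoke r f + (\<delta> - \<epsilon>)) \<le> (\<Sum>f\<in>others r e. \<delta>)" by (rule sum_mono)
    also have "\<dots> = (real m - 4) * \<delta>" using card_others[OF e(1,2)] deg many by (simp add: of_nat_diff)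
    finally have "(\<Sum>f\<in>others r e. spoke r f + (\<delta> - \<epsilon>)) \<le> (real m - 4) * \<delta>" .
    moreover have "spoke r e < \<epsilon> / ((1 - \<delta>) * (1 - 2 * \<delta>))"
      unfolding spoke_def
      by (rule divide_strict_left_mono[OF prod_load_four[OF e deg] \<epsilon>(1)
          mult_pos_pos[OF less_trans[OF numbers(6) prod_load_four[OF e deg]] numbers(6)]])
    ultimately show ?thesis
      using sum_others(2)[OF e(1,2), of "\<lambda>f. spoke r f + (\<delta> - \<epsilon>)"] numbers(5) by linarith
  next
    case False
    then have le3: "bsize r e \<le> 3" if "e \<in> hedges G" "r \<in> e" for e
  proof -
      have "bsize r e \<noteq> 4" using False that by blast
      then show ?thesis using le4[OF that] by linarith
    qed
    have pos: "0 < 1 - 2 * \<delta>" using numbers(2) by simp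
    have "(\<Sum>e\<in>incident r. spoke r e + (\<delta> - \<epsilon>))
        \<le> real (vdegree G r) * \<delta> + \<epsilon> * \<delta> / (1 - 2 * \<delta>) * (real m - real (vdegree G r))"
    proof (rule sum_top_le[OF r pos])
      fix e assume "e \<in> hedges G" "r \<in> e"
      then have "(real (bsize r e) - 1) * \<delta> \<le> 2 * \<delta>"
        using le3[of e] numbers(1) by (intro mult_right_mono) auto
      then show "1 - 2 * \<delta> \<le> 1 - (real (bsize r e) - 1) * \<delta>" by simp
    qed
    also have "\<dots> = (real m - 3) * \<delta> + 3 * (\<epsilon> * \<delta> / (1 - 2 * \<delta>))"
      using deg many by (simp add: of_nat_diff)
    also have "\<dots> < 1 + (\<delta> - \<epsilon>)"
    proof -
      define c where "c = (1 - \<delta>) * (1 - 2 * \<delta>)"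
      have c: "0 < c" using numbers(6) by (simp add: c_def)
      have "\<epsilon> * \<delta> / (1 - 2 * \<delta>) = \<epsilon> * \<delta> * (1 - \<delta>) / c"
        using pos c by (subst frac_eq_eq) (auto simp: c_def)
      then have "3 * (\<epsilon> * \<delta> / (1 - 2 * \<delta>)) = 3 * \<epsilon> * \<delta> * (1 - \<delta>) / c"
        by simp
      moreover have "\<epsilon> / c - \<epsilon> = \<epsilon> * (1 - c) / c" using c by (simp add: field_simps)
      moreover have "3 * \<epsilon> * \<delta> * (1 - \<delta>) < \<epsilon> * (1 - c)"
      proof -
        \<comment> \<open>Over the common denominator c the whole margin is \<epsilon> \<delta>^2,
          so no cruder denominator could be afforded lightly here.\<close>
        have "\<epsilon> * (1 - c) - 3 * \<epsilon> * \<delta> * (1 - \<delta>) = \<epsilon> * \<delta> * \<delta>" by (simp add: c_def algebra_simps)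
        moreover have "0 < \<epsilon> * \<delta> * \<delta>" using \<epsilon> numbers(1) by simp
        ultimately show ?thesis by linarith
      qed
      then have "3 * \<epsilon> * \<delta> * (1 - \<delta>) / c < \<epsilon> * (1 - c) / c" using c by (rule divide_strict_right_mono)
      ultimately have "3 * (\<epsilon> * \<delta> / (1 - 2 * \<delta>)) < \<epsilon> / c - \<epsilon>" by simp
      then show ?thesis using numbers(5) by (simp add: c_def algebra_simps)
    qed
    finally show ?thesis .
  qed
qed

lemma central_sum:
  assumes r: "r \<in> verts G" "central r"
  shows "(\<Sum>e\<in>incident r. spoke r e + (\<delta> - \<epsilon>)) < 1 + (\<delta> - \<epsilon>)"
proof (cases "vdegree G r = m - 3")
  case True
  then show ?thesis using central_large_degree[OF r] by simp
next
  case False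
  then show ?thesis using central_small_degree[OF r] max_degree[OF r(1)] by simp
qed

text \<open>Count heavy incidences. Without a central vertex every vertex has exactly one, in total
  |V|; if every edge has a light incidence, it has exactly k - 1 heavy ones, in total m (k - 1).
  These numbers differ by one.\<close>

lemma strict_somewhere:
  "(\<exists>v\<in>verts G. central v) \<or> (\<exists>e\<in>hedges G. \<forall>w\<in>e. heavy w e)"
proof (rule ccontr)
  assume "\<not> ?thesis"
  then have v: "\<And>v. v \<in> verts G \<Longrightarrow> \<not> central v" and e: "\<And>e. e \<in> hedges G \<Longrightarrow> \<exists>w\<in>e. \<not> heavy w e"
    by auto
  have "(\<Sum>w\<in>e. of_bool (heavy w e)) = k - 1" if eG: "e \<in> hedges G" for e
  proof -
    obtain w where w: "w \<in> e" "\<not> heavy w e" using e eG by blast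
    have "(\<Sum>w\<in>e. of_bool (heavy w e)) = (\<Sum>u\<in>e - {w}. of_bool (heavy u e) :: nat)"
      using w sum.remove[OF finite_edge[OF eG] w(1), of "\<lambda>w. of_bool (heavy w e) :: nat"] by simp
    also have "\<dots> = (\<Sum>u\<in>e - {w}. 1)"
      using light_unique[OF eG w] by (intro sum.cong) auto
    finally show ?thesis using card_edge[OF eG] finite_edge[OF eG] w by simp
  qed
  then have 1: "(\<Sum>e\<in>hedges G. \<Sum>w\<in>e. of_bool (heavy w e)) = m * (k - 1)" by simp
  have "(\<Sum>e\<in>incident w. of_bool (heavy w e)) = (1::nat)" if w: "w \<in> verts G" for w
  proof -
    obtain e where e: "e \<in> hedges G" "w \<in> e" "heavy w e" using v[OF w] by (auto simp: central_def)
    have "\<not> heavy w f" if "f \<in> incident w - {e}" for f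
      using others_light[OF e] that by (simp add: others_def)
    then have "(\<Sum>f\<in>incident w - {e}. of_bool (heavy w f)) = (0::nat)" by (intro sum.neutral) auto
    then show ?thesis
      using sum.remove[of "incident w" e "\<lambda>e. of_bool (heavy w e) :: nat"] e finite_edges by simp
  qed
  then have "(\<Sum>e\<in>hedges G. \<Sum>w\<in>e. of_bool (heavy w e)) = card (verts G)"
    unfolding sum_edges_verts by simp
  then show False using 1 card_verts by simp
qed

text \<open>A vertex that is not central is filled exactly, because its heavy incidence takes all
  that the light ones leave. Strict slack is found in the sum at central vertices and in the product
  over edges without a light incidence.\<close>

definition label :: "'a \<Rightarrow> 'a set \<Rightarrow> real" where
  "label v e = (if heavy v e then 1 - load v e
     else if central v then spoke v e else \<epsilon> / (1 - (real (bsize v e) - 1) * \<delta>))"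

lemma label_pos:
  assumes e: "e \<in> hedges G" "v \<in> e"
  shows "0 < label v e"
proof (cases "heavy v e")
  case True
  then show ?thesis using load_bounds[OF e True] by (simp add: label_def)
next
  case False
  then have "0 < 1 - (real (bsize v e) - 1) * \<delta>"
    using denominator(1)[of "bsize v e"] \<epsilon> by (simp add: heavy_def)
  then show ?thesis using prod_load(2)[OF e False] \<epsilon> False by (simp add: label_def spoke_def)
qed

lemma label_central: "central v \<Longrightarrow> v \<in> verts G \<Longrightarrow>
    (\<Sum>e\<in>incident v. label v e + (\<delta> - \<epsilon>)) < 1 + (\<delta> - \<epsilon>)"
proof -
  assume v: "central v" "v \<in> verts G"
  have "(\<Sum>e\<in>incident v. label v e + (\<delta> - \<epsilon>)) = (\<Sum>e\<in>incident v. spoke v e + (\<delta> - \<epsilon>))"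
    using v by (intro sum.cong) (auto simp: label_def central_def)
  then show ?thesis using central_sum v by simp
qed

lemma label_vertex:
  assumes v: "v \<in> verts G"
  shows "(\<Sum>e\<in>incident v. label v e + (\<delta> - \<epsilon>)) \<le> 1 + (\<delta> - \<epsilon>)"
proof (cases "central v")
  case True
  then show ?thesis using label_central v by (simp add: less_imp_le)
next
  case False
  then obtain e where e: "e \<in> hedges G" "v \<in> e" "heavy v e" by (auto simp: central_def)
  have "(\<Sum>f\<in>others v e. label v f + (\<delta> - \<epsilon>)) = load v e"
    unfolding load_def using others_light[OF e] False by (intro sum.cong) (auto simp: label_def top_weight_def)
  then show ?thesis
    using sum_others(2)[OF e(1,2), of "\<lambda>f. label v f + (\<delta> - \<epsilon>)"] e(3) by (simp add: label_def)
qed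

lemma label_no_light:
  assumes e: "e \<in> hedges G" "\<forall>w\<in>e. heavy w e"
  shows "\<epsilon> < (\<Prod>w\<in>e. label w e)"
  using prod_no_light[OF e(1)] e(2) by (simp add: label_def)

lemma label_edge:
  assumes e: "e \<in> hedges G"
  shows "\<epsilon> \<le> (\<Prod>v\<in>e. label v e)"
proof (cases "\<forall>w\<in>e. heavy w e")
  case True
  then show ?thesis using label_no_light[OF e] by simp
next
  case False
  then obtain v where v: "v \<in> e" "\<not> heavy v e" by blast
  have "(\<Prod>w\<in>e - {v}. label w e) = (\<Prod>w\<in>e - {v}. 1 - load w e)"
    using light_unique[OF e v] by (intro prod.cong) (auto simp: label_def)
  then have p: "(\<Prod>w\<in>e. label w e) = label v e * (\<Prod>w\<in>e - {v}. 1 - load w e)"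
    using prod.remove[OF finite_edge[OF e] v(1), of "\<lambda>w. label w e"] by simp
  note pl = prod_load[OF e v]
  have d: "0 < 1 - (real (bsize v e) - 1) * \<delta>"
    using denominator(1)[of "bsize v e"] v \<epsilon> by (simp add: heavy_def)
  show ?thesis
  proof (cases "central v")
    case True
    then show ?thesis using p v pl(2) by (simp add: label_def spoke_def)
  next
    case False
    have "\<epsilon> = \<epsilon> / (1 - (real (bsize v e) - 1) * \<delta>) * (1 - (real (bsize v e) - 1) * \<delta>)" using d by simp
    also have "\<dots> \<le> \<epsilon> / (1 - (real (bsize v e) - 1) * \<delta>) * (\<Prod>w\<in>e - {v}. 1 - load w e)"
      using pl(1) d \<epsilon> by (intro mult_left_mono) auto
    finally show ?thesis using p v False by (simp add: label_def)
  qed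
qed

lemma rho_less_comparison:
  assumes \<alpha>: "0 \<le> \<alpha>" "\<alpha> < 1" and \<mu>: "\<alpha> < \<mu>" and "\<delta> = del \<alpha> k \<mu>" "\<epsilon> = eps \<alpha> k \<mu>"
  shows "alpha_spectral_radius \<alpha> k G < \<mu>"
proof -
  interpret alpha_hypergraph k G \<alpha> by unfold_locales (use \<alpha> in auto)
  have \<gamma>: "gam \<alpha> \<mu> = \<delta> - \<epsilon>" using assms by (simp add: del_def)
  show ?thesis
  proof (rule rho_less[OF \<mu> gam_def \<open>\<epsilon> = eps \<alpha> k \<mu>\<close>[unfolded eps_def], of label])
    show "(\<exists>v\<in>verts G. (\<Sum>e\<in>incident v. label v e + gam \<alpha> \<mu>) < 1 + gam \<alpha> \<mu>)
        \<or> (\<exists>e\<in>hedges G. \<epsilon> < (\<Prod>v\<in>e. label v e))"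
      using strict_somewhere label_central label_no_light unfolding \<gamma> by blast
  qed (use label_pos label_vertex label_edge in \<open>auto simp: \<gamma>\<close>)
qed

end

section \<open>The ordering\<close>

context supertree
begin

lemma third_vertex:
  assumes "e \<in> hedges G"
  obtains u where "u \<in> e" "u \<noteq> a" "u \<noteq> b"
proof -
  have "card {a, b} \<le> 2" by (simp add: card_insert_if)
  then have "\<not> e \<subseteq> {a, b}" using card_edge[OF assms] k card_mono[of "{a, b}" e] by fastforce
  then show ?thesis using that by blast
qed

lemma edge_cored_two:
  assumes e: "e \<in> hedges G" "{w, v} \<subseteq> e" "w \<noteq> v"
    and sum: "(vdegree G w - 1) + (vdegree G v - 1) = card (hedges G) - 1"
  shows "edge_cored k G (vdegree G w - 1) (vdegree G v - 1) 0"
proof -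
  obtain u where u: "u \<in> e" "u \<noteq> w" "u \<noteq> v" using third_vertex[OF e(1)] .
  have "{w, v} \<subseteq> verts G" "u \<in> verts G - {w, v}" using u e edge_subset by blast+
  moreover have "(\<Sum>x\<in>{w, v}. vdegree G x - 1) = card (hedges G) - 1" using e(3) sum by simp
  ultimately have "vdegree G u = 1" using vdegree_outside by metis
  then show ?thesis using edge_coredI[OF e(1), of w v u] u e sum by simp
qed

lemma degree_le: "vdegree G v \<le> card (hedges G)"
  unfolding vdegree_def using finite_edges by (intro card_mono) auto

lemma edge_not_through:
  assumes "vdegree G v < card (hedges G)"
  obtains g where "g \<in> hedges G" "v \<notin> g"
proof -
  have "\<exists>g\<in>hedges G. v \<notin> g"
  proof (rule ccontr)
    assume "\<not> ?thesis"
    then have "incident v = hedges G" by blast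
    then show False using assms by (simp add: vdegree_def)
  qed
  then show ?thesis using that by blast
qed

text \<open>The excess left for vertices other than \<open>v\<close> is at most 2. Whenever some
  edge misses \<open>v\<close>, \<open>branching_neighbour\<close> places part of it on a neighbour
  of \<open>v\<close>, so only the position of one further vertex of degree 2 has to be
  distinguished.\<close>

lemma large_degree:
  assumes v: "v \<in> verts G" and m: "m = card (hedges G)" "5 \<le> m" and deg: "m - 2 \<le> vdegree G v"
  shows "edge_cored k G (m - 1) 0 0 \<or> edge_cored k G 1 (m - 2) 0 \<or> edge_cored k G 2 (m - 3) 0 \<or>
    edge_cored k G 1 1 (m - 3) \<or> path_cored k G 1 (m - 4) 1 \<or> path_cored k G (m - 3) 0 1"
proof -
  define f where "f u = vdegree G u - 1" for u
  have f0: "vdegree G u = f u + 1" if "u \<in> verts G" for u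
    using vdegree_pos[OF that] by (simp add: f_def)
  have sum: "f v + (\<Sum>u\<in>verts G - {v}. f u) = m - 1"
    using sum_vdegree sum.remove[OF finite_verts v, of f] m by (simp add: f_def)
  have fv: "vdegree G v = f v + 1" using f0 v .
  have fin: "finite (verts G - {v})" using finite_verts by simp
  consider "vdegree G v = m" | "vdegree G v = m - 1" | "vdegree G v = m - 2"
    using deg degree_le[of v] m by linarith
  then show ?thesis
  proof cases
    case 1
    obtain e where e: "e \<in> hedges G" "v \<in> e"
      using 1 m by (metis (mono_tags, lifting) Collect_empty_eq card.empty not_numeral_le_zero vdegree_def)
    obtain w where w: "w \<in> e" "w \<noteq> v" using third_vertex[OF e(1), of v v] by blast
    then have "w \<in> verts G" using e edge_subset by blast
    moreover have "(\<Sum>u\<in>verts G - {v}. f u) = 0" using sum fv 1 by simp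
    ultimately have "f w = 0" using fin w by simp
    then show ?thesis using edge_cored_two[of e v w] e w 1 m by (simp add: f_def)
  next
    case 2
    then obtain g where "g \<in> hedges G" "v \<notin> g" using edge_not_through[of v] m by auto
    then obtain e w where e: "e \<in> hedges G" "v \<in> e" "w \<in> e" "w \<noteq> v" "2 \<le> vdegree G w"
      using branching_neighbour[OF v] by metis
    have w: "w \<in> verts G - {v}" using e edge_subset by blast
    have "(\<Sum>u\<in>verts G - {v}. f u) = 1" using sum fv 2 m by simp
    then have "f w \<le> 1" using member_le_sum[of w "verts G - {v}" f] w fin by simp
    then have "vdegree G w = 2" using e by (simp add: f_def)
    then show ?thesis using edge_cored_two[of e w v] e 2 m by (simp add: numeral_2_eq_2)
  next
    case 3
    then obtain g where "g \<in> hedges G" "v \<notin> g" using edge_not_through[of v] m by auto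
    then obtain e w where e: "e \<in> hedges G" "v \<in> e" "w \<in> e" "w \<noteq> v" "2 \<le> vdegree G w"
      using branching_neighbour[OF v] by metis
    have w: "w \<in> verts G - {v}" using e edge_subset by blast
    have "(\<Sum>u\<in>verts G - {v}. f u) = 2" using sum fv 3 m by simp
    then have sum2: "f w + (\<Sum>u\<in>verts G - {v} - {w}. f u) = 2" using sum.remove[OF fin w, of f] by simp
    have "1 \<le> f w" using e by (simp add: f_def)
    with sum2 have "f w = 2 \<or> f w = 1 \<and> (\<Sum>u\<in>verts G - {v} - {w}. f u) = 1" by linarith
    then consider "f w = 2" | "f w = 1" "(\<Sum>u\<in>verts G - {v} - {w}. f u) = 1" by blast
    then show ?thesis
    proof cases
      case 1
      then show ?thesis using edge_cored_two[of e w v] e 3 m by (simp add: f_def numeral_3_eq_3)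
    next
      case 2
      then obtain z where z: "z \<in> verts G - {v} - {w}" "f z = 1"
        and zero: "\<forall>u\<in>verts G - {v} - {w}. z \<noteq> u \<longrightarrow> f u = 0"
        using fin sum_eq_1_iff[of "verts G - {v} - {w}" f] by auto
      have dw: "vdegree G w = 2" using 2 f0 w by auto
      have dz: "vdegree G z = 2" using z f0 by auto
      show ?thesis
      proof (cases "z \<in> e")
        case True
        then have "edge_cored k G (vdegree G w - 1) (vdegree G z - 1) (vdegree G v - 1)"
          using e z dw dz 3 m by (intro edge_coredI[of e]) auto
        then show ?thesis using dw dz 3 by (simp add: numeral_3_eq_3)
      next
        case False
        then obtain e' x where e': "e' \<in> hedges G" "z \<in> e'" "x \<in> e'" "x \<noteq> z" "2 \<le> vdegree G x"
          using branching_neighbour[of z e] z e by auto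
        have "x \<in> verts G" using e' edge_subset by blast
        \<comment> \<open>The vertices v, w and z exhaust the excess, so a branching vertex other
          than z is v or w; these give S_{1,m-4,1} and S_{m-3,0,1}.\<close>
        then have "x = v \<or> x = w" using zero e'(4,5) by (force simp: f_def)
        then show ?thesis
        proof
          assume "x = v"
          then have "path_cored k G (vdegree G z - 1) (vdegree G v - 2) (vdegree G w - 1)"
            using e e' z False dw dz 3 m by (intro path_coredI[of e' e]) auto
          moreover have "m - 2 - 2 = m - 4" by simp
          ultimately show ?thesis using dw dz 3 by simp
        next
          assume "x = w"
          then have "path_cored k G (vdegree G v - 1) (vdegree G w - 2) (vdegree G z - 1)"
            using e e' z False dw dz 3 m by (intro path_coredI[of e e']) auto
          moreover have "m - 2 - 1 = m - 3" by simp
          ultimately show ?thesis using dw dz 3 by simp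
        qed
      qed
    qed
  qed
qed

end

section \<open>Scalar inequalities between consecutive equations\<close>

text \<open>In what follows \<open>M\<close> is the number of edges.\<close>

lemma star_less_double_star:
  fixes M \<delta> :: real
  assumes "13 \<le> M" "0 < \<delta>"
  shows "1 - (M - 1) * \<delta> < (1 - \<delta>) * (1 - (M - 2) * \<delta>)"
proof -
  have "(1 - \<delta>) * (1 - (M - 2) * \<delta>) - (1 - (M - 1) * \<delta>) = (M - 2) * (\<delta> * \<delta>)"
    by (simp add: algebra_simps)
  moreover have "0 < (M - 2) * (\<delta> * \<delta>)" using assms by simp
  ultimately show ?thesis by linarith
qed

lemma double_star_shift:
  fixes M \<delta> :: real
  assumes "13 \<le> M" "0 < \<delta>"
  shows "(1 - \<delta>) * (1 - (M - 2) * \<delta>) < (1 - 2 * \<delta>) * (1 - (M - 3) * \<delta>)"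
proof -
  have "(1 - 2 * \<delta>) * (1 - (M - 3) * \<delta>) - (1 - \<delta>) * (1 - (M - 2) * \<delta>) = (M - 4) * (\<delta> * \<delta>)"
    by (simp add: algebra_simps)
  moreover have "0 < (M - 4) * (\<delta> * \<delta>)" using assms by simp
  ultimately show ?thesis by linarith
qed

lemma edge_core_to_path_core:
  fixes M \<delta> \<epsilon> :: real
  assumes "0 < \<delta>" "\<delta> < 1" "(M - 3) * \<delta> < 1" and \<epsilon>: "(1 - \<delta>) * (1 - \<delta>) * (1 - (M - 3) * \<delta>) = \<epsilon>"
  shows "(M - 4) * \<delta> + (\<delta> - \<epsilon>) + \<epsilon> / (1 - \<delta>) + \<epsilon> / (1 - \<delta>) < 1"
proof -
  define w where "w = 1 - (M - 3) * \<delta>"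
  have w: "0 < w" using assms by (simp add: w_def)
  have e: "\<epsilon> = (1 - \<delta>) * (1 - \<delta>) * w" using \<epsilon> by (simp add: w_def)
  then have x: "\<epsilon> / (1 - \<delta>) = (1 - \<delta>) * w" using assms(2) by simp
  have y: "(M - 4) * \<delta> = 1 - w - \<delta>" by (simp add: w_def algebra_simps)
  have "(M - 4) * \<delta> + (\<delta> - \<epsilon>) + \<epsilon> / (1 - \<delta>) + \<epsilon> / (1 - \<delta>)
      = 1 - w - \<delta> + (\<delta> - \<epsilon>) + (1 - \<delta>) * w + (1 - \<delta>) * w"
    unfolding x y ..
  also have "\<dots> = 1 - \<delta> * \<delta> * w" unfolding e by (simp add: algebra_simps)
  finally have "(M - 4) * \<delta> + (\<delta> - \<epsilon>) + \<epsilon> / (1 - \<delta>) + \<epsilon> / (1 - \<delta>) = 1 - \<delta> * \<delta> * w" .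
  moreover have "0 < \<delta> * \<delta> * w" using w assms(1) by simp
  ultimately show ?thesis by linarith
qed

lemma path_core_shift:
  fixes M \<delta> \<epsilon> :: real
  assumes "13 \<le> M" "0 < \<epsilon>" "\<epsilon> \<le> \<delta>" "\<delta> < 1"
    and eq: "(M - 4) * \<delta> + (\<delta> - \<epsilon>) + \<epsilon> / (1 - \<delta>) + \<epsilon> / (1 - \<delta>) = 1"
  shows "(M - 3) * \<delta> < 1" "(\<delta> - \<epsilon>) + \<epsilon> / (1 - (M - 3) * \<delta>) + \<epsilon> / (1 - \<delta>) < 1"
proof -
  define w where "w = 1 - (M - 3) * \<delta>"
  have "w = 2 * (\<epsilon> / (1 - \<delta>)) - \<epsilon>" using eq by (simp add: w_def algebra_simps)
  \<comment> \<open>With w in this form, \<epsilon> / w = (1 - \<delta>) / (1 + \<delta>) no longer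
    depends on \<epsilon>.\<close>
  also have "\<dots> = \<epsilon> * (1 + \<delta>) / (1 - \<delta>)" using assms(4) by (simp add: field_simps)
  finally have w: "w = \<epsilon> * (1 + \<delta>) / (1 - \<delta>)" .
  then have "0 < w" using assms by simp
  then show lt: "(M - 3) * \<delta> < 1" by (simp add: w_def)
  have "10 * \<delta> \<le> (M - 3) * \<delta>" using assms by (intro mult_right_mono) auto
  then have \<delta>: "\<delta> < 1 / 10" "0 < \<delta>" using lt assms by linarith+
  have ew: "\<epsilon> / w = (1 - \<delta>) / (1 + \<delta>)" unfolding w using assms(2) \<delta> by simp
  have "\<epsilon> / (1 - \<delta>) - \<epsilon> = \<epsilon> / (1 - \<delta>) * \<delta>" using assms(4) by (simp add: field_simps)
  moreover have "\<epsilon> / (1 - \<delta>) * \<delta> \<le> 1 / 9 * \<delta>"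
    using assms \<delta> by (intro mult_right_mono) (auto simp: field_simps)
  \<comment> \<open>The coefficient 10 / 9 has to pay for the summand \<delta> and for \<epsilon> /
    (1 - \<delta>) - \<epsilon>, which is at most \<delta> / 9.\<close>
  moreover have "(1 - \<delta>) / (1 + \<delta>) < 1 - 10 / 9 * \<delta>"
  proof -
    have "(1 - 10 / 9 * \<delta>) * (1 + \<delta>) - (1 - \<delta>) = \<delta> * (8 / 9 - 10 / 9 * \<delta>)" by (simp add: algebra_simps)
    moreover have "0 < \<delta> * (8 / 9 - 10 / 9 * \<delta>)" using \<delta> by simp
    ultimately have "1 - \<delta> < (1 - 10 / 9 * \<delta>) * (1 + \<delta>)" by linarith
    then show ?thesis using \<delta> by (simp add: pos_divide_less_eq)
  qed
  ultimately have "(\<delta> - \<epsilon>) + (1 - \<delta>) / (1 + \<delta>) + \<epsilon> / (1 - \<delta>) < 1" by linarith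
  then show "(\<delta> - \<epsilon>) + \<epsilon> / (1 - (M - 3) * \<delta>) + \<epsilon> / (1 - \<delta>) < 1" using ew by (simp add: w_def)
qed

lemma path_core_to_double_star:
  fixes M \<delta> \<epsilon> :: real
  assumes "13 \<le> M" "0 < \<epsilon>" "\<epsilon> \<le> \<delta>" "\<delta> < 1" "(M - 3) * \<delta> < 1"
    and eq: "(\<delta> - \<epsilon>) + \<epsilon> / (1 - (M - 3) * \<delta>) + \<epsilon> / (1 - \<delta>) = 1"
  shows "\<delta> < 1 / 10" "\<epsilon> < (1 - 3 * \<delta>) * (1 - (M - 4) * \<delta>)"
proof -
  have "10 * \<delta> \<le> (M - 3) * \<delta>" using assms by (intro mult_right_mono) auto
  then show \<delta>: "\<delta> < 1 / 10" using assms(5) by linarith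
  define w where "w = 1 - (M - 3) * \<delta>"
  have w: "0 < w" using assms by (simp add: w_def)
  have "0 < \<epsilon> / (1 - \<delta>)" using assms by simp
  then have "\<epsilon> / w < 1" using eq assms(3) unfolding w_def by linarith
  then have "\<epsilon> < w" using w by simp
  moreover have "1 - (M - 4) * \<delta> = w + \<delta>" by (simp add: w_def algebra_simps)
  \<comment> \<open>Moving one pendent edge away from the large vertex adds \<delta> \<ge>
    \<epsilon> to w > \<epsilon>. This doubling outweighs the factor 1 - 3\<delta> > 7 / 10, so no
    exact identity is called for.\<close>
  ultimately have "2 * \<epsilon> \<le> 1 - (M - 4) * \<delta>" using assms by linarith
  then have "7 / 10 * (2 * \<epsilon>) \<le> (1 - 3 * \<delta>) * (1 - (M - 4) * \<delta>)"
    using \<delta> assms by (intro mult_mono) auto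
  then show "\<epsilon> < (1 - 3 * \<delta>) * (1 - (M - 4) * \<delta>)" using assms by linarith
qed

theorem theorem4p1:
  fixes \<alpha> :: real and k n m :: nat and T :: "'a hypergraph"
  assumes "0 \<le> \<alpha>" and "\<alpha> < 1" and "3 \<le> k"
    and "real m = (real n - 1) / (real k - 1)" and "13 \<le> m"
    and "T \<in> supertrees n k - T8 n k"
  shows
    "alpha_spectral_radius \<alpha> k (power_hypergraph k (star_tree (m + 1)))
       > alpha_spectral_radius \<alpha> k (power_hypergraph k (S2_tree 1 (m - 2))) \<and>
     alpha_spectral_radius \<alpha> k (power_hypergraph k (S2_tree 1 (m - 2)))
       > alpha_spectral_radius \<alpha> k (power_hypergraph k (S2_tree 2 (m - 3))) \<and>
     alpha_spectral_radius \<alpha> k (power_hypergraph k (S2_tree 2 (m - 3)))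
       > alpha_spectral_radius \<alpha> k (T3_supertree k 1 1 (m - 3)) \<and>
     alpha_spectral_radius \<alpha> k (T3_supertree k 1 1 (m - 3))
       > alpha_spectral_radius \<alpha> k (power_hypergraph k (S3_tree 1 (m - 4) 1)) \<and>
     alpha_spectral_radius \<alpha> k (power_hypergraph k (S3_tree 1 (m - 4) 1))
       > alpha_spectral_radius \<alpha> k (power_hypergraph k (S3_tree (m - 3) 0 1)) \<and>
     alpha_spectral_radius \<alpha> k (power_hypergraph k (S3_tree (m - 3) 0 1))
       > alpha_spectral_radius \<alpha> k (power_hypergraph k (S2_tree 3 (m - 4))) \<and>
     alpha_spectral_radius \<alpha> k (power_hypergraph k (S2_tree 3 (m - 4)))
       > alpha_spectral_radius \<alpha> k (T3_supertree k 1 2 (m - 4)) \<and>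
     alpha_spectral_radius \<alpha> k (T3_supertree k 1 2 (m - 4))
       > alpha_spectral_radius \<alpha> k T"
proof -
  note \<alpha> = assms(1,2) and k = assms(3)
  have M: "13 \<le> real m" using assms(5) by simp
  have nats: "real (m - 1) = real m - 1" "real (m - 2) = real m - 2" "real (m - 3) = real m - 3"
    "real (m - 4) = real m - 4" using assms(5) by (simp_all add: of_nat_diff)
  have smaller: "(real m - b) * \<delta> < 1" if "(real m - a) * \<delta> < 1" "a \<le> b" "0 < \<delta>" for a b \<delta> :: real
  proof -
    have "(real m - b) * \<delta> \<le> (real m - a) * \<delta>" using that by (intro mult_right_mono) auto
    then show ?thesis using that(1) by linarith
  qed
  have tiny: "\<delta> < 1 / 9" if "(real m - 4) * \<delta> < 1" "0 < \<delta>" for \<delta> :: real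
  proof -
    have "9 * \<delta> \<le> (real m - 4) * \<delta>" using that M by (intro mult_right_mono) auto
    then show ?thesis using that(1) by linarith
  qed
  note pos = eps_gam_pos[OF \<alpha>]
  let ?\<rho> = "alpha_spectral_radius \<alpha> k"
  let ?G1 = "power_hypergraph k (star_tree (m + 1))" and ?G2 = "power_hypergraph k (S2_tree 1 (m - 2))"
    and ?G3 = "power_hypergraph k (S2_tree 2 (m - 3))" and ?G4 = "T3_supertree k 1 1 (m - 3)"
    and ?G5 = "power_hypergraph k (S3_tree 1 (m - 4) 1)" and ?G6 = "power_hypergraph k (S3_tree (m - 3) 0 1)"
    and ?G7 = "power_hypergraph k (S2_tree 3 (m - 4))" and ?G8 = "T3_supertree k 1 2 (m - 4)"
  have G1: "edge_cored k ?G1 (m - 1) 0 0" using star_edge_cored[OF k] assms(5) by simp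
  have G2: "edge_cored k ?G2 1 (m - 2) 0" and G3: "edge_cored k ?G3 2 (m - 3) 0"
    and G7: "edge_cored k ?G7 3 (m - 4) 0" using S2_edge_cored[OF k] by blast+
  have G4: "edge_cored k ?G4 1 1 (m - 3)" and G8: "edge_cored k ?G8 1 2 (m - 4)"
    using T3_edge_cored[OF k] by blast+
  have G5: "path_cored k ?G5 1 (m - 4) 1" and G6: "path_cored k ?G6 (m - 3) 0 1"
    using S3_path_cored[OF k] by blast+
  have "?\<rho> ?G2 < ?\<rho> ?G1"
  proof -
    define \<delta> where "\<delta> = del \<alpha> k (?\<rho> ?G1)"
    note eq = edge_cored_eq[OF G1 k \<alpha> refl \<delta>_def, unfolded nats]
    have \<delta>: "0 < \<delta>" using pos(4)[OF eq(1)] by (simp add: \<delta>_def)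
    have small: "(real m - 2) * \<delta> < 1" "(real m - 4) * \<delta> < 1" using smaller[OF eq(2) _ \<delta>] by auto
    show ?thesis
      by (rule edge_cored_less[OF G2 k \<alpha> eq(1) \<delta>_def, unfolded nats])
        (use small tiny[OF small(2) \<delta>] star_less_double_star[OF M \<delta>] eq(5) in auto)
  qed
  moreover have "?\<rho> ?G3 < ?\<rho> ?G2"
  proof -
    define \<delta> where "\<delta> = del \<alpha> k (?\<rho> ?G2)"
    note eq = edge_cored_eq[OF G2 k \<alpha> refl \<delta>_def, unfolded nats]
    have \<delta>: "0 < \<delta>" using pos(4)[OF eq(1)] by (simp add: \<delta>_def)
    have small: "(real m - 3) * \<delta> < 1" "(real m - 4) * \<delta> < 1" using smaller[OF eq(3) _ \<delta>] by auto
    show ?thesis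
      by (rule edge_cored_less[OF G3 k \<alpha> eq(1) \<delta>_def, unfolded nats])
        (use small tiny[OF small(2) \<delta>] double_star_shift[OF M \<delta>] eq(5) in auto)
  qed
  moreover have "?\<rho> ?G4 < ?\<rho> ?G3"
  proof -
    define \<delta> where "\<delta> = del \<alpha> k (?\<rho> ?G3)"
    note eq = edge_cored_eq[OF G3 k \<alpha> refl \<delta>_def, unfolded nats]
    have \<delta>: "0 < \<delta>" using pos(4)[OF eq(1)] by (simp add: \<delta>_def)
    have small: "(real m - 4) * \<delta> < 1" using smaller[OF eq(3) _ \<delta>] by auto
    \<comment> \<open>Two pendent edges at one core vertex leave 1 - 2\<delta>; moved to two
      vertices they leave (1 - \<delta>)^2, which is larger.\<close>
    have "(1 - 2 * \<delta>) * (1 - (real m - 3) * \<delta>) < (1 - \<delta>) * (1 - \<delta>) * (1 - (real m - 3) * \<delta>)"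
      using eq(3) \<delta> by (intro mult_strict_right_mono) (auto simp: algebra_simps)
    then have lt: "eps \<alpha> k (?\<rho> ?G3) < (1 - \<delta>) * (1 - \<delta>) * (1 - (real m - 3) * \<delta>)"
      using eq(5) by (simp only: of_nat_numeral of_nat_0 mult_zero_left diff_zero mult_1_right)
    show ?thesis
    proof (rule edge_cored_less[OF G4 k \<alpha> eq(1) \<delta>_def, unfolded nats])
      show "eps \<alpha> k (?\<rho> ?G3) < (1 - real 1 * \<delta>) * (1 - real 1 * \<delta>) * (1 - (real m - 3) * \<delta>)"
        using lt by (simp only: of_nat_1 mult_1)
    qed (use tiny[OF small \<delta>] eq(3) in auto)
  qed
  moreover have "?\<rho> ?G5 < ?\<rho> ?G4"
  proof -
    define \<delta> where "\<delta> = del \<alpha> k (?\<rho> ?G4)"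
    define \<epsilon> where "\<epsilon> = eps \<alpha> k (?\<rho> ?G4)"
    note eq = edge_cored_eq[OF G4 k \<alpha> refl \<delta>_def, unfolded nats]
    have \<delta>: "0 < \<delta>" using pos(4)[OF eq(1)] by (simp add: \<delta>_def)
    have "(1 - \<delta>) * (1 - \<delta>) * (1 - (real m - 3) * \<delta>) = \<epsilon>" using eq(5) by (simp add: \<epsilon>_def)
    from edge_core_to_path_core[OF \<delta> _ _ this] show ?thesis
      by (intro path_cored_less[OF G5 k \<alpha> eq(1) \<delta>_def \<epsilon>_def, unfolded nats]) (use eq(2,4) in auto)
  qed
  moreover have "?\<rho> ?G6 < ?\<rho> ?G5"
  proof -
    define \<delta> where "\<delta> = del \<alpha> k (?\<rho> ?G5)"
    define \<epsilon> where "\<epsilon> = eps \<alpha> k (?\<rho> ?G5)"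
    note eq = path_cored_eq[OF G5 k \<alpha> refl \<delta>_def \<epsilon>_def, unfolded nats]
    have \<epsilon>: "0 < \<epsilon>" "\<epsilon> \<le> \<delta>" using pos(1,3)[OF eq(1)] by (simp_all add: \<epsilon>_def \<delta>_def)
    have "(real m - 4) * \<delta> + (\<delta> - \<epsilon>) + \<epsilon> / (1 - \<delta>) + \<epsilon> / (1 - \<delta>) = 1" using eq(4) by simp
    from path_core_shift[OF M \<epsilon> _ this] show ?thesis
      by (intro path_cored_less[OF G6 k \<alpha> eq(1) \<delta>_def \<epsilon>_def, unfolded nats]) (use eq(2) in auto)
  qed
  moreover have "?\<rho> ?G7 < ?\<rho> ?G6"
  proof -
    define \<delta> where "\<delta> = del \<alpha> k (?\<rho> ?G6)"
    define \<epsilon> where "\<epsilon> = eps \<alpha> k (?\<rho> ?G6)"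
    note eq = path_cored_eq[OF G6 k \<alpha> refl \<delta>_def \<epsilon>_def, unfolded nats]
    have \<epsilon>: "0 < \<epsilon>" "\<epsilon> \<le> \<delta>" using pos(1,3)[OF eq(1)] by (simp_all add: \<epsilon>_def \<delta>_def)
    have \<delta>: "0 < \<delta>" using \<epsilon> by linarith
    have "(\<delta> - \<epsilon>) + \<epsilon> / (1 - (real m - 3) * \<delta>) + \<epsilon> / (1 - \<delta>) = 1" using eq(4) by simp
    note step = path_core_to_double_star[OF M \<epsilon> _ eq(2) this]
    show ?thesis
      by (rule edge_cored_less[OF G7 k \<alpha> eq(1) \<delta>_def, unfolded nats])
        (use step smaller[OF eq(2) _ \<delta>, of 4] eq(3) in \<open>auto simp: \<epsilon>_def\<close>)
  qed
  moreover have "?\<rho> ?G8 < ?\<rho> ?G7"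
  proof -
    define \<delta> where "\<delta> = del \<alpha> k (?\<rho> ?G7)"
    note eq = edge_cored_eq[OF G7 k \<alpha> refl \<delta>_def, unfolded nats]
    have \<delta>: "0 < \<delta>" using pos(4)[OF eq(1)] by (simp add: \<delta>_def)
    have "(1 - 3 * \<delta>) * (1 - (real m - 4) * \<delta>) < (1 - \<delta>) * (1 - 2 * \<delta>) * (1 - (real m - 4) * \<delta>)"
      using eq(3) \<delta> by (intro mult_strict_right_mono) (auto simp: algebra_simps)
    then have lt: "eps \<alpha> k (?\<rho> ?G7) < (1 - \<delta>) * (1 - 2 * \<delta>) * (1 - (real m - 4) * \<delta>)"
      using eq(5) by (simp only: of_nat_numeral of_nat_0 mult_zero_left diff_zero mult_1_right)
    show ?thesis
    proof (rule edge_cored_less[OF G8 k \<alpha> eq(1) \<delta>_def, unfolded nats])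
      show "eps \<alpha> k (?\<rho> ?G7) < (1 - real 1 * \<delta>) * (1 - real 2 * \<delta>) * (1 - (real m - 4) * \<delta>)"
        using lt by (simp only: of_nat_1 mult_1 of_nat_numeral)
    qed (use tiny[OF eq(3) \<delta>] eq(3) in auto)
  qed
  moreover have "?\<rho> T < ?\<rho> ?G8"
  proof -
    have T: "uniform_hypergraph k T" "card (verts T) = n" "hconnected T" "\<nexists>vs es. is_cycle T vs es"
      using assms(6) by (auto simp: supertrees_def)
    have "real m * (real k - 1) = real n - 1" using assms(3,4) by simp
    then have "real n = real (m * (k - 1) + 1)" using k by (simp add: of_nat_diff)
    then have n: "n = m * (k - 1) + 1" by linarith
    then have m: "(n - 1) div (k - 1) = m" using k by simp
    \<comment> \<open>A connected hypergraph without edges has a single vertex, whereas n = m (k -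
      1) + 1 is larger.\<close>
    have ne: "hedges T \<noteq> {}"
    proof
      assume "hedges T = {}"
      then have "\<And>u v. u \<in> verts T \<Longrightarrow> v \<in> verts T \<Longrightarrow> u = v"
        using T(3) by (auto simp: hconnected_def)
      then have "card (verts T) \<le> 1" using T(1) by (simp add: uniform_hypergraph_def card_le_Suc0_iff_eq)
      then show False using T(2) n assms(5) k by simp
    qed
    interpret T: supertree k T 
      by (intro supertree.intro conn_hypergraph.intro supertree_axioms.intro k T(1,3,4) ne)
    have mT: "card (hedges T) = m" using T.card_verts T(2) n k by simp
    have no: "\<not> T \<cong>\<^sub>h ?G1" "\<not> T \<cong>\<^sub>h ?G2" "\<not> T \<cong>\<^sub>h ?G3" "\<not> T \<cong>\<^sub>h ?G4"
      "\<not> T \<cong>\<^sub>h ?G5" "\<not> T \<cong>\<^sub>h ?G6" "\<not> T \<cong>\<^sub>h ?G7" "\<not> T \<cong>\<^sub>h ?G8"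
      using assms(6) unfolding T8_def m Let_def by simp_all
    have iso: "\<not> edge_cored k T (m - 1) 0 0" "\<not> edge_cored k T 1 (m - 2) 0"
      "\<not> edge_cored k T 2 (m - 3) 0" "\<not> edge_cored k T 1 1 (m - 3)" "\<not> path_cored k T 1 (m - 4) 1"
      "\<not> path_cored k T (m - 3) 0 1" "\<not> edge_cored k T 3 (m - 4) 0" "\<not> edge_cored k T 1 2 (m - 4)"
      using no(1-8) edge_cored_iso[OF _ G1, of T] edge_cored_iso[OF _ G2, of T] edge_cored_iso[OF _ G3, of T]
        edge_cored_iso[OF _ G4, of T] path_cored_iso[OF _ G5, of T] path_cored_iso[OF _ G6, of T]
        edge_cored_iso[OF _ G7, of T] edge_cored_iso[OF _ G8, of T]
      by auto
    define \<delta> where "\<delta> = del \<alpha> k (?\<rho> ?G8)"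
    define \<epsilon> where "\<epsilon> = eps \<alpha> k (?\<rho> ?G8)"
    note eq8 = edge_cored_eq[OF G8 k \<alpha> refl \<delta>_def, unfolded nats]
    \<comment> \<open>The parameters come from T(1,2,m-4), whereas the combinatorial assumptions are
      about T and express that it is isomorphic to none of the eight.\<close>
    interpret comparison k T \<delta> \<epsilon>
    proof unfold_locales
      show "13 \<le> card (hedges T)" using mT assms(5) by simp
      show "0 < \<epsilon>" "\<epsilon> \<le> \<delta>" using pos(1,3)[OF eq8(1)] by (simp_all add: \<epsilon>_def \<delta>_def)
      show "(real (card (hedges T)) - 4) * \<delta> < 1" using eq8(4) mT by simp
      show "(1 - \<delta>) * (1 - 2 * \<delta>) * (1 - (real (card (hedges T)) - 4) * \<delta>) = \<epsilon>"
        using eq8(5) mT by (simp add: \<epsilon>_def)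
    next
      fix v assume "v \<in> verts T"
      then have "\<not> m - 2 \<le> vdegree T v" using T.large_degree[of v m] mT assms(5) iso by auto
      then show "vdegree T v \<le> card (hedges T) - 3" using mT by linarith
    next
      fix e r w assume e: "e \<in> hedges T" "{r, w} \<subseteq> e" "r \<noteq> w" "vdegree T r = card (hedges T) - 3"
      show "vdegree T w \<noteq> 4"
      proof
        assume "vdegree T w = 4"
        then have "edge_cored k T (vdegree T w - 1) (vdegree T r - 1) 0"
          using e mT assms(5) by (intro T.edge_cored_two[of e]) auto
        moreover have "m - 3 - 1 = m - 4" by simp
        ultimately show False using iso(7) \<open>vdegree T w = 4\<close> e(4) mT by simp
      qed
    next
      fix e r w w' assume e: "e \<in> hedges T" "{r, w, w'} \<subseteq> e" "r \<noteq> w" "r \<noteq> w'" "w \<noteq> w'"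
        "vdegree T r = card (hedges T) - 3" "vdegree T w = 3"
      show "vdegree T w' \<noteq> 2"
      proof
        assume w': "vdegree T w' = 2"
        then have "edge_cored k T (vdegree T w' - 1) (vdegree T w - 1) (vdegree T r - 1)"
          using e mT assms(5) by (intro T.edge_coredI[of e]) auto
        moreover have "m - 3 - 1 = m - 4" by simp
        ultimately show False using iso(8) w' e(6,7) mT by simp
      qed
    qed
    show ?thesis using rho_less_comparison[OF \<alpha> eq8(1) \<delta>_def \<epsilon>_def] .
  qed
  ultimately show ?thesis by (intro conjI)
qed

end
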